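(* Let $\mathcal{C}$ be a $2$-Calabi-Yau triangulated category and let $T,T'$ be cluster tilting objects in $\mathcal{C}$. Then $\Gamma_T$ is connected if and only if $\Gamma_{T'}$ is connected.
   Context: Fix a field $k$. All triangulated categories are $k$-linear, Hom-finite and Krull-Schmidt, with shift functor $[1]$; $\mathrm{Ext}^n(X,Y)=\mathrm{Hom}(X,Y[n])$. $\mathcal{C}$ is $2$-Calabi-Yau if $[2]$ is a Serre functor: $\mathrm{Hom}(X,Y)\cong \mathrm{Hom}_k(\mathrm{Hom}(Y,X[2]),k)$ functorially. An object $T$ is cluster tilting if $\mathrm{Ext}^1(T,T)=0$ and every object $C\in\mathcal{C}$ admits a triangle $T_0\to C\to T_1[1]\to T_0[1]$ with $T_0,T_1\in\mathrm{add}\,T$ (the closure of $T$ under finite direct sums and direct summands). For a cluster tilting object $T$, $\Gamma_T$ denotes the Gabriel quiver of the finite-dimensional algebra $\mathrm{End}(T)$. *)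

theory Defs
  imports Complex_Main "HOL-Library.FuncSet"
begin

section \<open>Quivers\<close>

text \<open>
  A quiver, up to isomorphism, is given by its vertices and, for every ordered pair of vertices,
  the number of arrows from the first to the second.
\<close>

record 'v quiver =
  verts :: "'v set"
  arrows :: "'v \<Rightarrow> 'v \<Rightarrow> nat"

definition adjacency :: "'v quiver \<Rightarrow> ('v \<times> 'v) set" where
  "adjacency Q = {(v, w). v \<in> verts Q \<and> w \<in> verts Q \<and> (arrows Q v w > 0 \<or> arrows Q w v > 0)}"

text \<open>The empty quiver, which belongs to the zero algebra, is not counted as connected.\<close>

definition connected_quiver :: "'v quiver \<Rightarrow> bool" where
  "connected_quiver Q \<longleftrightarrow>
     verts Q \<noteq> {} \<and> (\<forall>v \<in> verts Q. \<forall>w \<in> verts Q. (v, w) \<in> (adjacency Q)\<^sup>*)"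


section \<open>Algebras over a field and their Gabriel quivers\<close>

text \<open>
  The underlying vector space of an algebra is a subspace of the ambient vector space given by
  the type \<open>'a\<close> and the scalar multiplication \<open>scal A\<close>.
\<close>

record ('a, 'k) alg =
  carr :: "'a set"
  mult :: "'a \<Rightarrow> 'a \<Rightarrow> 'a"  (infixl "\<cdot>\<index>" 70)
  unit :: "'a"  ("\<one>\<index>")
  scal :: "'k \<Rightarrow> 'a \<Rightarrow> 'a"

definition alg_unit :: "('a::ab_group_add, 'k::field) alg \<Rightarrow> 'a \<Rightarrow> bool" where
  "alg_unit A x \<longleftrightarrow>
     x \<in> carr A \<and> (\<exists>y \<in> carr A. x \<cdot>\<^bsub>A\<^esub> y = \<one>\<^bsub>A\<^esub> \<and> y \<cdot>\<^bsub>A\<^esub> x = \<one>\<^bsub>A\<^esub>)"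

definition local_alg :: "('a::ab_group_add, 'k::field) alg \<Rightarrow> bool" where
  "local_alg A \<longleftrightarrow> \<one>\<^bsub>A\<^esub> \<noteq> 0 \<and>
     (\<forall>x \<in> carr A. \<forall>y \<in> carr A. \<not> alg_unit A x \<longrightarrow> \<not> alg_unit A y \<longrightarrow> \<not> alg_unit A (x + y))"

definition left_ideal :: "('a::ab_group_add, 'k::field) alg \<Rightarrow> 'a set \<Rightarrow> bool" where
  "left_ideal A L \<longleftrightarrow> L \<subseteq> carr A \<and> 0 \<in> L \<and> (\<forall>x \<in> L. \<forall>y \<in> L. x + y \<in> L) \<and>
     (\<forall>a \<in> carr A. \<forall>x \<in> L. a \<cdot>\<^bsub>A\<^esub> x \<in> L)"

definition maximal_left_ideal :: "('a::ab_group_add, 'k::field) alg \<Rightarrow> 'a set \<Rightarrow> bool" where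
  "maximal_left_ideal A M \<longleftrightarrow> left_ideal A M \<and> M \<noteq> carr A \<and>
     (\<forall>L. left_ideal A L \<longrightarrow> M \<subseteq> L \<longrightarrow> L = M \<or> L = carr A)"

definition rad :: "('a::ab_group_add, 'k::field) alg \<Rightarrow> 'a set" where
  "rad A = {x \<in> carr A. \<forall>M. maximal_left_ideal A M \<longrightarrow> x \<in> M}"

definition rad_square :: "('a::ab_group_add, 'k::field) alg \<Rightarrow> 'a set" where
  "rad_square A = module.span (scal A) {x \<cdot>\<^bsub>A\<^esub> y | x y. x \<in> rad A \<and> y \<in> rad A}"

definition idempotent :: "('a::ab_group_add, 'k::field) alg \<Rightarrow> 'a \<Rightarrow> bool" where
  "idempotent A e \<longleftrightarrow> e \<in> carr A \<and> e \<cdot>\<^bsub>A\<^esub> e = e"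

definition primitive_idempotent :: "('a::ab_group_add, 'k::field) alg \<Rightarrow> 'a \<Rightarrow> bool" where
  "primitive_idempotent A e \<longleftrightarrow> idempotent A e \<and> e \<noteq> 0 \<and>
     \<not> (\<exists>e1 e2. idempotent A e1 \<and> idempotent A e2 \<and> e1 \<noteq> 0 \<and> e2 \<noteq> 0 \<and>
           e1 \<cdot>\<^bsub>A\<^esub> e2 = 0 \<and> e2 \<cdot>\<^bsub>A\<^esub> e1 = 0 \<and> e = e1 + e2)"

definition left_proj :: "('a::ab_group_add, 'k::field) alg \<Rightarrow> 'a \<Rightarrow> 'a set" where
  "left_proj A e = {a \<cdot>\<^bsub>A\<^esub> e | a. a \<in> carr A}"

text \<open>Isomorphism of the left modules \<open>A e\<close> and \<open>A f\<close>.\<close>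

definition proj_iso :: "('a::ab_group_add, 'k::field) alg \<Rightarrow> 'a \<Rightarrow> 'a \<Rightarrow> bool" where
  "proj_iso A e f \<longleftrightarrow>
     (\<exists>\<phi>. bij_betw \<phi> (left_proj A e) (left_proj A f) \<and>
          (\<forall>x \<in> left_proj A e. \<forall>y \<in> left_proj A e. \<phi> (x + y) = \<phi> x + \<phi> y) \<and>
          (\<forall>a \<in> carr A. \<forall>x \<in> left_proj A e. \<phi> (a \<cdot>\<^bsub>A\<^esub> x) = a \<cdot>\<^bsub>A\<^esub> \<phi> x))"

text \<open>
  A vertex is a class of primitive idempotents \<open>e\<close> with isomorphic indecomposable projective
  modules \<open>A e\<close>; picking one idempotent from every class amounts to passing to the basic algebra.
  The number of arrows is the dimension over the ground field of
  \<open>e (rad A / rad\<^sup>2 A) f = e (rad A) f / e (rad\<^sup>2 A) f\<close>, which does not depend on the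
  choice of \<open>e\<close> and \<open>f\<close> in their classes. For finite-dimensional \<open>A\<close> the difference below is
  this dimension, and the truncated subtraction does no harm since \<open>rad\<^sup>2 A \<subseteq> rad A\<close>.
\<close>

definition arrow_number :: "('a::ab_group_add, 'k::field) alg \<Rightarrow> 'a \<Rightarrow> 'a \<Rightarrow> nat" where
  "arrow_number A e f =
     vector_space.dim (scal A) {e \<cdot>\<^bsub>A\<^esub> x \<cdot>\<^bsub>A\<^esub> f | x. x \<in> rad A} -
     vector_space.dim (scal A) {e \<cdot>\<^bsub>A\<^esub> x \<cdot>\<^bsub>A\<^esub> f | x. x \<in> rad_square A}"

definition gabriel_quiver :: "('a::ab_group_add, 'k::field) alg \<Rightarrow> 'a set quiver" where
  "gabriel_quiver A =
     \<lparr> verts = {e. primitive_idempotent A e} //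
                 {(e, f). primitive_idempotent A e \<and> primitive_idempotent A f \<and> proj_iso A e f},
       arrows = (\<lambda>V W. arrow_number A (SOME e. e \<in> V) (SOME f. f \<in> W)) \<rparr>"


section \<open>Linear categories\<close>

text \<open>
  The spaces of morphisms are subspaces of one ambient vector space, given by the type \<open>'m\<close> and the
  scalar multiplication \<open>Scal C\<close>. Every small linear category has this form up to isomorphism:
  take the direct sum of all its spaces of morphisms as ambient space, and extend composition
  bilinearly, by zero on pairs of morphisms that are not composable.
  \<open>Comp C g f\<close> is \<open>g\<close> after \<open>f\<close>.
\<close>

record ('o, 'm, 'k) lin_cat =
  Obj :: "'o set"
  Hom :: "'o \<Rightarrow> 'o \<Rightarrow> 'm set"
  Comp :: "'m \<Rightarrow> 'm \<Rightarrow> 'm"  (infixl "\<odot>\<index>" 70)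
  Id :: "'o \<Rightarrow> 'm"
  Scal :: "'k \<Rightarrow> 'm \<Rightarrow> 'm"

definition iso_mor ::
  "('o, 'm::ab_group_add, 'k::field, 'z) lin_cat_scheme \<Rightarrow> 'o \<Rightarrow> 'o \<Rightarrow> 'm \<Rightarrow> bool" where
  "iso_mor C X Y f \<longleftrightarrow>
     f \<in> Hom C X Y \<and> (\<exists>g \<in> Hom C Y X. g \<odot>\<^bsub>C\<^esub> f = Id C X \<and> f \<odot>\<^bsub>C\<^esub> g = Id C Y)"

definition zero_object :: "('o, 'm::ab_group_add, 'k::field, 'z) lin_cat_scheme \<Rightarrow> 'o \<Rightarrow> bool" where
  "zero_object C Z \<longleftrightarrow> Z \<in> Obj C \<and> (\<forall>X \<in> Obj C. Hom C X Z = {0} \<and> Hom C Z X = {0})"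

text \<open>
  \<open>Z\<close> is a direct sum of the finite list \<open>Xs\<close> of objects. The direct sums of the empty list are
  the zero objects.
\<close>

definition direct_sum ::
  "('o, 'm::ab_group_add, 'k::field, 'z) lin_cat_scheme \<Rightarrow> 'o list \<Rightarrow> 'o \<Rightarrow> bool" where
  "direct_sum C Xs Z \<longleftrightarrow> set Xs \<subseteq> Obj C \<and> Z \<in> Obj C \<and>
     (\<exists>\<iota> \<pi>. (\<forall>i < length Xs. \<iota> i \<in> Hom C (Xs ! i) Z \<and> \<pi> i \<in> Hom C Z (Xs ! i)) \<and>
            (\<forall>i < length Xs. \<forall>j < length Xs.
               \<pi> j \<odot>\<^bsub>C\<^esub> \<iota> i = (if i = j then Id C (Xs ! i) else 0)) \<and>
            (\<Sum>i < length Xs. \<iota> i \<odot>\<^bsub>C\<^esub> \<pi> i) = Id C Z)"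

definition End_alg ::
  "('o, 'm::ab_group_add, 'k::field, 'z) lin_cat_scheme \<Rightarrow> 'o \<Rightarrow> ('m, 'k) alg" where
  "End_alg C X = \<lparr> carr = Hom C X X, mult = Comp C, unit = Id C X, scal = Scal C \<rparr>"

text \<open>The closure of an object under finite direct sums and direct summands.\<close>

inductive_set add_closure ::
  "('o, 'm::ab_group_add, 'k::field, 'z) lin_cat_scheme \<Rightarrow> 'o \<Rightarrow> 'o set"
  for C :: "('o, 'm::ab_group_add, 'k::field, 'z) lin_cat_scheme" and T :: 'o where
  base: "T \<in> add_closure C T"
| sum: "\<lbrakk>\<forall>X \<in> set Xs. X \<in> add_closure C T; direct_sum C Xs Z\<rbrakk> \<Longrightarrow> Z \<in> add_closure C T"
| summand: "\<lbrakk>Z \<in> add_closure C T; direct_sum C Xs Z; X \<in> set Xs\<rbrakk> \<Longrightarrow> X \<in> add_closure C T"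

locale linear_category = vector_space "Scal C"
  for C :: "('o, 'm::ab_group_add, 'k::field, 'z) lin_cat_scheme" (structure) +
  assumes Hom_subspace: "\<lbrakk>X \<in> Obj C; Y \<in> Obj C\<rbrakk> \<Longrightarrow> subspace (Hom C X Y)"
    and Id_in: "X \<in> Obj C \<Longrightarrow> Id C X \<in> Hom C X X"
    and Comp_in: "\<lbrakk>X \<in> Obj C; Y \<in> Obj C; Z \<in> Obj C; f \<in> Hom C X Y; g \<in> Hom C Y Z\<rbrakk>
                    \<Longrightarrow> g \<odot> f \<in> Hom C X Z"
    and Comp_assoc: "\<lbrakk>W \<in> Obj C; X \<in> Obj C; Y \<in> Obj C; Z \<in> Obj C;
                       f \<in> Hom C W X; g \<in> Hom C X Y; h \<in> Hom C Y Z\<rbrakk>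
                    \<Longrightarrow> h \<odot> g \<odot> f = h \<odot> (g \<odot> f)"
    and Id_left: "\<lbrakk>X \<in> Obj C; Y \<in> Obj C; f \<in> Hom C X Y\<rbrakk> \<Longrightarrow> Id C Y \<odot> f = f"
    and Id_right: "\<lbrakk>X \<in> Obj C; Y \<in> Obj C; f \<in> Hom C X Y\<rbrakk> \<Longrightarrow> f \<odot> Id C X = f"
    and Comp_add_left: "\<lbrakk>X \<in> Obj C; Y \<in> Obj C; Z \<in> Obj C;
                          f \<in> Hom C X Y; g \<in> Hom C Y Z; g' \<in> Hom C Y Z\<rbrakk>
                    \<Longrightarrow> (g + g') \<odot> f = g \<odot> f + g' \<odot> f"
    and Comp_add_right: "\<lbrakk>X \<in> Obj C; Y \<in> Obj C; Z \<in> Obj C;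
                           f \<in> Hom C X Y; f' \<in> Hom C X Y; g \<in> Hom C Y Z\<rbrakk>
                    \<Longrightarrow> g \<odot> (f + f') = g \<odot> f + g \<odot> f'"
    and Comp_scal_left: "\<lbrakk>X \<in> Obj C; Y \<in> Obj C; Z \<in> Obj C; f \<in> Hom C X Y; g \<in> Hom C Y Z\<rbrakk>
                    \<Longrightarrow> Scal C \<mu> g \<odot> f = Scal C \<mu> (g \<odot> f)"
    and Comp_scal_right: "\<lbrakk>X \<in> Obj C; Y \<in> Obj C; Z \<in> Obj C; f \<in> Hom C X Y; g \<in> Hom C Y Z\<rbrakk>
                    \<Longrightarrow> g \<odot> Scal C \<mu> f = Scal C \<mu> (g \<odot> f)"
    and direct_sum_exists: "set Xs \<subseteq> Obj C \<Longrightarrow> \<exists>Z. direct_sum C Xs Z"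

locale hom_finite_category = linear_category +
  assumes hom_finite: "\<lbrakk>X \<in> Obj C; Y \<in> Obj C\<rbrakk> \<Longrightarrow> \<exists>B. finite B \<and> span B = Hom C X Y"

locale krull_schmidt_category = linear_category +
  assumes krull_schmidt:
    "X \<in> Obj C \<Longrightarrow> \<exists>Xs. direct_sum C Xs X \<and> (\<forall>Y \<in> set Xs. local_alg (End_alg C Y))"


section \<open>Triangulated categories\<close>

text \<open>
  \<open>Sh\<close> and \<open>ShM\<close> are the action of the shift functor \<open>[1]\<close> on objects and on morphisms, and
  \<open>Tri C X Y Z f g h\<close> says that \<open>X \<rightarrow> Y \<rightarrow> Z \<rightarrow> X[1]\<close>, with the maps
  \<open>f\<close>, \<open>g\<close>, \<open>h\<close>, is a distinguished triangle.
\<close>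

record ('o, 'm, 'k) tri_cat = "('o, 'm, 'k) lin_cat" +
  Sh :: "'o \<Rightarrow> 'o"
  ShM :: "'m \<Rightarrow> 'm"
  Tri :: "'o \<Rightarrow> 'o \<Rightarrow> 'o \<Rightarrow> 'm \<Rightarrow> 'm \<Rightarrow> 'm \<Rightarrow> bool"

text \<open>
  The shift is a linear autoequivalence, not necessarily an automorphism.
\<close>

locale triangulated_category = linear_category C
  for C :: "('o, 'm::ab_group_add, 'k::field, 'z) tri_cat_scheme" (structure) +
  assumes Sh_in: "X \<in> Obj C \<Longrightarrow> Sh C X \<in> Obj C"
    and ShM_bij: "\<lbrakk>X \<in> Obj C; Y \<in> Obj C\<rbrakk>
                    \<Longrightarrow> bij_betw (ShM C) (Hom C X Y) (Hom C (Sh C X) (Sh C Y))"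
    and ShM_Id: "X \<in> Obj C \<Longrightarrow> ShM C (Id C X) = Id C (Sh C X)"
    and ShM_Comp: "\<lbrakk>X \<in> Obj C; Y \<in> Obj C; Z \<in> Obj C; f \<in> Hom C X Y; g \<in> Hom C Y Z\<rbrakk>
                    \<Longrightarrow> ShM C (g \<odot> f) = ShM C g \<odot> ShM C f"
    and ShM_add: "\<lbrakk>X \<in> Obj C; Y \<in> Obj C; f \<in> Hom C X Y; f' \<in> Hom C X Y\<rbrakk>
                    \<Longrightarrow> ShM C (f + f') = ShM C f + ShM C f'"
    and ShM_scal: "\<lbrakk>X \<in> Obj C; Y \<in> Obj C; f \<in> Hom C X Y\<rbrakk>
                    \<Longrightarrow> ShM C (Scal C \<mu> f) = Scal C \<mu> (ShM C f)"
    and Sh_ess_surj: "Y \<in> Obj C \<Longrightarrow> \<exists>X \<in> Obj C. \<exists>f. iso_mor C (Sh C X) Y f"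
    and Tri_in: "Tri C X Y Z f g h \<Longrightarrow>
                   X \<in> Obj C \<and> Y \<in> Obj C \<and> Z \<in> Obj C \<and>
                   f \<in> Hom C X Y \<and> g \<in> Hom C Y Z \<and> h \<in> Hom C Z (Sh C X)"
    and TR1_iso: "\<lbrakk>Tri C X Y Z f g h; X' \<in> Obj C; Y' \<in> Obj C; Z' \<in> Obj C;
                    f' \<in> Hom C X' Y'; g' \<in> Hom C Y' Z'; h' \<in> Hom C Z' (Sh C X');
                    iso_mor C X X' a; iso_mor C Y Y' b; iso_mor C Z Z' c;
                    b \<odot> f = f' \<odot> a; c \<odot> g = g' \<odot> b; ShM C a \<odot> h = h' \<odot> c\<rbrakk>
                    \<Longrightarrow> Tri C X' Y' Z' f' g' h'"
    and TR1_Id: "\<lbrakk>X \<in> Obj C; zero_object C Z\<rbrakk> \<Longrightarrow> Tri C X X Z (Id C X) 0 0"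
    and TR1_cone: "\<lbrakk>X \<in> Obj C; Y \<in> Obj C; f \<in> Hom C X Y\<rbrakk> \<Longrightarrow> \<exists>Z g h. Tri C X Y Z f g h"
    and TR2: "\<lbrakk>X \<in> Obj C; Y \<in> Obj C; Z \<in> Obj C;
                f \<in> Hom C X Y; g \<in> Hom C Y Z; h \<in> Hom C Z (Sh C X)\<rbrakk>
                    \<Longrightarrow> Tri C X Y Z f g h \<longleftrightarrow> Tri C Y Z (Sh C X) g h (- ShM C f)"
    and TR3: "\<lbrakk>Tri C X Y Z f g h; Tri C X' Y' Z' f' g' h';
                a \<in> Hom C X X'; b \<in> Hom C Y Y'; b \<odot> f = f' \<odot> a\<rbrakk>
                    \<Longrightarrow> \<exists>c \<in> Hom C Z Z'. c \<odot> g = g' \<odot> b \<and> ShM C a \<odot> h = h' \<odot> c"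
    and TR4: "\<lbrakk>Tri C X Y Z' f j k; Tri C Y Z X' g l i; Tri C X Z Y' (g \<odot> f) m n\<rbrakk>
                    \<Longrightarrow> \<exists>u v. Tri C Z' Y' X' u v (ShM C j \<odot> i) \<and>
                              u \<odot> j = m \<odot> g \<and> n \<odot> u = k \<and> v \<odot> m = l \<and> i \<odot> v = ShM C f \<odot> n"


section \<open>Calabi--Yau duality and cluster tilting objects\<close>

text \<open>The linear dual of the space of morphisms from \<open>X\<close> to \<open>Y\<close>.\<close>

definition dual_Hom ::
  "('o, 'm::ab_group_add, 'k::field, 'z) lin_cat_scheme \<Rightarrow> 'o \<Rightarrow> 'o \<Rightarrow> ('m \<Rightarrow> 'k) set" where
  "dual_Hom C X Y =
     {l \<in> extensional (Hom C X Y).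
        (\<forall>x \<in> Hom C X Y. \<forall>y \<in> Hom C X Y. l (x + y) = l x + l y) \<and>
        (\<forall>\<mu>. \<forall>x \<in> Hom C X Y. l (Scal C \<mu> x) = \<mu> * l x)}"

text \<open>
  \<open>\<phi> X Y\<close> is an isomorphism from \<open>Hom(X, Y)\<close> to the dual of \<open>Hom(Y, X[2])\<close>, natural in both
  arguments.
\<close>

definition serre_duality_2 ::
  "('o, 'm::ab_group_add, 'k::field, 'z) tri_cat_scheme \<Rightarrow> ('o \<Rightarrow> 'o \<Rightarrow> 'm \<Rightarrow> 'm \<Rightarrow> 'k) \<Rightarrow> bool" where
  "serre_duality_2 C \<phi> \<longleftrightarrow>
     (\<forall>X \<in> Obj C. \<forall>Y \<in> Obj C.
        bij_betw (\<phi> X Y) (Hom C X Y) (dual_Hom C Y (Sh C (Sh C X))) \<and>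
        (\<forall>f \<in> Hom C X Y. \<forall>f' \<in> Hom C X Y. \<forall>h \<in> Hom C Y (Sh C (Sh C X)).
           \<phi> X Y (f + f') h = \<phi> X Y f h + \<phi> X Y f' h) \<and>
        (\<forall>\<mu>. \<forall>f \<in> Hom C X Y. \<forall>h \<in> Hom C Y (Sh C (Sh C X)).
           \<phi> X Y (Scal C \<mu> f) h = \<mu> * \<phi> X Y f h)) \<and>
     (\<forall>X \<in> Obj C. \<forall>Y \<in> Obj C. \<forall>X' \<in> Obj C. \<forall>Y' \<in> Obj C.
        \<forall>a \<in> Hom C X' X. \<forall>f \<in> Hom C X Y. \<forall>b \<in> Hom C Y Y'. \<forall>h \<in> Hom C Y' (Sh C (Sh C X')).
          \<phi> X' Y' (b \<odot>\<^bsub>C\<^esub> f \<odot>\<^bsub>C\<^esub> a) h = \<phi> X Y f (ShM C (ShM C a) \<odot>\<^bsub>C\<^esub> h \<odot>\<^bsub>C\<^esub> b))"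

locale two_calabi_yau_category =
  triangulated_category C + hom_finite_category C + krull_schmidt_category C
  for C :: "('o, 'm::ab_group_add, 'k::field, 'z) tri_cat_scheme" (structure) +
  assumes two_calabi_yau: "\<exists>\<phi>. serre_duality_2 C \<phi>"

definition cluster_tilting ::
  "('o, 'm::ab_group_add, 'k::field, 'z) tri_cat_scheme \<Rightarrow> 'o \<Rightarrow> bool" where
  "cluster_tilting C T \<longleftrightarrow> T \<in> Obj C \<and> Hom C T (Sh C T) = {0} \<and>
     (\<forall>X \<in> Obj C. \<exists>T0 \<in> add_closure C T. \<exists>T1 \<in> add_closure C T. \<exists>f g h.
        Tri C T0 X (Sh C T1) f g h)"

end

theory Submission
  imports Defs
begin

text \<open>
  A finite-dimensional algebra has a connected quiver iff it is nonzero and has no central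
  idempotent besides \<open>0\<close> and \<open>1\<close>. So it suffices to transport central idempotents from \<open>End(T)\<close> to
  \<open>End(T')\<close>, and this is done by extending a central idempotent \<open>f\<close> of \<open>End(T)\<close> to an idempotent
  endomorphism of the identity functor of the category that commutes with the shift. On \<open>add T\<close>
  the extension is forced. On an arbitrary \<open>X\<close> it is obtained from a triangle
  \<open>P \<rightarrow> X \<rightarrow> Q[1]\<close> with \<open>P, Q\<close> in \<open>add T\<close> by completing to a morphism of triangles, which is
  idempotent up to a square-zero endomorphism. Naturality amounts to naturality with respect to
  maps \<open>Q[1] \<rightarrow> P\<close>; by duality these are controlled by maps \<open>P \<rightarrow> Q[3]\<close>, and those by the
  triangle of \<open>Q[2]\<close>, where the extension is \<open>f[2]\<close> because \<open>T\<close> is rigid. The extension does not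
  vanish on \<open>T'\<close> unless \<open>f = 0\<close>, because \<open>T\<close> itself lies in a triangle \<open>P' \<rightarrow> T \<rightarrow> Q'[1]\<close> with
  \<open>P', Q'\<close> in \<open>add T'\<close>.
\<close>

section \<open>Finite-dimensional algebras\<close>

text \<open>A morphism of triangles can be completed but not uniquely, so neither the value on
  \<open>X\<close> nor its naturality can be read off a triangle directly. Idempotents remove this
  obstacle. For idempotents \<open>e\<close>, \<open>e'\<close> the commutator
  \<open>e' x - x e\<close> has only off-diagonal components, and if it is itself compatible with
  \<open>e\<close> and \<open>e'\<close> it must vanish. Along a triangle
  \<open>A \<rightarrow> X \<rightarrow> B\<close> exactness factors the commutator through one end,
  so compatibility at both ends passes to the middle, on the source side and on the target side
  alike. What remains are pairs of ends: maps \<open>P \<rightarrow> Q[1]\<close> vanish, and maps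
  between objects of \<open>add T\<close> or between their shifts are under control.

  On the algebra side, over an arbitrary field the algebra need not be a quotient of a path algebra.
  Missing arrows are therefore read as the inclusion of a corner of the radical \<open>J\<close> in
  \<open>J^2\<close>, and nilpotency of \<open>J\<close> does the rest.\<close>

context vector_space
begin

section \<open>Linear algebra: dimension arguments and functionals\<close>

lemma subspace_eq_if_dim_le:
  assumes "finite B" "subspace S" "S \<subseteq> T" "T \<subseteq> span B" "dim T \<le> dim S"
  shows "S = T"
proof -
  obtain BS where BS: "BS \<subseteq> S" "independent BS" "S \<subseteq> span BS" "card BS = dim S"
    using basis_exists by blast
  obtain BT where BT: "BS \<subseteq> BT" "BT \<subseteq> T" "independent BT" "T \<subseteq> span BT"
    using maximal_independent_subset_extend[of BS T] BS assms(3) by blast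
  \<comment> \<open>The bound by a finite span matters: in infinite dimension \<open>dim\<close> is
    the default 0, and comparing dimensions would say nothing.\<close>
  have fin: "finite BT"
    using independent_span_bound[OF assms(1) BT(3)] BT(2) assms(4) by blast
  have "card BT = dim T"
    using basis_card_eq_dim BT by blast
  hence "BS = BT"
    using card_seteq[OF fin BT(1)] BS(4) assms(5) by simp
  hence "T \<subseteq> span S"
    using BT(4) BS(1) span_mono by blast
  thus ?thesis
    using assms(2,3) span_eq_iff by blast
qed

lemma descending_chain_stationary:
  fixes S :: "nat \<Rightarrow> 'b set"
  assumes "finite B" "\<And>n. subspace (S n)" "\<And>n. S n \<subseteq> span B" "antimono S"
  shows "\<exists>N. \<forall>n\<ge>N. S n = S N"
proof -
  obtain N where N: "\<And>n. dim (S N) \<le> dim (S n)"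
    using ex_has_least_nat[of "\<lambda>_. True" 0 "\<lambda>n. dim (S n)"] by auto
  have "S n = S N" if "n \<ge> N" for n
    using subspace_eq_if_dim_le[OF assms(1,2) antimonoD[OF assms(4) that] assms(3) N] .
  thus ?thesis by blast
qed

lemma ascending_chain_stationary:
  fixes S :: "nat \<Rightarrow> 'b set"
  assumes "finite B" "\<And>n. subspace (S n)" "\<And>n. S n \<subseteq> span B" "mono S"
  shows "\<exists>N. \<forall>n\<ge>N. S n = S N"
proof -
  have "\<forall>n. True \<longrightarrow> dim (S n) < Suc (card B)"
    using dim_le_card[OF assms(3,1)] by (simp add: less_Suc_eq_le)
  then obtain N where N: "\<And>n. dim (S n) \<le> dim (S N)"
    using ex_has_greatest_nat[of "\<lambda>_. True" 0 "\<lambda>n. dim (S n)" "Suc (card B)"]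
    by (metis less_imp_le)
  have "S N = S n" if "n \<ge> N" for n
    using subspace_eq_if_dim_le[OF assms(1,2) monoD[OF assms(4) that] assms(3) N] .
  thus ?thesis by blast
qed

text \<open>The functional is the coordinate at \<open>h\<close> in a basis that contains
  \<open>h\<close>. It serves to test morphisms against the dual spaces in Serre duality.\<close>

lemma separating_functional:
  assumes "h \<noteq> 0"
  shows "\<exists>l. (\<forall>x y. l (x + y) = l x + l y) \<and> (\<forall>\<mu> x. l (scale \<mu> x) = \<mu> * l x) \<and> l h \<noteq> 0"
proof -
  have i: "independent {h}" using assms by (simp add: independent_insert)
  note B = extend_basis_superset[OF i] independent_extend_basis[OF i] span_extend_basis[OF i]
  let ?l = "\<lambda>v. representation (extend_basis {h}) v h"
  have "?l h = 1" using representation_basis[OF B(2), of h] B(1) by simp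
  moreover have "?l (x + y) = ?l x + ?l y" for x y
    using representation_add[OF B(2)] B(3) by simp
  moreover have "?l (scale \<mu> x) = \<mu> * ?l x" for \<mu> x
    using representation_scale[OF B(2)] B(3) by simp
  ultimately show ?thesis by (intro exI[of _ ?l]) simp
qed

end

section \<open>Left ideals and the Jacobson radical\<close>

locale fd_algebra = vector_space "scal A"
  for A :: "('a::ab_group_add, 'k::field) alg" (structure) +
  assumes carr_subspace: "subspace (carr A)"
    and mult_in [simp, intro]: "\<lbrakk>x \<in> carr A; y \<in> carr A\<rbrakk> \<Longrightarrow> x \<cdot> y \<in> carr A"
    and one_in [simp, intro]: "\<one> \<in> carr A"
    and mult_assoc: "\<lbrakk>x \<in> carr A; y \<in> carr A; z \<in> carr A\<rbrakk> \<Longrightarrow> x \<cdot> y \<cdot> z = x \<cdot> (y \<cdot> z)"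
    and mult_one_left [simp]: "x \<in> carr A \<Longrightarrow> \<one> \<cdot> x = x"
    and mult_one_right [simp]: "x \<in> carr A \<Longrightarrow> x \<cdot> \<one> = x"
    and distrib_right: "\<lbrakk>x \<in> carr A; y \<in> carr A; z \<in> carr A\<rbrakk> \<Longrightarrow> (x + y) \<cdot> z = x \<cdot> z + y \<cdot> z"
    and distrib_left: "\<lbrakk>x \<in> carr A; y \<in> carr A; z \<in> carr A\<rbrakk> \<Longrightarrow> x \<cdot> (y + z) = x \<cdot> y + x \<cdot> z"
    and scal_mult_left: "\<lbrakk>x \<in> carr A; y \<in> carr A\<rbrakk> \<Longrightarrow> scal A \<mu> x \<cdot> y = scal A \<mu> (x \<cdot> y)"
    and scal_mult_right: "\<lbrakk>x \<in> carr A; y \<in> carr A\<rbrakk> \<Longrightarrow> x \<cdot> scal A \<mu> y = scal A \<mu> (x \<cdot> y)"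
    and fin_dim: "\<exists>B. finite B \<and> span B = carr A"
begin

lemma zero_in [simp, intro]: "0 \<in> carr A"
  and add_in [simp, intro]: "\<lbrakk>x \<in> carr A; y \<in> carr A\<rbrakk> \<Longrightarrow> x + y \<in> carr A"
  and scal_in [simp, intro]: "x \<in> carr A \<Longrightarrow> scal A \<mu> x \<in> carr A"
  and minus_in [simp, intro]: "x \<in> carr A \<Longrightarrow> - x \<in> carr A"
  and diff_in [simp, intro]: "\<lbrakk>x \<in> carr A; y \<in> carr A\<rbrakk> \<Longrightarrow> x - y \<in> carr A"
  and sum_in [intro]: "(\<And>i. i \<in> I \<Longrightarrow> f i \<in> carr A) \<Longrightarrow> sum f I \<in> carr A"
  using carr_subspace
  by (auto simp: subspace_0 subspace_add subspace_scale subspace_neg subspace_diff subspace_sum)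

lemma mult_zero_left [simp]: "x \<in> carr A \<Longrightarrow> 0 \<cdot> x = 0"
  using distrib_right[of 0 0 x] by simp

lemma mult_zero_right [simp]: "x \<in> carr A \<Longrightarrow> x \<cdot> 0 = 0"
  using distrib_left[of x 0 0] by simp

lemma mult_diff_right: "\<lbrakk>x \<in> carr A; y \<in> carr A; z \<in> carr A\<rbrakk> \<Longrightarrow> x \<cdot> (y - z) = x \<cdot> y - x \<cdot> z"
  using distrib_left[of x "y - z" z] by (simp add: eq_diff_eq)

lemma mult_diff_left: "\<lbrakk>x \<in> carr A; y \<in> carr A; z \<in> carr A\<rbrakk> \<Longrightarrow> (x - y) \<cdot> z = x \<cdot> z - y \<cdot> z"
  using distrib_right[of "x - y" y z] by (simp add: eq_diff_eq)

lemma mult_sum_right: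
  assumes "x \<in> carr A" "\<And>i. i \<in> I \<Longrightarrow> f i \<in> carr A"
  shows "x \<cdot> sum f I = (\<Sum>i\<in>I. x \<cdot> f i)"
  using assms(2)
  by (induction I rule: infinite_finite_induct) (auto simp: assms(1) distrib_left sum_in)

lemma mult_sum_left:
  assumes "x \<in> carr A" "\<And>i. i \<in> I \<Longrightarrow> f i \<in> carr A"
  shows "sum f I \<cdot> x = (\<Sum>i\<in>I. f i \<cdot> x)"
  using assms(2)
  by (induction I rule: infinite_finite_induct) (auto simp: assms(1) distrib_right sum_in)

lemma span_subset_carr: "S \<subseteq> carr A \<Longrightarrow> span S \<subseteq> carr A"
  using span_minimal carr_subspace by blast

text \<open>A scalar acts as multiplication by a scalar multiple of \<open>\<one>\<close>, so
  closure under scalars is automatic.\<close>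

lemma left_ideal_subspace: "left_ideal A L \<Longrightarrow> subspace L"
  unfolding subspace_def left_ideal_def
  by (metis mult_one_left one_in scal_in scal_mult_left subsetD)

lemma left_idealI:
  assumes "subspace L" "L \<subseteq> carr A" "\<And>a x. \<lbrakk>a \<in> carr A; x \<in> L\<rbrakk> \<Longrightarrow> a \<cdot> x \<in> L"
  shows "left_ideal A L"
  using assms unfolding left_ideal_def by (simp add: subspace_0 subspace_add)

lemma dim_stationary:
  assumes "\<And>n. subspace (S n)" "\<And>n. S n \<subseteq> carr A"
  shows "antimono S \<Longrightarrow> \<exists>N. \<forall>n\<ge>N. S n = S (N::nat)"
    and "mono S \<Longrightarrow> \<exists>N. \<forall>n\<ge>N. S n = S (N::nat)"
  using fin_dim assms descending_chain_stationary[of _ S] ascending_chain_stationary[of _ S]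
  by metis+

lemma eq_if_dim_le:
  "\<lbrakk>subspace S; S \<subseteq> T; T \<subseteq> carr A; dim T \<le> dim S\<rbrakk> \<Longrightarrow> S = T"
  using fin_dim subspace_eq_if_dim_le by metis

text \<open>The set is the annihilator of the nonzero class of \<open>m\<close> in the simple module
  \<open>M / N\<close>; the quotient of \<open>A\<close> by it is that simple module.\<close>

lemma annihilator_maximal:
  assumes M: "left_ideal A M" and N: "left_ideal A N" "N \<subseteq> M"
    and max: "\<And>L. \<lbrakk>left_ideal A L; N \<subseteq> L; L \<subseteq> M\<rbrakk> \<Longrightarrow> L = N \<or> L = M"
    and m: "m \<in> M" "m \<notin> N"
  shows "maximal_left_ideal A {a \<in> carr A. a \<cdot> m \<in> N}"
proof -
  have mA: "m \<in> carr A" and MA: "M \<subseteq> carr A" and NA: "N \<subseteq> carr A"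
    using M N m by (auto simp: left_ideal_def)
  let ?L = "{a \<in> carr A. a \<cdot> m \<in> N}"
  have L: "left_ideal A ?L"
    using N mA unfolding left_ideal_def by (auto simp: distrib_right mult_assoc)
  have ne: "?L \<noteq> carr A"
    using m mult_one_left[OF mA] one_in by (metis (mono_tags, lifting) mem_Collect_eq)
  have "L' = ?L \<or> L' = carr A" if L': "left_ideal A L'" "?L \<subseteq> L'" for L'
  proof (cases "L' \<subseteq> ?L")
    case True thus ?thesis using that by blast
  next
    case False
    then obtain l where l: "l \<in> L'" "l \<cdot> m \<notin> N"
      using L' by (auto simp: left_ideal_def)
    have L'A: "L' \<subseteq> carr A" using L' by (simp add: left_ideal_def)
    \<comment> \<open>As \<open>l \<cdot> m\<close> lies outside \<open>N\<close>, simplicity forces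
      \<open>N + L' m = M\<close>. Writing \<open>m\<close> in this form puts
      \<open>\<one> - x\<close> into the annihilator, hence \<open>\<one>\<close> into
      \<open>L'\<close>.\<close>
    let ?K = "{n + x \<cdot> m | n x. n \<in> N \<and> x \<in> L'}"
    have K: "left_ideal A ?K"
      unfolding left_ideal_def
    proof (intro conjI ballI)
      show "?K \<subseteq> carr A" using NA L'A mA by auto
      have "0 = 0 + 0 \<cdot> m" using mA by simp
      thus "0 \<in> ?K" using N L' unfolding left_ideal_def by blast
      show "x + y \<in> ?K" if "x \<in> ?K" "y \<in> ?K" for x y
      proof -
        obtain n1 x1 n2 x2 where "x = n1 + x1 \<cdot> m" "y = n2 + x2 \<cdot> m" "n1 \<in> N" "n2 \<in> N" "x1 \<in> L'" "x2 \<in> L'"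
          using \<open>x \<in> ?K\<close> \<open>y \<in> ?K\<close> by blast
        moreover from this have "x + y = (n1 + n2) + (x1 + x2) \<cdot> m"
          using L'A mA by (simp add: distrib_right subset_iff)
        ultimately show ?thesis using N L' unfolding left_ideal_def by blast
      qed
      show "a \<cdot> x \<in> ?K" if "a \<in> carr A" "x \<in> ?K" for a x
      proof -
        obtain n1 x1 where "x = n1 + x1 \<cdot> m" "n1 \<in> N" "x1 \<in> L'"
          using \<open>x \<in> ?K\<close> by blast
        moreover from this have "a \<cdot> x = a \<cdot> n1 + (a \<cdot> x1) \<cdot> m"
          using L'A NA mA \<open>a \<in> carr A\<close> by (simp add: distrib_left mult_assoc subset_iff)
        ultimately show ?thesis using N L' \<open>a \<in> carr A\<close> unfolding left_ideal_def by blast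
      qed
    qed
    have 0: "0 \<in> L'" "0 \<in> N" using L' N by (auto simp: left_ideal_def)
    have "N \<subseteq> ?K"
    proof
      fix n assume "n \<in> N"
      moreover have "n = n + 0 \<cdot> m" using mA by simp
      ultimately show "n \<in> ?K" using 0 by blast
    qed
    moreover have "?K \<subseteq> M"
      using N M L'A m unfolding left_ideal_def by (auto 4 4)
    moreover have "l \<cdot> m \<in> ?K"
    proof -
      have "l \<cdot> m = 0 + l \<cdot> m \<and> 0 \<in> N \<and> l \<in> L'" using 0 l by simp
      thus ?thesis by blast
    qed
    ultimately have "?K = M"
      using max[OF K] l by blast
    then obtain n x where nx: "m = n + x \<cdot> m" "n \<in> N" "x \<in> L'"
      using m by blast
    have xA: "x \<in> carr A" using nx L'A by blast
    have "(\<one> - x) \<cdot> m = n"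
      using nx(1) xA mA by (simp add: mult_diff_left diff_eq_eq)
    hence "\<one> - x \<in> L'"
      using L'(2) nx xA by auto
    hence "\<one> - x + x \<in> L'"
      using L' nx(3) unfolding left_ideal_def by blast
    hence one: "\<one> \<in> L'" by simp
    have "a \<in> L'" if "a \<in> carr A" for a
      using one L'(1) that mult_one_right[OF that] unfolding left_ideal_def by metis
    thus ?thesis using L'A by blast
  qed
  thus ?thesis
    using L ne unfolding maximal_left_ideal_def by blast
qed

text \<open>Annihilators of nonzero elements of the simple module \<open>M / N\<close> are maximal
  left ideals, so the radical lies in each of them and kills \<open>M / N\<close>.\<close>

lemma rad_mult_in_maximal:
  assumes "left_ideal A M" "left_ideal A N" "N \<subseteq> M"
    and "\<And>L. \<lbrakk>left_ideal A L; N \<subseteq> L; L \<subseteq> M\<rbrakk> \<Longrightarrow> L = N \<or> L = M"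
    and "m \<in> M" "x \<in> rad A"
  shows "x \<cdot> m \<in> N"
proof (cases "m \<in> N")
  case True
  thus ?thesis using assms unfolding left_ideal_def rad_def by blast
next
  case False
  thus ?thesis
    using annihilator_maximal[OF assms(1-5)] assms(6) unfolding rad_def by blast
qed

lemma rad_subset: "rad A \<subseteq> carr A"
  unfolding rad_def by blast

lemma left_ideal_carr: "left_ideal A (carr A)"
  unfolding left_ideal_def by auto

lemma rad_left_ideal: "left_ideal A (rad A)"
  unfolding left_ideal_def rad_def maximal_left_ideal_def by auto

lemma rad_subspace: "subspace (rad A)"
  using left_ideal_subspace rad_left_ideal by blast

lemma rad_mult_left: "\<lbrakk>a \<in> carr A; x \<in> rad A\<rbrakk> \<Longrightarrow> a \<cdot> x \<in> rad A"
  using rad_left_ideal unfolding left_ideal_def by blast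

text \<open>\<open>A / M\<close> is simple for every maximal \<open>M\<close>, so \<open>x\<close>
  kills the class of \<open>a\<close> in it.\<close>

lemma rad_mult_right:
  assumes "x \<in> rad A" "a \<in> carr A"
  shows "x \<cdot> a \<in> rad A"
proof -
  have "x \<cdot> a \<in> M" if "maximal_left_ideal A M" for M
  proof (rule rad_mult_in_maximal[OF left_ideal_carr _ _ _ assms(2,1)])
    show "left_ideal A M" "M \<subseteq> carr A"
      using that by (simp_all add: maximal_left_ideal_def left_ideal_def)
    show "L = M \<or> L = carr A" if "left_ideal A L" "M \<subseteq> L" for L
      using \<open>maximal_left_ideal A M\<close> that by (simp add: maximal_left_ideal_def)
  qed
  thus ?thesis using assms rad_subset unfolding rad_def by blast
qed

text \<open>A proper submodule \<open>N\<close> of largest dimension leaves a simple quotient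
  \<open>M / N\<close>, and the radical kills simple modules.\<close>

lemma proper_submodule_contains_rad_mult:
  assumes M: "left_ideal A M" "M \<noteq> {0}"
  shows "\<exists>N. left_ideal A N \<and> N \<subset> M \<and> (\<forall>x \<in> rad A. \<forall>m \<in> M. x \<cdot> m \<in> N)"
proof -
  obtain B where B: "finite B" "span B = carr A" using fin_dim by blast
  let ?P = "\<lambda>N. left_ideal A N \<and> N \<subset> M"
  have "left_ideal A {0}" unfolding left_ideal_def by auto
  moreover have "0 \<in> M" using M unfolding left_ideal_def by blast
  ultimately have "?P {0}" using M(2) by auto
  moreover have "\<forall>N. ?P N \<longrightarrow> dim N < Suc (card B)"
  proof (intro allI impI)
    fix N assume "?P N"
    hence "N \<subseteq> span B" using B unfolding left_ideal_def by simp
    thus "dim N < Suc (card B)" using dim_le_card[OF _ B(1)] by (simp add: less_Suc_eq_le)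
  qed
  ultimately obtain N where N: "?P N" "\<And>L. ?P L \<Longrightarrow> dim L \<le> dim N"
    using ex_has_greatest_nat[of ?P "{0}" dim "Suc (card B)"] by blast
  have "L = N \<or> L = M" if "left_ideal A L" "N \<subseteq> L" "L \<subseteq> M" for L
  proof (cases "L = M")
    case False
    hence "dim L \<le> dim N" using N(2) that by blast
    thus ?thesis
      using eq_if_dim_le[of N L] N(1) that left_ideal_subspace
      by (simp add: left_ideal_def)
  qed simp
  hence "\<forall>x \<in> rad A. \<forall>m \<in> M. x \<cdot> m \<in> N"
    using rad_mult_in_maximal[OF M(1), of N] N(1) by blast
  thus ?thesis using N(1) by blast
qed

text \<open>These are the powers of the radical, with the whole algebra as power zero.\<close>

primrec rad_series :: "nat \<Rightarrow> 'a set" where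
  "rad_series 0 = carr A"
| "rad_series (Suc n) = span {x \<cdot> y | x y. x \<in> rad A \<and> y \<in> rad_series n}"

lemma left_ideal_span:
  assumes S: "S \<subseteq> carr A" and mul: "\<And>a x. \<lbrakk>a \<in> carr A; x \<in> S\<rbrakk> \<Longrightarrow> a \<cdot> x \<in> span S"
  shows "left_ideal A (span S)"
proof (rule left_idealI[OF subspace_span span_subset_carr[OF S]])
  fix a x assume a: "a \<in> carr A" and x: "x \<in> span S"
  have "subspace {x \<in> carr A. a \<cdot> x \<in> span S}"
    using a by (auto simp: subspace_def span_zero distrib_left span_add scal_mult_right span_scale)
  hence "span S \<subseteq> {x \<in> carr A. a \<cdot> x \<in> span S}"
    using S mul[OF a] by (intro span_minimal) auto
  thus "a \<cdot> x \<in> span S" using x by blast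
qed

lemma rad_series_left_ideal: "left_ideal A (rad_series n)"
proof (induction n)
  case 0 show ?case using left_ideal_carr by simp
next
  case (Suc n)
  let ?S = "{x \<cdot> y | x y. x \<in> rad A \<and> y \<in> rad_series n}"
  have nA: "rad_series n \<subseteq> carr A" using Suc by (simp add: left_ideal_def)
  have "a \<cdot> s \<in> span ?S" if a: "a \<in> carr A" and "s \<in> ?S" for a s
  proof -
    obtain x y where xy: "s = x \<cdot> y" "x \<in> rad A" "y \<in> rad_series n" using \<open>s \<in> ?S\<close> by blast
    hence xyA: "x \<in> carr A" "y \<in> carr A" using rad_subset nA by auto
    have "a \<cdot> s = (a \<cdot> x) \<cdot> y" using xy(1) xyA a by (simp add: mult_assoc)
    hence "a \<cdot> s \<in> ?S" using rad_mult_left[OF a xy(2)] xy(3) by blast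
    thus ?thesis by (rule span_base)
  qed
  moreover have "?S \<subseteq> carr A" using nA rad_subset by blast
  ultimately have "left_ideal A (span ?S)" by (intro left_ideal_span)
  thus ?case by simp
qed

lemma rad_series_subset: "rad_series n \<subseteq> carr A"
  using rad_series_left_ideal by (simp add: left_ideal_def)

lemma rad_series_subspace: "subspace (rad_series n)"
  using rad_series_left_ideal left_ideal_subspace by blast

lemma rad_mult_rad_series: "\<lbrakk>x \<in> rad A; m \<in> rad_series n\<rbrakk> \<Longrightarrow> x \<cdot> m \<in> rad_series (Suc n)"
  by (auto intro: span_base)

text \<open>Nakayama's lemma: the descending series stabilises, and at a nonzero stable term it would still
  drop into a maximal proper submodule.\<close>

lemma rad_series_eventually_zero: "\<exists>n. rad_series n = {0}"
proof -
  have sub: "rad_series (Suc n) \<subseteq> rad_series n" for n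
  proof -
    have "x \<cdot> y \<in> rad_series n" if "x \<in> rad A" "y \<in> rad_series n" for x y
      using that rad_series_left_ideal[of n] rad_subset unfolding left_ideal_def by blast
    hence "span {x \<cdot> y | x y. x \<in> rad A \<and> y \<in> rad_series n} \<subseteq> rad_series n"
      by (intro span_minimal rad_series_subspace) blast
    thus ?thesis by simp
  qed
  hence "antimono rad_series" by (simp only: antimono_iff_le_Suc simp_thms)
  hence "\<exists>N. \<forall>n\<ge>N. rad_series n = rad_series N"
    by (rule dim_stationary(1)[of rad_series, OF rad_series_subspace rad_series_subset])
  then obtain N where "\<forall>n\<ge>N. rad_series n = rad_series N" ..
  hence eq: "rad_series (Suc N) = rad_series N" by (metis le_SucI order_refl)
  have "rad_series N = {0}"
  proof (rule ccontr)
    assume "rad_series N \<noteq> {0}"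
    from proper_submodule_contains_rad_mult[OF rad_series_left_ideal this] obtain L where L: "left_ideal A L" "L \<subset> rad_series N"
        "\<forall>x \<in> rad A. \<forall>m \<in> rad_series N. x \<cdot> m \<in> L"
      by blast
    have "span {x \<cdot> y | x y. x \<in> rad A \<and> y \<in> rad_series N} \<subseteq> L"
    proof (rule span_minimal)
      show "{x \<cdot> y | x y. x \<in> rad A \<and> y \<in> rad_series N} \<subseteq> L" using L(3) by blast
      show "subspace L" by (rule left_ideal_subspace[OF L(1)])
    qed
    hence "rad_series (Suc N) \<subseteq> L" by simp
    thus False using eq L(2) by blast
  qed
  thus ?thesis by blast
qed

text \<open>Since \<open>e = e \<cdot> e\<close>, the element lies in every power of the radical,
  and these reach zero.\<close>

lemma idempotent_rad_eq_0:
  assumes "e \<in> rad A" "e \<cdot> e = e"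
  shows "e = 0"
proof -
  have "e \<in> rad_series n" for n
  proof (induction n)
    case 0 show ?case using assms(1) rad_subset by auto
  next
    case (Suc n) show ?case using rad_mult_rad_series[OF assms(1) Suc] assms(2) by simp
  qed
  thus ?thesis using rad_series_eventually_zero by blast
qed

section \<open>Fitting's lemma and primitive idempotents\<close>

primrec pow :: "'a \<Rightarrow> nat \<Rightarrow> 'a" where
  "pow z 0 = \<one>"
| "pow z (Suc n) = pow z n \<cdot> z"

lemma pow_in [simp, intro]: "z \<in> carr A \<Longrightarrow> pow z n \<in> carr A"
  by (induction n) auto

lemma pow_add: "z \<in> carr A \<Longrightarrow> pow z (m + n) = pow z m \<cdot> pow z n"
  by (induction n) (auto simp: mult_assoc)

text \<open>The inverse is the partial geometric series
  \<open>1 + z + ... + z^(m-1)\<close>.\<close>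

lemma left_inverse_one_minus_nilpotent:
  assumes z: "z \<in> carr A" and nil: "pow z n = 0"
  shows "\<exists>s \<in> carr A. s \<cdot> (\<one> - z) = \<one>"
proof -
  have "\<exists>s \<in> carr A. s \<cdot> (\<one> - z) = \<one> - pow z m" for m
  proof (induction m)
    case 0 show ?case using z by (auto intro!: bexI[of _ 0])
  next
    case (Suc m)
    then obtain s where s: "s \<in> carr A" "s \<cdot> (\<one> - z) = \<one> - pow z m" by blast
    have "(s + pow z m) \<cdot> (\<one> - z) = (\<one> - pow z m) + pow z m \<cdot> (\<one> - z)"
      using z s by (simp add: distrib_right)
    also have "\<dots> = \<one> - pow z (Suc m)" using z by (simp add: mult_diff_right)
    finally show ?case using z s(1) by blast
  qed
  thus ?thesis using nil by (metis diff_zero)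
qed

text \<open>If a maximal \<open>M\<close> missed \<open>x\<close>, then \<open>1 = m + y x\<close>
  with \<open>m\<close> in \<open>M\<close>, and \<open>1 - y x = m\<close> would be a left
  invertible element of \<open>M\<close>.\<close>

lemma in_rad_if_left_quasi_regular:
  assumes x: "x \<in> carr A"
    and inv: "\<And>y. y \<in> carr A \<Longrightarrow> \<exists>s \<in> carr A. s \<cdot> (\<one> - y \<cdot> x) = \<one>"
  shows "x \<in> rad A"
proof -
  have "x \<in> M" if M: "maximal_left_ideal A M" for M
  proof (rule ccontr)
    assume xM: "x \<notin> M"
    have lM: "left_ideal A M" and MA: "M \<subseteq> carr A"
      using M by (auto simp: maximal_left_ideal_def left_ideal_def)
    let ?L = "{m + y \<cdot> x | m y. m \<in> M \<and> y \<in> carr A}"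
    have "left_ideal A ?L"
      unfolding left_ideal_def
    proof (intro conjI ballI)
      show "?L \<subseteq> carr A" using MA x by auto
      have "0 = 0 + 0 \<cdot> x \<and> 0 \<in> M \<and> 0 \<in> carr A" using x lM by (simp add: left_ideal_def)
      thus "0 \<in> ?L" by blast
      show "u + v \<in> ?L" if "u \<in> ?L" "v \<in> ?L" for u v
      proof -
        obtain m y m' y' where "u = m + y \<cdot> x" "v = m' + y' \<cdot> x" "m \<in> M" "m' \<in> M"
            "y \<in> carr A" "y' \<in> carr A"
          using \<open>u \<in> ?L\<close> \<open>v \<in> ?L\<close> by blast
        hence "u + v = (m + m') + (y + y') \<cdot> x \<and> m + m' \<in> M \<and> y + y' \<in> carr A"
          using x lM by (auto simp: distrib_right left_ideal_def)
        thus ?thesis by blast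
      qed
      show "a \<cdot> u \<in> ?L" if a: "a \<in> carr A" and "u \<in> ?L" for a u
      proof -
        obtain m y where my: "u = m + y \<cdot> x" "m \<in> M" "y \<in> carr A"
          using \<open>u \<in> ?L\<close> by blast
        hence "m \<in> carr A" using MA by blast
        hence "a \<cdot> u = a \<cdot> m + (a \<cdot> y) \<cdot> x \<and> a \<cdot> m \<in> M \<and> a \<cdot> y \<in> carr A"
          using x lM my a by (auto simp: distrib_left mult_assoc left_ideal_def)
        thus ?thesis by blast
      qed
    qed
    moreover have "M \<subseteq> ?L"
    proof
      fix m assume "m \<in> M"
      hence "m = m + 0 \<cdot> x \<and> m \<in> M \<and> 0 \<in> carr A" using x by simp
      thus "m \<in> ?L" by blast
    qed
    moreover have "x \<in> ?L"
    proof -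
      have "x = 0 + \<one> \<cdot> x \<and> 0 \<in> M \<and> \<one> \<in> carr A" using x lM by (simp add: left_ideal_def)
      thus ?thesis by blast
    qed
    ultimately have "?L = carr A"
      using M xM unfolding maximal_left_ideal_def by blast
    then obtain m y where my: "\<one> = m + y \<cdot> x" "m \<in> M" "y \<in> carr A"
      using one_in by blast
    then obtain s where s: "s \<in> carr A" "s \<cdot> (\<one> - y \<cdot> x) = \<one>" using inv by blast
    have "m = \<one> - y \<cdot> x" using my(1) by (simp add: eq_diff_eq)
    hence one: "\<one> \<in> M" using s my(2) lM unfolding left_ideal_def by metis
    have "a \<in> M" if "a \<in> carr A" for a
      using one lM that mult_one_right[OF that] unfolding left_ideal_def by metis
    thus False using M MA unfolding maximal_left_ideal_def by blast
  qed
  thus ?thesis using x unfolding rad_def by blast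
qed

text \<open>The left ideals \<open>A z^n\<close> and the left annihilators of \<open>z^n\<close>
  both stabilise. For \<open>w = z^(n+1)\<close> the first gives \<open>w = a w^2\<close>; with
  \<open>p = a w\<close> this yields \<open>(p a - a) w^2 = 0\<close>, and the second cancels one
  factor \<open>w\<close>, so that \<open>p p = p\<close>. The exponent is a successor so that a
  factor \<open>z\<close> can be split off later.\<close>

lemma fitting_idempotent:
  assumes z: "z \<in> carr A"
  shows "\<exists>n a. a \<in> carr A \<and> (a \<cdot> pow z (Suc n)) \<cdot> (a \<cdot> pow z (Suc n)) = a \<cdot> pow z (Suc n) \<and>
                (a \<cdot> pow z (Suc n)) \<cdot> pow z (Suc n) = pow z (Suc n)"
proof -
  let ?L = "\<lambda>n. {a \<cdot> pow z n | a. a \<in> carr A}"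
  let ?R = "\<lambda>n. {a \<in> carr A. a \<cdot> pow z n = 0}"
  have subL: "subspace (?L n)" for n
  proof (rule left_ideal_subspace, unfold left_ideal_def, intro conjI ballI)
    show "?L n \<subseteq> carr A" using z by auto
    have "0 = 0 \<cdot> pow z n" using z by simp
    thus "0 \<in> ?L n" by blast
    show "u + v \<in> ?L n" if "u \<in> ?L n" "v \<in> ?L n" for u v
      using that z by (auto simp: distrib_right[symmetric])
    show "a \<cdot> u \<in> ?L n" if "a \<in> carr A" "u \<in> ?L n" for a u
      using that z by (auto simp: mult_assoc[symmetric])
  qed
  have subR: "subspace (?R n)" for n
    using z by (auto simp: subspace_def distrib_right scal_mult_left)
  have LA: "?L n \<subseteq> carr A" for n using z by auto
  have Suc_eq: "pow z (Suc n) = z \<cdot> pow z n" for n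
    using pow_add[OF z, of 1 n] z by simp
  have "antimono ?L"
  proof (rule antimono_iff_le_Suc[THEN iffD2], rule allI, rule subsetI)
    fix n u assume "u \<in> ?L (Suc n)"
    then obtain a where "u = a \<cdot> pow z (Suc n)" "a \<in> carr A" by blast
    hence "u = (a \<cdot> z) \<cdot> pow z n \<and> a \<cdot> z \<in> carr A" using z Suc_eq by (simp add: mult_assoc)
    thus "u \<in> ?L n" by blast
  qed
  then obtain N1 where N1: "\<forall>n\<ge>N1. ?L n = ?L N1"
    using dim_stationary(1)[of ?L, OF subL LA] by blast
  have "mono ?R"
  proof (rule mono_iff_le_Suc[THEN iffD2], rule allI, rule subsetI)
    fix n u assume "u \<in> ?R n"
    thus "u \<in> ?R (Suc n)" using z by (simp add: mult_assoc[symmetric])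
  qed
  then obtain N2 where N2: "\<forall>n\<ge>N2. ?R n = ?R N2"
    using dim_stationary(2)[of ?R, OF subR] by blast
  define n where "n = N1 + N2"
  define w where "w = pow z (Suc n)"
  have wA: "w \<in> carr A" using z by (simp add: w_def)
  have ww: "w \<cdot> w = pow z (Suc n + Suc n)" by (simp only: w_def pow_add[OF z])
  have n: "Suc n \<ge> N1" "Suc n + Suc n \<ge> N1" "Suc n \<ge> N2" "Suc n + Suc n \<ge> N2"
    by (simp_all add: n_def)
  have "?L (Suc n + Suc n) = ?L (Suc n)"
    by (rule trans[OF N1[rule_format, OF n(2)] N1[rule_format, OF n(1), symmetric]])
  moreover have "\<one> \<cdot> w = w" using wA by simp
  hence "w \<in> ?L (Suc n)" unfolding w_def using one_in by (metis (mono_tags, lifting) mem_Collect_eq)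
  ultimately obtain a where a: "a \<in> carr A" "w = a \<cdot> (w \<cdot> w)" using ww by auto
  let ?p = "a \<cdot> w"
  have pw: "?p \<cdot> w = w" using a wA by (simp add: mult_assoc)
  let ?d = "?p \<cdot> a - a"
  have "?d \<cdot> (w \<cdot> w) = 0"
  proof -
    have "?d \<cdot> (w \<cdot> w) = a \<cdot> w \<cdot> (a \<cdot> (w \<cdot> w)) - a \<cdot> (w \<cdot> w)"
      using a wA by (simp add: mult_diff_left mult_assoc del: a(2))
    thus ?thesis using a pw by simp
  qed
  hence "?d \<in> ?R (Suc n + Suc n)" using a wA ww by simp
  moreover have "?R (Suc n + Suc n) = ?R (Suc n)"
    by (rule trans[OF N2[rule_format, OF n(4)] N2[rule_format, OF n(3), symmetric]])
  ultimately have "?d \<cdot> w = 0" unfolding w_def by blast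
  hence "?p \<cdot> ?p = ?p" using a wA by (simp add: mult_diff_left mult_assoc)
  thus ?thesis using pw a(1) unfolding w_def by blast
qed

text \<open>Otherwise \<open>e = q + (e - q)\<close> would be a nontrivial orthogonal splitting of
  \<open>e\<close>.\<close>

lemma primitive_unique_idempotent:
  assumes e: "primitive_idempotent A e" and q: "q \<in> carr A" "q \<cdot> q = q" "e \<cdot> q = q" "q \<cdot> e = q" "q \<noteq> 0"
  shows "q = e"
proof (rule ccontr)
  assume ne: "q \<noteq> e"
  have eA: "e \<in> carr A" "e \<cdot> e = e" using e by (auto simp: primitive_idempotent_def idempotent_def)
  have "idempotent A (e - q)" "idempotent A q" "q \<cdot> (e - q) = 0" "(e - q) \<cdot> q = 0" "e = q + (e - q)"
    using eA q by (simp_all add: idempotent_def mult_diff_left mult_diff_right)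
  thus False using e q(5) ne unfolding primitive_idempotent_def by (metis right_minus_eq)
qed

text \<open>This is the locality of \<open>e A e\<close>. The Fitting idempotent \<open>a w\<close>
  of \<open>z\<close>, multiplied by \<open>e\<close> on the left, is an idempotent of
  \<open>e A e\<close>; it fixes the nonzero element \<open>w\<close>, so it is nonzero and hence
  \<open>e\<close>. It is also a left multiple of \<open>z\<close>.\<close>

lemma primitive_nilpotent_or_left_invertible:
  assumes e: "primitive_idempotent A e" and z: "z \<in> carr A" "e \<cdot> z = z" "z \<cdot> e = z"
    and nil: "\<And>n. pow z n \<noteq> 0"
  shows "\<exists>w \<in> carr A. w \<cdot> z = e"
proof -
  have eA: "e \<in> carr A" "e \<cdot> e = e" using e by (auto simp: primitive_idempotent_def idempotent_def)
  obtain n a where a: "a \<in> carr A" 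
     and p: "(a \<cdot> pow z (Suc n)) \<cdot> (a \<cdot> pow z (Suc n)) = a \<cdot> pow z (Suc n)"
       "(a \<cdot> pow z (Suc n)) \<cdot> pow z (Suc n) = pow z (Suc n)"
    using fitting_idempotent[OF z(1)] by blast
  define w where "w = pow z (Suc n)"
  have "w = z \<cdot> pow z n" using pow_add[OF z(1), of 1 n] z(1) by (simp add: w_def)
  hence "e \<cdot> w = w" using z eA by (simp add: mult_assoc[symmetric])
  moreover have "w \<cdot> e = w" using z eA by (simp add: w_def mult_assoc)
  ultimately have w: "w \<in> carr A" "w \<cdot> e = w" "w \<noteq> 0" "e \<cdot> w = w"
    using z(1) nil by (auto simp only: w_def pow_in)
  let ?q = "e \<cdot> (a \<cdot> w)"
  note p = p[folded w_def]
  have "?q \<cdot> ?q = e \<cdot> (a \<cdot> ((w \<cdot> e) \<cdot> (a \<cdot> w)))" using a w(1) eA(1) by (simp add: mult_assoc)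
  also have "\<dots> = e \<cdot> ((a \<cdot> w) \<cdot> (a \<cdot> w))" unfolding w(2) using a w(1) eA by (simp add: mult_assoc)
  finally have "?q \<cdot> ?q = ?q" using p by simp
  moreover have "?q \<cdot> w = w" using a w eA p by (simp add: mult_assoc)
  hence "?q \<noteq> 0" using w by auto
  moreover have "e \<cdot> ?q = ?q" using a w eA by (simp add: mult_assoc[symmetric])
  moreover have "?q \<cdot> e = ?q" using a w eA by (simp add: mult_assoc)
  ultimately have "?q = e" using primitive_unique_idempotent[OF e, of ?q] a w(1) eA(1) by blast
  hence "(e \<cdot> a \<cdot> pow z n) \<cdot> z = e" using a z eA by (simp add: w_def mult_assoc)
  thus ?thesis using a z eA by blast
qed

lemma primitiveD:
  assumes "primitive_idempotent A e"
  shows "e \<in> carr A" "e \<cdot> e = e" "e \<noteq> 0"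
  using assms by (auto simp: primitive_idempotent_def idempotent_def)

section \<open>Isomorphic projectives and the vertices of the quiver\<close>

lemma left_proj_iff:
  assumes "idempotent A e"
  shows "x \<in> left_proj A e \<longleftrightarrow> x \<in> carr A \<and> x \<cdot> e = x"
proof
  assume "x \<in> left_proj A e"
  thus "x \<in> carr A \<and> x \<cdot> e = x"
    using assms by (auto simp: left_proj_def idempotent_def mult_assoc)
next
  assume "x \<in> carr A \<and> x \<cdot> e = x"
  thus "x \<in> left_proj A e" unfolding left_proj_def by (metis (mono_tags, lifting) mem_Collect_eq)
qed

text \<open>A module map out of \<open>A e\<close> is right multiplication by the image of
  \<open>e\<close>, an element of \<open>e A f\<close>. So \<open>\<alpha>\<close> is the image of
  \<open>e\<close>, and \<open>\<beta>\<close> the preimage of \<open>f\<close>.\<close>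

lemma proj_iso_iff:
  assumes e: "idempotent A e" and f: "idempotent A f"
  shows "proj_iso A e f \<longleftrightarrow>
    (\<exists>\<alpha> \<in> carr A. \<exists>\<beta> \<in> carr A. e \<cdot> \<alpha> = \<alpha> \<and> \<alpha> \<cdot> f = \<alpha> \<and> f \<cdot> \<beta> = \<beta> \<and> \<beta> \<cdot> e = \<beta> \<and>
       \<alpha> \<cdot> \<beta> = e \<and> \<beta> \<cdot> \<alpha> = f)"
    (is "_ \<longleftrightarrow> ?R")
proof
  have eA: "e \<in> carr A" "e \<cdot> e = e" and fA: "f \<in> carr A" "f \<cdot> f = f"
    using e f by (auto simp: idempotent_def)
  note iff = left_proj_iff[OF e] left_proj_iff[OF f]
  assume "proj_iso A e f"
  then obtain \<phi> where bij: "bij_betw \<phi> (left_proj A e) (left_proj A f)"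
    and lin: "\<And>a x. \<lbrakk>a \<in> carr A; x \<in> left_proj A e\<rbrakk> \<Longrightarrow> \<phi> (a \<cdot> x) = a \<cdot> \<phi> x"
    unfolding proj_iso_def by blast
  have eL: "e \<in> left_proj A e" and fL: "f \<in> left_proj A f"
    using eA fA by (simp_all add: iff)
  have "\<phi> e \<in> left_proj A f" using bij eL by (rule bij_betwE[THEN bspec])
  hence \<alpha>: "\<phi> e \<in> carr A" "\<phi> e \<cdot> f = \<phi> e" by (simp_all add: iff)
  have e\<alpha>: "e \<cdot> \<phi> e = \<phi> e" using lin[OF eA(1) eL] eA by simp
  obtain \<beta> where \<beta>: "\<beta> \<in> left_proj A e" "\<phi> \<beta> = f"
    using bij fL unfolding bij_betw_def by (metis imageE)
  have \<beta>A: "\<beta> \<in> carr A" "\<beta> \<cdot> e = \<beta>" using \<beta>(1) by (simp_all add: iff)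
  have inj: "x = y" if "x \<in> left_proj A e" "y \<in> left_proj A e" "\<phi> x = \<phi> y" for x y
    using bij that unfolding bij_betw_def by (meson inj_onD)
  have "f \<cdot> \<beta> = \<beta>"
  proof (rule inj[OF _ \<beta>(1)])
    show "f \<cdot> \<beta> \<in> left_proj A e" using \<beta>A fA eA by (simp add: iff mult_assoc)
    show "\<phi> (f \<cdot> \<beta>) = \<phi> \<beta>" using lin[OF fA(1) \<beta>(1)] \<beta>(2) fA by simp
  qed
  moreover have "\<phi> e \<cdot> \<beta> = e"
  proof (rule inj[OF _ eL])
    show "\<phi> e \<cdot> \<beta> \<in> left_proj A e" using \<beta>A \<alpha> eA by (simp add: iff mult_assoc)
    show "\<phi> (\<phi> e \<cdot> \<beta>) = \<phi> e" using lin[OF \<alpha>(1) \<beta>(1)] \<beta>(2) \<alpha> by simp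
  qed
  moreover have "\<beta> \<cdot> \<phi> e = f" using lin[OF \<beta>A(1) eL] \<beta>A(2) \<beta>(2) by simp
  ultimately show ?R using \<alpha> e\<alpha> \<beta>A by blast
next
  have eA: "e \<in> carr A" "e \<cdot> e = e" and fA: "f \<in> carr A" "f \<cdot> f = f"
    using e f by (auto simp: idempotent_def)
  note iff = left_proj_iff[OF e] left_proj_iff[OF f]
  assume ?R
  then obtain \<alpha> \<beta> where ab: "\<alpha> \<in> carr A" "\<beta> \<in> carr A" "e \<cdot> \<alpha> = \<alpha>" "\<alpha> \<cdot> f = \<alpha>" "f \<cdot> \<beta> = \<beta>"
      "\<beta> \<cdot> e = \<beta>" "\<alpha> \<cdot> \<beta> = e" "\<beta> \<cdot> \<alpha> = f" by blast
  have "bij_betw (\<lambda>x. x \<cdot> \<alpha>) (left_proj A e) (left_proj A f)"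
    by (rule bij_betw_byWitness[where f' = "\<lambda>x. x \<cdot> \<beta>"])
      (auto simp: iff mult_assoc ab eA fA)
  thus "proj_iso A e f"
    unfolding proj_iso_def
    by (intro exI[of _ "\<lambda>x. x \<cdot> \<alpha>"]) (auto simp: iff distrib_right mult_assoc ab eA)
qed

lemma proj_isoE:
  assumes "proj_iso A e f" "idempotent A e" "idempotent A f"
  obtains \<alpha> \<beta> where "\<alpha> \<in> carr A" "\<beta> \<in> carr A" "e \<cdot> \<alpha> = \<alpha>" "\<alpha> \<cdot> f = \<alpha>" "f \<cdot> \<beta> = \<beta>"
    "\<beta> \<cdot> e = \<beta>" "\<alpha> \<cdot> \<beta> = e" "\<beta> \<cdot> \<alpha> = f"
  using assms(1) unfolding proj_iso_iff[OF assms(2,3)] by blast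

abbreviation iso_rel :: "('a \<times> 'a) set" where
  "iso_rel \<equiv> {(e, f). primitive_idempotent A e \<and> primitive_idempotent A f \<and> proj_iso A e f}"

lemma iso_rel_equiv: "equiv {e. primitive_idempotent A e} iso_rel"
proof (rule equivI)
  have idem: "idempotent A e" if "primitive_idempotent A e" for e
    using that by (simp add: primitive_idempotent_def)
  show "iso_rel \<subseteq> {e. primitive_idempotent A e} \<times> {e. primitive_idempotent A e}" by auto
  show "refl_on {e. primitive_idempotent A e} iso_rel"
  proof (rule refl_onI)
    fix e assume "e \<in> {e. primitive_idempotent A e}"
    hence "primitive_idempotent A e" by simp
    moreover from this have "proj_iso A e e"
      unfolding proj_iso_iff[OF idem idem, OF \<open>primitive_idempotent A e\<close> \<open>primitive_idempotent A e\<close>]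
      using primitiveD[of e] by blast
    ultimately show "(e, e) \<in> iso_rel" by simp
  qed
  show "sym iso_rel"
  proof (rule symI)
    fix e f assume "(e, f) \<in> iso_rel"
    hence p: "primitive_idempotent A e" "primitive_idempotent A f" "proj_iso A e f" by auto
    hence "proj_iso A f e"
      unfolding proj_iso_iff[OF idem[OF p(1)] idem[OF p(2)]] proj_iso_iff[OF idem[OF p(2)] idem[OF p(1)]]
      by blast
    thus "(f, e) \<in> iso_rel" using p by simp
  qed
  show "trans iso_rel"
  proof (rule transI)
    fix e f g assume "(e, f) \<in> iso_rel" "(f, g) \<in> iso_rel"
    hence p: "primitive_idempotent A e" "primitive_idempotent A f" "primitive_idempotent A g"
      "proj_iso A e f" "proj_iso A f g" by auto
    obtain \<alpha> \<beta> where ab: "\<alpha> \<in> carr A" "\<beta> \<in> carr A" "e \<cdot> \<alpha> = \<alpha>" "\<alpha> \<cdot> f = \<alpha>" "f \<cdot> \<beta> = \<beta>"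
      "\<beta> \<cdot> e = \<beta>" "\<alpha> \<cdot> \<beta> = e" "\<beta> \<cdot> \<alpha> = f" using proj_isoE[OF p(4) idem[OF p(1)] idem[OF p(2)]] .
    obtain \<gamma> \<delta> where cd: "\<gamma> \<in> carr A" "\<delta> \<in> carr A" "f \<cdot> \<gamma> = \<gamma>" "\<gamma> \<cdot> g = \<gamma>" "g \<cdot> \<delta> = \<delta>"
      "\<delta> \<cdot> f = \<delta>" "\<gamma> \<cdot> \<delta> = f" "\<delta> \<cdot> \<gamma> = g" using proj_isoE[OF p(5) idem[OF p(2)] idem[OF p(3)]] .
    note A = primitiveD(1)[OF p(1)] primitiveD(1)[OF p(2)] primitiveD(1)[OF p(3)] ab(1,2) cd(1,2)
    have "\<alpha> \<cdot> \<gamma> \<cdot> (\<delta> \<cdot> \<beta>) = \<alpha> \<cdot> ((\<gamma> \<cdot> \<delta>) \<cdot> \<beta>)" using A by (simp add: mult_assoc del: cd)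
    hence 1: "\<alpha> \<cdot> \<gamma> \<cdot> (\<delta> \<cdot> \<beta>) = e" using ab cd by simp
    have "\<delta> \<cdot> \<beta> \<cdot> (\<alpha> \<cdot> \<gamma>) = \<delta> \<cdot> ((\<beta> \<cdot> \<alpha>) \<cdot> \<gamma>)" using A by (simp add: mult_assoc del: ab)
    hence 2: "\<delta> \<cdot> \<beta> \<cdot> (\<alpha> \<cdot> \<gamma>) = g" using ab cd by simp
    have 3: "e \<cdot> (\<alpha> \<cdot> \<gamma>) = \<alpha> \<cdot> \<gamma>" "g \<cdot> (\<delta> \<cdot> \<beta>) = \<delta> \<cdot> \<beta>"
      using A ab cd by (simp_all add: mult_assoc[symmetric])
    have 4: "\<alpha> \<cdot> \<gamma> \<cdot> g = \<alpha> \<cdot> \<gamma>" "\<delta> \<cdot> \<beta> \<cdot> e = \<delta> \<cdot> \<beta>"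
      using A ab cd by (simp_all add: mult_assoc)
    have "proj_iso A e g"
      unfolding proj_iso_iff[OF idem[OF p(1)] idem[OF p(3)]]
      using 1 2 3 4 mult_in[OF A(4,6)] mult_in[OF A(7,5)] by blast
    thus "(e, g) \<in> iso_rel" using p by simp
  qed
qed

text \<open>Were \<open>e x f y e\<close> not nilpotent, it would be invertible in the local algebra \<open>e A e\<close>, which splits
  \<open>e\<close> off \<open>f\<close>; so every \<open>y (e x f)\<close> is nilpotent.\<close>

lemma non_iso_corner_in_rad:
  assumes e: "primitive_idempotent A e" and f: "primitive_idempotent A f"
    and non: "\<not> proj_iso A e f" and x: "x \<in> carr A"
  shows "e \<cdot> x \<cdot> f \<in> rad A"
proof (rule in_rad_if_left_quasi_regular)
  note eA = primitiveD[OF e] and fA = primitiveD[OF f]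
  show u: "e \<cdot> x \<cdot> f \<in> carr A" using eA fA x by simp
  fix y assume y: "y \<in> carr A"
  define u where "u = e \<cdot> x \<cdot> f"
  have uA: "u \<in> carr A" "e \<cdot> u = u" "u \<cdot> f = u"
    using eA fA x by (simp_all add: u_def mult_assoc) (simp add: mult_assoc[symmetric])
  define z where "z = u \<cdot> y \<cdot> e"
  have zA: "z \<in> carr A" "e \<cdot> z = z" "z \<cdot> e = z"
    using uA y eA by (simp_all add: z_def mult_assoc) (simp_all add: mult_assoc[symmetric])
  have "\<exists>n. pow z n = 0"
  proof (rule ccontr)
    assume "\<not> (\<exists>n. pow z n = 0)"
    then obtain w where w: "w \<in> carr A" "w \<cdot> z = e"
      using primitive_nilpotent_or_left_invertible[OF e zA] by blast
    define \<alpha> where "\<alpha> = e \<cdot> w \<cdot> u"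
    define \<beta> where "\<beta> = f \<cdot> y \<cdot> e"
    have A: "\<alpha> \<in> carr A" "\<beta> \<in> carr A" using eA fA w y uA by (simp_all add: \<alpha>_def \<beta>_def)
    have 1: "e \<cdot> \<alpha> = \<alpha>" "f \<cdot> \<beta> = \<beta>"
      using eA fA w y uA by (simp_all add: \<alpha>_def \<beta>_def mult_assoc[symmetric])
    have 2: "\<alpha> \<cdot> f = \<alpha>" "\<beta> \<cdot> e = \<beta>"
      using eA fA w y uA by (simp_all add: \<alpha>_def \<beta>_def mult_assoc)
    have "\<alpha> \<cdot> \<beta> = e \<cdot> (w \<cdot> ((u \<cdot> f) \<cdot> y \<cdot> e))"
      using eA(1) fA(1) w(1) y uA(1) by (simp add: \<alpha>_def \<beta>_def mult_assoc)
    hence 3: "\<alpha> \<cdot> \<beta> = e" using uA(3) w(2) eA by (simp add: z_def[symmetric])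
    \<comment> \<open>The product \<open>\<beta> \<cdot> \<alpha>\<close> is an idempotent of
      \<open>f A f\<close>; once nonzero it equals the primitive \<open>f\<close>, which makes
      \<open>\<alpha>\<close> and \<open>\<beta>\<close> mutually inverse.\<close>
    have ne: "\<beta> \<cdot> \<alpha> \<noteq> 0"
    proof
      assume "\<beta> \<cdot> \<alpha> = 0"
      hence "\<alpha> \<cdot> (\<beta> \<cdot> \<alpha>) \<cdot> \<beta> = 0" using A by simp
      moreover have "\<alpha> \<cdot> (\<beta> \<cdot> \<alpha>) \<cdot> \<beta> = (\<alpha> \<cdot> \<beta>) \<cdot> (\<alpha> \<cdot> \<beta>)" using A by (simp add: mult_assoc)
      ultimately show False using 3 eA by simp
    qed
    have "\<beta> \<cdot> \<alpha> \<cdot> (\<beta> \<cdot> \<alpha>) = \<beta> \<cdot> ((\<alpha> \<cdot> \<beta>) \<cdot> \<alpha>)" using A by (simp add: mult_assoc)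
    hence "\<beta> \<cdot> \<alpha> \<cdot> (\<beta> \<cdot> \<alpha>) = \<beta> \<cdot> \<alpha>" using 3 1 by simp
    moreover have "f \<cdot> (\<beta> \<cdot> \<alpha>) = \<beta> \<cdot> \<alpha>" using A fA 1 by (simp add: mult_assoc[symmetric])
    moreover have "\<beta> \<cdot> \<alpha> \<cdot> f = \<beta> \<cdot> \<alpha>" using A fA 2 by (simp add: mult_assoc)
    ultimately have "\<beta> \<cdot> \<alpha> = f" using primitive_unique_idempotent[OF f] A ne by blast
    hence "proj_iso A e f"
      using 1 2 3 A e f by (subst proj_iso_iff) (auto simp: primitive_idempotent_def)
    thus False using non by simp
  qed
  then obtain n where n: "pow z n = 0" by blast
  have yu: "y \<cdot> u \<in> carr A" using y uA by simp
  \<comment> \<open>Nilpotency passes from \<open>z = u y e\<close> to \<open>y u\<close>, because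
    \<open>u = e u\<close> lets the factors be regrouped.\<close>
  have "pow (y \<cdot> u) (Suc k) = y \<cdot> (pow z k \<cdot> u)" for k
  proof (induction k)
    case 0 show ?case using y uA by simp
  next
    case (Suc k)
    have "pow (y \<cdot> u) (Suc (Suc k)) = y \<cdot> (pow z k \<cdot> u) \<cdot> (y \<cdot> u)" using Suc by simp
    also have "\<dots> = y \<cdot> (pow z k \<cdot> (u \<cdot> y \<cdot> (e \<cdot> u)))" unfolding uA(2) using y uA(1) zA(1) by (simp add: mult_assoc)
    also have "\<dots> = y \<cdot> (pow z (Suc k) \<cdot> u)" using y uA(1) eA(1) zA(1) by (simp add: mult_assoc z_def)
    finally show ?case .
  qed
  hence "pow (y \<cdot> u) (Suc n) = 0" using n uA(1) y by simp
  thus "\<exists>s \<in> carr A. s \<cdot> (\<one> - y \<cdot> (e \<cdot> x \<cdot> f)) = \<one>"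
    using left_inverse_one_minus_nilpotent[OF yu] unfolding u_def by blast
qed

section \<open>Decompositions into orthogonal primitive idempotents\<close>

definition orthogonal_primitives :: "'a set \<Rightarrow> bool" where
  "orthogonal_primitives P \<longleftrightarrow> finite P \<and> (\<forall>p \<in> P. primitive_idempotent A p) \<and>
     (\<forall>p \<in> P. \<forall>q \<in> P. p \<noteq> q \<longrightarrow> p \<cdot> q = 0)"

lemma orthogonal_primitives_mult_sum:
  assumes P: "orthogonal_primitives P" and Q: "Q \<subseteq> P" and p: "p \<in> P"
  shows "p \<cdot> \<Sum>Q = (if p \<in> Q then p else 0)" "\<Sum>Q \<cdot> p = (if p \<in> Q then p else 0)"
proof -
  have fin: "finite Q" using P Q finite_subset unfolding orthogonal_primitives_def by blast
  have A: "q \<in> carr A" if "q \<in> P" for q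
    using that P primitiveD unfolding orthogonal_primitives_def by blast
  have pq: "p \<cdot> q = (if q = p then p else 0)" "q \<cdot> p = (if q = p then p else 0)" if "q \<in> P" for q
    using that p P primitiveD unfolding orthogonal_primitives_def by auto
  have "p \<cdot> \<Sum>Q = (\<Sum>q\<in>Q. p \<cdot> q)" using A p Q by (intro mult_sum_right) auto
  also have "\<dots> = (\<Sum>q\<in>Q. if q = p then p else 0)" using pq Q by (intro sum.cong) auto
  finally show "p \<cdot> \<Sum>Q = (if p \<in> Q then p else 0)" using fin by (simp add: sum.delta)
  have "\<Sum>Q \<cdot> p = (\<Sum>q\<in>Q. q \<cdot> p)" using A p Q by (intro mult_sum_left) auto
  also have "\<dots> = (\<Sum>q\<in>Q. if q = p then p else 0)" using pq Q by (intro sum.cong) auto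
  finally show "\<Sum>Q \<cdot> p = (if p \<in> Q then p else 0)" using fin by (simp add: sum.delta)
qed

text \<open>In a splitting \<open>e = g + h\<close> with \<open>h\<close> nonzero, \<open>h\<close>
  lies in \<open>A e\<close> but not in \<open>A g\<close>, so \<open>dim (A e)\<close> drops
  strictly and bounds the number of splittings.\<close>

lemma idempotent_decomposition:
  assumes "idempotent A e"
  shows "\<exists>P. orthogonal_primitives P \<and> \<Sum>P = e"
  using assms
proof (induction "dim (left_proj A e)" arbitrary: e rule: less_induct)
  case less
  have eA: "e \<in> carr A" "e \<cdot> e = e" using less.prems by (auto simp: idempotent_def)
  consider "e = 0" | "primitive_idempotent A e" | "e \<noteq> 0" "\<not> primitive_idempotent A e" by blast
  thus ?case
  proof cases
    case 1 thus ?thesis by (intro exI[of _ "{}"]) (simp add: orthogonal_primitives_def)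
  next
    case 2 thus ?thesis by (intro exI[of _ "{e}"]) (simp add: orthogonal_primitives_def)
  next
    case 3
    then obtain e1 e2 where d: "idempotent A e1" "idempotent A e2" "e1 \<noteq> 0" "e2 \<noteq> 0"
        "e1 \<cdot> e2 = 0" "e2 \<cdot> e1 = 0" "e = e1 + e2"
      using less.prems unfolding primitive_idempotent_def by blast
    have A: "e1 \<in> carr A" "e1 \<cdot> e1 = e1" "e2 \<in> carr A" "e2 \<cdot> e2 = e2"
      using d by (auto simp: idempotent_def)
    have smaller: "dim (left_proj A g) < dim (left_proj A e)"
      if g: "idempotent A g" "idempotent A h" "h \<noteq> 0" "g \<cdot> h = 0" "h \<cdot> g = 0" "e = g + h" for g h
    proof (rule ccontr)
      assume "\<not> ?thesis"
      hence le: "dim (left_proj A e) \<le> dim (left_proj A g)" by simp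
      have gh: "g \<in> carr A" "g \<cdot> g = g" "h \<in> carr A" "h \<cdot> h = h" using g by (auto simp: idempotent_def)
      have "left_proj A g = left_proj A e"
      proof (rule eq_if_dim_le[OF _ _ _ le])
        show "subspace (left_proj A g)"
          using gh by (auto simp: subspace_def left_proj_iff[OF g(1)] distrib_right scal_mult_left)
        show "left_proj A e \<subseteq> carr A" by (auto simp: left_proj_iff[OF less.prems])
        show "left_proj A g \<subseteq> left_proj A e"
        proof
          fix x assume "x \<in> left_proj A g"
          hence x: "x \<in> carr A" "x \<cdot> g = x" by (auto simp: left_proj_iff[OF g(1)])
          have "x \<cdot> h = (x \<cdot> g) \<cdot> h" using x by simp
          also have "\<dots> = 0" using x(1) gh g(4) by (simp add: mult_assoc)
          finally have "x \<cdot> e = x" using x gh g(6) by (simp add: distrib_left)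
          thus "x \<in> left_proj A e" using x by (simp add: left_proj_iff[OF less.prems])
        qed
      qed
      moreover have "h \<in> left_proj A e"
      proof -
        have "h \<cdot> e = h" unfolding g(6) using gh g(5) by (simp add: distrib_left)
        thus ?thesis using gh by (simp add: left_proj_iff[OF less.prems])
      qed
      ultimately have "h \<cdot> g = h" using left_proj_iff[OF g(1)] by blast
      thus False using g by simp
    qed
    obtain P1 where P1: "orthogonal_primitives P1" "\<Sum>P1 = e1"
      using less.hyps[OF smaller[of e1 e2] d(1)] d by blast
    obtain P2 where P2: "orthogonal_primitives P2" "\<Sum>P2 = e2"
      using less.hyps[OF smaller[of e2 e1] d(2)] d by (metis add.commute)
    have p1: "p \<in> carr A" "p \<cdot> e1 = p" "e1 \<cdot> p = p" "p \<noteq> 0" if "p \<in> P1" for p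
      using orthogonal_primitives_mult_sum[OF P1(1) subset_refl that] that P1 primitiveD
      unfolding orthogonal_primitives_def by auto
    have p2: "p \<in> carr A" "p \<cdot> e2 = p" "e2 \<cdot> p = p" "p \<noteq> 0" if "p \<in> P2" for p
      using orthogonal_primitives_mult_sum[OF P2(1) subset_refl that] that P2 primitiveD
      unfolding orthogonal_primitives_def by auto
    have cross: "p \<cdot> q = 0" "q \<cdot> p = 0" if "p \<in> P1" "q \<in> P2" for p q
    proof -
      have "(p \<cdot> e1) \<cdot> (e2 \<cdot> q) = p \<cdot> (e1 \<cdot> e2) \<cdot> q" "(q \<cdot> e2) \<cdot> (e1 \<cdot> p) = q \<cdot> (e2 \<cdot> e1) \<cdot> p"
        using p1(1)[OF that(1)] p2(1)[OF that(2)] A(1,3) by (simp_all add: mult_assoc)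
      thus "p \<cdot> q = 0" "q \<cdot> p = 0" using p1[OF that(1)] p2[OF that(2)] d by simp_all
    qed
    have "P1 \<inter> P2 = {}"
    proof (rule ccontr)
      assume "P1 \<inter> P2 \<noteq> {}"
      then obtain p where "p \<in> P1" "p \<in> P2" by blast
      moreover from this have "p \<cdot> p = p"
        using P1(1) primitiveD(2)[of p] unfolding orthogonal_primitives_def by simp
      ultimately show False using cross(1)[of p p] p1(4)[of p] by simp
    qed
    hence "\<Sum>(P1 \<union> P2) = e"
      using P1 P2 d(7) sum.union_disjoint[of P1 P2 "\<lambda>x. x"] unfolding orthogonal_primitives_def by simp
    moreover have "orthogonal_primitives (P1 \<union> P2)"
      using P1(1) P2(1) unfolding orthogonal_primitives_def by (simp add: ball_Un cross)
    ultimately show ?thesis by blast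
  qed
qed

text \<open>If \<open>e\<close> matched no summand, all \<open>e p\<close> would lie in the radical,
  and so would their sum \<open>e\<close>, a nonzero idempotent. Hence a decomposition of
  \<open>\<one>\<close> meets every vertex of the quiver.\<close>

lemma primitive_iso_to_summand:
  assumes P: "orthogonal_primitives P" "\<Sum>P = \<one>" and e: "primitive_idempotent A e"
  shows "\<exists>p \<in> P. proj_iso A e p"
proof (rule ccontr)
  assume no: "\<not> ?thesis"
  note eA = primitiveD[OF e]
  have PA: "p \<in> carr A" if "p \<in> P" for p
    using that P primitiveD unfolding orthogonal_primitives_def by blast
  have "e \<cdot> p \<in> rad A" if "p \<in> P" for p
    using non_iso_corner_in_rad[OF e, of p \<one>] that no P eA unfolding orthogonal_primitives_def by simp
  hence "(\<Sum>p\<in>P. e \<cdot> p) \<in> rad A" by (intro subspace_sum rad_subspace)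
  moreover have "e = (\<Sum>p\<in>P. e \<cdot> p)"
    using mult_sum_right[of e P "\<lambda>p. p"] PA P(2) eA by simp
  ultimately have "e \<in> rad A" by simp
  thus False using idempotent_rad_eq_0 eA by blast
qed

section \<open>The square of the radical and the number of arrows\<close>

lemma rad_square_subset_rad: "rad_square A \<subseteq> rad A"
  unfolding rad_square_def
  by (intro span_minimal rad_subspace) (use rad_mult_left rad_subset in blast)

lemma rad_square_mult:
  assumes x: "x \<in> rad_square A" and a: "a \<in> carr A" and b: "b \<in> carr A"
  shows "a \<cdot> x \<cdot> b \<in> rad_square A"
proof -
  have "rad_square A \<subseteq> {x \<in> carr A. a \<cdot> x \<cdot> b \<in> rad_square A}"
    unfolding rad_square_def
  proof (rule span_minimal)
    show "subspace {x \<in> carr A. a \<cdot> x \<cdot> b \<in> span {x \<cdot> y |x y. x \<in> rad A \<and> y \<in> rad A}}"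
      using a b by (auto simp: subspace_def span_zero distrib_left distrib_right span_add
          scal_mult_right scal_mult_left span_scale)
    show "{x \<cdot> y |x y. x \<in> rad A \<and> y \<in> rad A}
        \<subseteq> {x \<in> carr A. a \<cdot> x \<cdot> b \<in> span {x \<cdot> y |x y. x \<in> rad A \<and> y \<in> rad A}}"
    proof
      fix u assume "u \<in> {x \<cdot> y |x y. x \<in> rad A \<and> y \<in> rad A}"
      then obtain x y where xy: "u = x \<cdot> y" "x \<in> rad A" "y \<in> rad A" by blast
      hence A: "x \<in> carr A" "y \<in> carr A" using rad_subset by auto
      have "a \<cdot> u \<cdot> b = (a \<cdot> x) \<cdot> (y \<cdot> b)" using A a b xy by (simp add: mult_assoc)
      moreover have "a \<cdot> x \<in> rad A" "y \<cdot> b \<in> rad A"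
        using rad_mult_left rad_mult_right xy a b by auto
      ultimately have "a \<cdot> u \<cdot> b \<in> {x \<cdot> y |x y. x \<in> rad A \<and> y \<in> rad A}" by blast
      thus "u \<in> {x \<in> carr A. a \<cdot> x \<cdot> b \<in> span {x \<cdot> y |x y. x \<in> rad A \<and> y \<in> rad A}}"
        using A xy by (simp add: span_base)
    qed
  qed
  thus ?thesis using x by blast
qed

text \<open>With \<open>J\<close> the radical, \<open>K = c J d\<close> satisfies \<open>K \<subseteq> c J\<^sup>2 d \<subseteq> J K + K J\<close>, as \<open>c + d = 1\<close>; iterating,
  \<open>K\<close> vanishes because \<open>J\<close> is nilpotent.\<close>

lemma complementary_corner_eq_0:
  assumes E: "finite E" "finite F" "\<And>e. e \<in> E \<Longrightarrow> primitive_idempotent A e"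
      "\<And>f. f \<in> F \<Longrightarrow> primitive_idempotent A f"
    and c: "c = \<Sum>E" and d: "d = \<Sum>F" and cd: "c + d = \<one>" "c \<cdot> c = c" "d \<cdot> d = d"
    and non: "\<And>e f. \<lbrakk>e \<in> E; f \<in> F\<rbrakk> \<Longrightarrow> \<not> proj_iso A e f"
    and sq: "\<And>e f x. \<lbrakk>e \<in> E; f \<in> F; x \<in> rad A\<rbrakk> \<Longrightarrow> e \<cdot> x \<cdot> f \<in> rad_square A"
    and x: "x \<in> carr A"
  shows "c \<cdot> x \<cdot> d = 0"
proof -
  have EA: "\<And>e. e \<in> E \<Longrightarrow> e \<in> carr A" and FA: "\<And>f. f \<in> F \<Longrightarrow> f \<in> carr A"
    using E primitiveD by auto
  have cA: "c \<in> carr A" and dA: "d \<in> carr A" using EA FA unfolding c d by (auto intro: sum_in)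
  have exp: "c \<cdot> y \<cdot> d = (\<Sum>e\<in>E. \<Sum>f\<in>F. e \<cdot> y \<cdot> f)" if y: "y \<in> carr A" for y
  proof -
    have "c \<cdot> y \<cdot> d = (\<Sum>e\<in>E. e \<cdot> y) \<cdot> d" unfolding c using mult_sum_left[OF y, of E "\<lambda>e. e"] EA by simp
    also have "\<dots> = (\<Sum>e\<in>E. (e \<cdot> y) \<cdot> d)" using EA y by (intro mult_sum_left dA) auto
    also have "\<dots> = (\<Sum>e\<in>E. \<Sum>f\<in>F. e \<cdot> y \<cdot> f)"
      unfolding d using EA FA y by (intro sum.cong refl mult_sum_right) auto
    finally show ?thesis .
  qed
  have idem: "c \<cdot> (c \<cdot> y \<cdot> d) \<cdot> d = c \<cdot> y \<cdot> d" if y: "y \<in> carr A" for y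
  proof -
    have "c \<cdot> (c \<cdot> y \<cdot> d) \<cdot> d = (c \<cdot> c) \<cdot> y \<cdot> (d \<cdot> d)"
      using cA dA y by (simp add: mult_assoc)
    thus ?thesis using cd by simp
  qed
  have in_rad: "c \<cdot> y \<cdot> d \<in> rad A" if y: "y \<in> carr A" for y
    unfolding exp[OF y] using E non y
    by (intro subspace_sum rad_subspace non_iso_corner_in_rad) auto
  have in_sq: "c \<cdot> y \<cdot> d \<in> rad_square A" if y: "y \<in> rad A" for y
  proof -
    have "y \<in> carr A" using y rad_subset by blast
    thus ?thesis using exp sq y unfolding rad_square_def
      by (auto intro!: subspace_sum subspace_span)
  qed
  \<comment> \<open>The iteration is phrased by degrees: \<open>K\<close> raises the radical degree
    by any \<open>n\<close>. All \<open>i\<close> are needed at once, since in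
    \<open>(c p d) ((q d) m)\<close> the inner factor has already moved \<open>m\<close> from degree
    \<open>i\<close> to \<open>i + 1\<close>.\<close>
  have shift: "\<forall>y \<in> rad A. \<forall>i. \<forall>m \<in> rad_series i. (c \<cdot> y \<cdot> d) \<cdot> m \<in> rad_series (i + n)" for n
  proof (induction n)
    case 0
    show ?case
    proof (intro ballI allI)
      fix y i m assume "y \<in> rad A" "m \<in> rad_series i"
      moreover from this have "c \<cdot> y \<cdot> d \<in> carr A" using cA dA rad_subset by blast
      ultimately show "(c \<cdot> y \<cdot> d) \<cdot> m \<in> rad_series (i + 0)"
        using rad_series_left_ideal[of i] unfolding left_ideal_def by simp
    qed
  next
    case (Suc n)
    let ?U = "{y \<in> carr A. \<forall>i. \<forall>m \<in> rad_series i. (c \<cdot> y \<cdot> d) \<cdot> m \<in> rad_series (i + Suc n)}"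
    have mA: "m \<in> carr A" if "m \<in> rad_series i" for m i using that rad_series_subset by blast
    have "subspace ?U"
      unfolding subspace_def
    proof (intro conjI ballI allI)
      show "0 \<in> ?U" using cA dA mA subspace_0[OF rad_series_subspace] by (auto simp del: rad_series.simps)
      show "u + v \<in> ?U" if "u \<in> ?U" "v \<in> ?U" for u v
        using that cA dA mA subspace_add[OF rad_series_subspace]
        by (auto simp: distrib_left distrib_right simp del: rad_series.simps)
      show "scal A k u \<in> ?U" if "u \<in> ?U" for k u
        using that cA dA mA subspace_scale[OF rad_series_subspace]
        by (auto simp: scal_mult_left scal_mult_right simp del: rad_series.simps)
    qed
    moreover have "{p \<cdot> q | p q. p \<in> rad A \<and> q \<in> rad A} \<subseteq> ?U"
    proof
      fix u assume "u \<in> {p \<cdot> q | p q. p \<in> rad A \<and> q \<in> rad A}"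
      then obtain p q where u: "u = p \<cdot> q" and pq: "p \<in> rad A" "q \<in> rad A" by blast
      hence A: "p \<in> carr A" "q \<in> carr A" using rad_subset by auto
      have "(c \<cdot> u \<cdot> d) \<cdot> m \<in> rad_series (i + Suc n)" if m: "m \<in> rad_series i" for i m
      proof -
        have "c \<cdot> u \<cdot> d = c \<cdot> (p \<cdot> (c + d) \<cdot> q) \<cdot> d" using A cd u by simp
        also have "\<dots> = c \<cdot> (p \<cdot> c \<cdot> q) \<cdot> d + c \<cdot> (p \<cdot> d \<cdot> q) \<cdot> d"
          using A cA dA by (simp add: distrib_left distrib_right)
        finally have "(c \<cdot> u \<cdot> d) \<cdot> m = (c \<cdot> p) \<cdot> ((c \<cdot> q \<cdot> d) \<cdot> m) + (c \<cdot> p \<cdot> d) \<cdot> ((q \<cdot> d) \<cdot> m)"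
          using A cA dA mA[OF m] by (simp add: distrib_right mult_assoc)
        moreover have "(c \<cdot> p) \<cdot> ((c \<cdot> q \<cdot> d) \<cdot> m) \<in> rad_series (Suc (i + n))"
          using rad_mult_rad_series[OF rad_mult_left[OF cA pq(1)]] Suc.IH pq(2) m by blast
        moreover have "(q \<cdot> d) \<cdot> m \<in> rad_series (Suc i)"
          using rad_mult_rad_series[OF rad_mult_right[OF pq(2) dA] m] .
        hence "(c \<cdot> p \<cdot> d) \<cdot> ((q \<cdot> d) \<cdot> m) \<in> rad_series (Suc i + n)"
          using Suc.IH pq(1) by blast
        ultimately show ?thesis
          using subspace_add[OF rad_series_subspace] by (simp del: rad_series.simps)
      qed
      thus "u \<in> ?U" using A u by blast
    qed
    ultimately have U: "rad_square A \<subseteq> ?U" unfolding rad_square_def by (intro span_minimal)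
    show ?case
    proof (intro ballI allI)
      fix y i m assume y: "y \<in> rad A" and m: "m \<in> rad_series i"
      have "(c \<cdot> (c \<cdot> y \<cdot> d) \<cdot> d) \<cdot> m \<in> rad_series (i + Suc n)" using U in_sq[OF y] m by blast
      thus "(c \<cdot> y \<cdot> d) \<cdot> m \<in> rad_series (i + Suc n)" using idem y rad_subset by (metis subsetD)
    qed
  qed
  obtain n where n: "rad_series n = {0}" using rad_series_eventually_zero by blast
  \<comment> \<open>For arbitrary \<open>x\<close> the element \<open>c x d\<close> already lies in
    the radical, by the absence of isomorphisms; it is applied to \<open>\<one>\<close> in degree
    0.\<close>
  have "(c \<cdot> (c \<cdot> x \<cdot> d) \<cdot> d) \<cdot> \<one> \<in> rad_series (0 + n)"
    using shift[of n, rule_format, OF in_rad[OF x], of \<one> 0] by simp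
  thus ?thesis using n idem[OF x] x cA dA by simp
qed

text \<open>A zero count makes the dimensions of \<open>e J f\<close> and \<open>e J^2 f\<close>
  agree, so the two coincide by inclusion. Conjugation with \<open>\<alpha>\<close>,
  \<open>\<beta>\<close>, \<open>\<gamma>\<close>, \<open>\<delta>\<close> carries this from the
  representatives chosen by the quiver to any others.\<close>

lemma arrow_number_zero_transfer:
  assumes e: "idempotent A e" "idempotent A e'" "proj_iso A e e'"
    and f: "idempotent A f" "idempotent A f'" "proj_iso A f f'"
    and zero: "arrow_number A e f = 0" and x: "x \<in> rad A"
  shows "e' \<cdot> x \<cdot> f' \<in> rad_square A"
proof -
  have A: "e \<in> carr A" "f \<in> carr A" "e' \<in> carr A" "f' \<in> carr A" "e \<cdot> e = e" "f \<cdot> f = f"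
    using e f by (auto simp: idempotent_def)
  have sqA: "rad_square A \<subseteq> carr A" using rad_square_subset_rad rad_subset by blast
  let ?S = "\<lambda>R. {e \<cdot> x \<cdot> f | x. x \<in> R}"
  have "?S (rad_square A) = ?S (rad A)"
  proof (rule eq_if_dim_le)
    show "subspace (?S (rad_square A))"
      unfolding subspace_def
    proof (intro conjI ballI allI)
      have sub: "subspace (rad_square A)" unfolding rad_square_def by (rule subspace_span)
      have "0 = e \<cdot> 0 \<cdot> f" using A by simp
      thus "0 \<in> ?S (rad_square A)" using subspace_0[OF sub] by blast
      fix u assume "u \<in> ?S (rad_square A)"
      then obtain x where x: "u = e \<cdot> x \<cdot> f" "x \<in> rad_square A" by blast
      show "u + v \<in> ?S (rad_square A)" if "v \<in> ?S (rad_square A)" for v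
      proof -
        obtain y where y: "v = e \<cdot> y \<cdot> f" "y \<in> rad_square A" using \<open>v \<in> _\<close> by blast
        have "u + v = e \<cdot> (x + y) \<cdot> f" using x y A sqA by (simp add: distrib_left distrib_right subset_iff)
        thus ?thesis using subspace_add[OF sub x(2) y(2)] by blast
      qed
      show "scal A k u \<in> ?S (rad_square A)" for k
      proof -
        have "scal A k u = e \<cdot> scal A k x \<cdot> f"
          using x A sqA by (simp add: scal_mult_left scal_mult_right subset_iff)
        thus ?thesis using subspace_scale[OF sub x(2)] by blast
      qed
    qed
    show "?S (rad_square A) \<subseteq> ?S (rad A)" using rad_square_subset_rad by blast
    show "?S (rad A) \<subseteq> carr A" using rad_subset A by auto
    show "dim (?S (rad A)) \<le> dim (?S (rad_square A))"
      using zero unfolding arrow_number_def by simp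
  qed
  note eq = this
  obtain \<alpha> \<beta> where ab: "\<alpha> \<in> carr A" "\<beta> \<in> carr A" "e \<cdot> \<alpha> = \<alpha>" "\<alpha> \<cdot> e' = \<alpha>" "e' \<cdot> \<beta> = \<beta>"
      "\<beta> \<cdot> e = \<beta>" "\<alpha> \<cdot> \<beta> = e" "\<beta> \<cdot> \<alpha> = e'" using proj_isoE[OF e(3,1,2)] .
  obtain \<gamma> \<delta> where cd: "\<gamma> \<in> carr A" "\<delta> \<in> carr A" "f \<cdot> \<gamma> = \<gamma>" "\<gamma> \<cdot> f' = \<gamma>" "f' \<cdot> \<delta> = \<delta>"
      "\<delta> \<cdot> f = \<delta>" "\<gamma> \<cdot> \<delta> = f" "\<delta> \<cdot> \<gamma> = f'" using proj_isoE[OF f(3,1,2)] .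
  have xA: "x \<in> carr A" using x rad_subset by blast
  let ?y = "\<alpha> \<cdot> x \<cdot> \<delta>"
  have "?y \<in> rad A" using rad_mult_right[OF rad_mult_left[OF ab(1) x] cd(2)] .
  hence "e \<cdot> ?y \<cdot> f \<in> ?S (rad_square A)" using eq by blast
  then obtain z where z: "e \<cdot> ?y \<cdot> f = e \<cdot> z \<cdot> f" "z \<in> rad_square A" by blast
  have "e' \<cdot> x \<cdot> f' = (\<beta> \<cdot> \<alpha>) \<cdot> x \<cdot> (\<delta> \<cdot> \<gamma>)" unfolding ab(8) cd(8) ..
  also have "\<dots> = (\<beta> \<cdot> e) \<cdot> \<alpha> \<cdot> x \<cdot> (\<delta> \<cdot> (f \<cdot> \<gamma>))"
    unfolding ab(6) cd(3) using ab(1,2) cd(1,2) xA by (simp add: mult_assoc)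
  also have "\<dots> = \<beta> \<cdot> (e \<cdot> ?y \<cdot> f) \<cdot> \<gamma>" using ab(1,2) cd(1,2) xA A(1,2) by (simp add: mult_assoc)
  also have "\<dots> = \<beta> \<cdot> (e \<cdot> z \<cdot> f) \<cdot> \<gamma>" unfolding z(1) ..
  finally show ?thesis using rad_square_mult z(2) A(1,2) ab(1,2) cd(1,2) by simp
qed

section \<open>Central idempotents and connected components\<close>

definition central_idempotent :: "'a \<Rightarrow> bool" where
  "central_idempotent c \<longleftrightarrow> idempotent A c \<and> (\<forall>x \<in> carr A. c \<cdot> x = x \<cdot> c)"

lemma vertsE:
  assumes "V \<in> verts (gabriel_quiver A)"
  obtains e where "primitive_idempotent A e" "V = iso_rel `` {e}" "e \<in> V"
proof -
  obtain e where e: "primitive_idempotent A e" "V = iso_rel `` {e}"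
    using assms unfolding gabriel_quiver_def by (auto elim: quotientE)
  thus thesis using that equiv_class_self[OF iso_rel_equiv] by blast
qed

lemma in_vertex_iso:
  assumes "V \<in> verts (gabriel_quiver A)" "e \<in> V" "f \<in> V"
  shows "primitive_idempotent A e" "primitive_idempotent A f" "proj_iso A e f"
proof -
  have V: "V \<in> {e. primitive_idempotent A e} // iso_rel"
    using assms(1) unfolding gabriel_quiver_def by simp
  have "(e, f) \<in> iso_rel"
    using in_quotient_imp_in_rel[OF iso_rel_equiv V] assms(2,3) by blast
  thus "primitive_idempotent A e" "primitive_idempotent A f" "proj_iso A e f" by auto
qed

lemma class_in_verts: "primitive_idempotent A e \<Longrightarrow> iso_rel `` {e} \<in> verts (gabriel_quiver A)"
  unfolding gabriel_quiver_def using quotientI[of e "{e. primitive_idempotent A e}" iso_rel] by simp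

lemma class_eq_iff:
  assumes "primitive_idempotent A e" "primitive_idempotent A f"
  shows "iso_rel `` {e} = iso_rel `` {f} \<longleftrightarrow> proj_iso A e f"
  using eq_equiv_class_iff[OF iso_rel_equiv, of e f] assms by simp

text \<open>Centrality makes \<open>f c\<close> an idempotent of \<open>f A f\<close>, so each
  primitive \<open>f\<close> lies under \<open>c\<close> or under \<open>\<one> - c\<close>. The
  side depends only on the vertex, and corners between opposite sides vanish, so no arrow changes
  sides; both sides are inhabited.\<close>

lemma central_idempotent_disconnects:
  assumes c: "central_idempotent c" "c \<noteq> 0" "c \<noteq> \<one>"
  shows "\<not> connected_quiver (gabriel_quiver A)"
proof
  assume conn: "connected_quiver (gabriel_quiver A)"
  have cA: "c \<in> carr A" "c \<cdot> c = c" and comm: "\<And>x. x \<in> carr A \<Longrightarrow> c \<cdot> x = x \<cdot> c"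
    using c by (auto simp: central_idempotent_def idempotent_def)
  have ex: "\<exists>p. primitive_idempotent A p \<and> p \<cdot> g = p" if g: "idempotent A g" "g \<noteq> 0" for g
  proof -
    obtain P where P: "orthogonal_primitives P" "\<Sum>P = g"
      using idempotent_decomposition[OF g(1)] by blast
    then obtain p where "p \<in> P" using g(2) by fastforce
    thus ?thesis using orthogonal_primitives_mult_sum(1)[OF P(1) subset_refl] P
      unfolding orthogonal_primitives_def by auto
  qed
  obtain p where p: "primitive_idempotent A p" "p \<cdot> c = p"
    using ex[of c] c unfolding central_idempotent_def by blast
  have "idempotent A (\<one> - c)"
    using cA by (simp add: idempotent_def mult_diff_left mult_diff_right)
  then obtain q where q: "primitive_idempotent A q" "q \<cdot> (\<one> - c) = q"
    using ex[of "\<one> - c"] c(3) by auto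
  have qc: "q \<cdot> c = 0"
    using q primitiveD[OF q(1)] cA by (simp add: mult_diff_right)
  have dichotomy: "f \<cdot> c = f \<or> f \<cdot> c = 0" if f: "primitive_idempotent A f" for f
  proof -
    note fA = primitiveD[OF f]
    have "f \<cdot> c \<cdot> (f \<cdot> c) = f \<cdot> (c \<cdot> f) \<cdot> c" using fA cA by (simp add: mult_assoc)
    also have "\<dots> = (f \<cdot> f) \<cdot> (c \<cdot> c)" unfolding comm[OF fA(1)] using fA(1) cA(1) by (simp add: mult_assoc)
    finally have "f \<cdot> c \<cdot> (f \<cdot> c) = f \<cdot> c" using fA cA by simp
    moreover have "f \<cdot> (f \<cdot> c) = f \<cdot> c" using fA cA by (simp add: mult_assoc[symmetric])
    moreover have "f \<cdot> c \<cdot> f = f \<cdot> c" using fA cA(1) comm[OF fA(1)]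
      by (metis calculation(2) mult_assoc)
    ultimately show ?thesis using primitive_unique_idempotent[OF f, of "f \<cdot> c"] fA cA by blast
  qed
  have iso_inv: "f \<cdot> c = 0" if f: "primitive_idempotent A f" "primitive_idempotent A g" "proj_iso A f g"
    and g: "g \<cdot> c = 0" for f g
  proof -
    obtain \<alpha> \<beta> where ab: "\<alpha> \<in> carr A" "\<beta> \<in> carr A" "f \<cdot> \<alpha> = \<alpha>" "\<alpha> \<cdot> g = \<alpha>" "g \<cdot> \<beta> = \<beta>"
      "\<beta> \<cdot> f = \<beta>" "\<alpha> \<cdot> \<beta> = f" "\<beta> \<cdot> \<alpha> = g"
      using proj_isoE f unfolding primitive_idempotent_def by metis
    have "f \<cdot> c = \<alpha> \<cdot> g \<cdot> \<beta> \<cdot> c" unfolding ab(4,7) ..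
    also have "\<dots> = \<alpha> \<cdot> g \<cdot> (\<beta> \<cdot> c)" using ab(1,2) primitiveD(1)[OF f(2)] cA(1) by (simp add: mult_assoc)
    also have "\<dots> = \<alpha> \<cdot> (g \<cdot> c) \<cdot> \<beta>"
      unfolding comm[OF ab(2), symmetric] using ab(1,2) primitiveD(1)[OF f(2)] cA(1)
      by (simp add: mult_assoc)
    finally show ?thesis using g ab by simp
  qed
  \<comment> \<open>All idempotents in the class are tracked, because \<open>arrows\<close> is
    evaluated at an unknown representative.\<close>
  have reach: "W \<in> verts (gabriel_quiver A) \<and> (\<forall>f \<in> W. f \<cdot> c = f)"
    if "(iso_rel `` {p}, W) \<in> (adjacency (gabriel_quiver A))\<^sup>*" for W
    using that
  proof (induction rule: rtrancl_induct)
    case base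
    have V: "iso_rel `` {p} \<in> verts (gabriel_quiver A)" using class_in_verts p(1) .
    have "f \<cdot> c = f" if "f \<in> iso_rel `` {p}" for f
    proof -
      have f: "primitive_idempotent A f" "proj_iso A p f" using that by auto
      show ?thesis using dichotomy[OF f(1)] iso_inv[OF p(1) f] p(2) primitiveD(3)[OF p(1)] by force
    qed
    thus ?case using V by blast
  next
    case (step V W)
    have V: "V \<in> verts (gabriel_quiver A)" and W: "W \<in> verts (gabriel_quiver A)"
      and arr: "arrows (gabriel_quiver A) V W > 0 \<or> arrows (gabriel_quiver A) W V > 0"
      using step(2) unfolding adjacency_def by auto
    define e where "e = (SOME e. e \<in> V)"
    define f where "f = (SOME f. f \<in> W)"
    have eV: "e \<in> V" unfolding e_def using vertsE[OF V] by (metis someI_ex)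
    have fW: "f \<in> W" unfolding f_def using vertsE[OF W] by (metis someI_ex)
    have e: "primitive_idempotent A e" using in_vertex_iso[OF V eV eV] by simp
    have f: "primitive_idempotent A f" using in_vertex_iso[OF W fW fW] by simp
    note eA = primitiveD[OF e] and fA = primitiveD[OF f]
    have ec: "e \<cdot> c = e" using step.IH eV by blast
    have fc: "f \<cdot> c = f"
    proof (rule ccontr)
      assume "f \<cdot> c \<noteq> f"
      hence f0: "f \<cdot> c = 0" using dichotomy[OF f] by blast
      have "e \<cdot> x \<cdot> f = 0" "f \<cdot> x \<cdot> e = 0" if x: "x \<in> carr A" for x
      proof -
        have "e \<cdot> x \<cdot> f = (e \<cdot> c) \<cdot> (x \<cdot> f)" unfolding ec using eA(1) fA(1) x by (simp add: mult_assoc)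
        also have "\<dots> = e \<cdot> (c \<cdot> (x \<cdot> f))" using eA(1) fA(1) x cA(1) by (simp add: mult_assoc)
        also have "\<dots> = e \<cdot> (x \<cdot> (f \<cdot> c))" using comm[of "x \<cdot> f"] eA(1) fA(1) x cA(1) by (simp add: mult_assoc)
        finally show "e \<cdot> x \<cdot> f = 0" using f0 eA x by simp
        have "f \<cdot> x \<cdot> e = f \<cdot> (x \<cdot> (e \<cdot> c))" unfolding ec using eA(1) fA(1) x by (simp add: mult_assoc)
        also have "\<dots> = f \<cdot> (x \<cdot> (c \<cdot> e))" using comm[OF eA(1)] by simp
        also have "\<dots> = f \<cdot> ((x \<cdot> c) \<cdot> e)" using eA(1) fA(1) x cA(1) by (simp add: mult_assoc)
        also have "\<dots> = f \<cdot> ((c \<cdot> x) \<cdot> e)" using comm[OF x] by simp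
        also have "\<dots> = f \<cdot> c \<cdot> (x \<cdot> e)" using eA(1) fA(1) x cA(1) by (simp add: mult_assoc)
        finally show "f \<cdot> x \<cdot> e = 0" using f0 eA x by simp
      qed
      hence "{e \<cdot> x \<cdot> f | x. x \<in> rad A} \<subseteq> span {}" "{f \<cdot> x \<cdot> e | x. x \<in> rad A} \<subseteq> span {}"
        using rad_subset by auto
      hence "dim {e \<cdot> x \<cdot> f | x. x \<in> rad A} \<le> card ({} :: 'a set)"
          "dim {f \<cdot> x \<cdot> e | x. x \<in> rad A} \<le> card ({} :: 'a set)"
        by (auto intro!: dim_le_card simp del: card.empty)
      hence "arrow_number A e f = 0" "arrow_number A f e = 0" unfolding arrow_number_def by simp_all
      thus False using arr unfolding gabriel_quiver_def e_def f_def by simp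
    qed
    have "g \<cdot> c = g" if "g \<in> W" for g
    proof -
      have g: "primitive_idempotent A g" "proj_iso A f g" using in_vertex_iso[OF W fW that] by auto
      show ?thesis using dichotomy[OF g(1)] iso_inv[OF f g] fc fA(3) by force
    qed
    thus ?case using W by blast
  qed
  have "(iso_rel `` {p}, iso_rel `` {q}) \<in> (adjacency (gabriel_quiver A))\<^sup>*"
    using conn class_in_verts p(1) q(1) unfolding connected_quiver_def by blast
  hence "q \<cdot> c = q" using reach equiv_class_self[OF iso_rel_equiv] q(1) by blast
  thus False using qc primitiveD(3)[OF q(1)] by simp
qed

text \<open>A decomposition of \<open>\<one>\<close> is divided according to whether the vertex can
  be reached from \<open>v\<close>. No arrow joins the halves in either direction, so both
  off-diagonal corners vanish and the sum \<open>c\<close> of one half is central. As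
  \<open>v\<close> and \<open>w\<close> lie in different halves, \<open>c\<close> is neither
  \<open>0\<close> nor \<open>\<one>\<close>.\<close>

lemma connected_if_no_central_idempotent:
  assumes one: "\<one> \<noteq> 0" and triv: "\<And>c. central_idempotent c \<Longrightarrow> c = 0 \<or> c = \<one>"
  shows "connected_quiver (gabriel_quiver A)"
proof (rule ccontr)
  let ?Q = "gabriel_quiver A"
  assume nc: "\<not> connected_quiver ?Q"
  have "idempotent A \<one>" by (simp add: idempotent_def)
  from idempotent_decomposition[OF this] obtain P where P: "orthogonal_primitives P" "\<Sum>P = \<one>"
    by blast
  have prim: "primitive_idempotent A p" if "p \<in> P" for p
    using that P unfolding orthogonal_primitives_def by blast
  have fin: "finite P" using P unfolding orthogonal_primitives_def by blast
  obtain p0 where "p0 \<in> P" using P(2) one by fastforce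
  hence "verts ?Q \<noteq> {}" using class_in_verts[OF prim] by blast
  then obtain v w where vw: "v \<in> verts ?Q" "w \<in> verts ?Q" "(v, w) \<notin> (adjacency ?Q)\<^sup>*"
    using nc unfolding connected_quiver_def by blast
  define S where "S e \<longleftrightarrow> (v, iso_rel `` {e}) \<in> (adjacency ?Q)\<^sup>*" for e
  define E where "E = {p \<in> P. S p}"
  define F where "F = {p \<in> P. \<not> S p}"
  have EF: "E \<subseteq> P" "F \<subseteq> P" "E \<inter> F = {}" "E \<union> F = P" unfolding E_def F_def by auto
  have finEF: "finite E" "finite F" using EF fin finite_subset by blast+
  have noarrow: "arrows ?Q (iso_rel `` {e}) (iso_rel `` {f}) = 0"
      "arrows ?Q (iso_rel `` {f}) (iso_rel `` {e}) = 0" if "e \<in> E" "f \<in> F" for e f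
  proof -
    have "(iso_rel `` {e}, iso_rel `` {f}) \<notin> adjacency ?Q"
    proof
      assume adj: "(iso_rel `` {e}, iso_rel `` {f}) \<in> adjacency ?Q"
      have "S e" "\<not> S f" using that unfolding E_def F_def by blast+
      thus False unfolding S_def using rtrancl.rtrancl_into_rtrancl[OF _ adj, of v] by blast
    qed
    thus "arrows ?Q (iso_rel `` {e}) (iso_rel `` {f}) = 0"
      "arrows ?Q (iso_rel `` {f}) (iso_rel `` {e}) = 0"
      using class_in_verts that EF prim unfolding adjacency_def by auto
  qed
  have sq: "e \<cdot> x \<cdot> f \<in> rad_square A"
    if ef: "e \<in> P" "f \<in> P" and "arrows ?Q (iso_rel `` {e}) (iso_rel `` {f}) = 0" "x \<in> rad A" for e f x
  proof -
    define e' where "e' = (SOME e'. e' \<in> iso_rel `` {e})"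
    define f' where "f' = (SOME f'. f' \<in> iso_rel `` {f})"
    have C: "e \<in> iso_rel `` {e}" "f \<in> iso_rel `` {f}"
      using equiv_class_self[OF iso_rel_equiv] prim ef by blast+
    have "e' \<in> iso_rel `` {e}" unfolding e'_def by (rule someI[of "\<lambda>e'. e' \<in> iso_rel `` {e}", OF C(1)])
    note 1 = in_vertex_iso[OF class_in_verts[OF prim[OF ef(1)]] this C(1)]
    have "f' \<in> iso_rel `` {f}" unfolding f'_def by (rule someI[of "\<lambda>f'. f' \<in> iso_rel `` {f}", OF C(2)])
    note 2 = in_vertex_iso[OF class_in_verts[OF prim[OF ef(2)]] this C(2)]
    have "arrow_number A e' f' = 0"
      using that unfolding gabriel_quiver_def e'_def f'_def by simp
    thus ?thesis
      using arrow_number_zero_transfer[of e' e f' f x] 1 2 that(4)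
      unfolding primitive_idempotent_def by blast
  qed
  have non: "\<not> proj_iso A e f" "\<not> proj_iso A f e" if "e \<in> E" "f \<in> F" for e f
  proof -
    have "iso_rel `` {e} \<noteq> iso_rel `` {f}" using that unfolding E_def F_def S_def by auto
    thus "\<not> proj_iso A e f" "\<not> proj_iso A f e"
      using class_eq_iff[of e f] class_eq_iff[of f e] that EF prim by auto
  qed
  define c where "c = \<Sum>E"
  define d where "d = \<Sum>F"
  have cA: "c \<in> carr A" and dA: "d \<in> carr A"
    unfolding c_def d_def using EF prim primitiveD(1) by (auto intro!: sum_in)
  have cd1: "c + d = \<one>"
    unfolding c_def d_def using sum.union_disjoint[OF finEF EF(3), of "\<lambda>x. x"] EF P by simp
  have "c \<cdot> d = (\<Sum>e\<in>E. e \<cdot> d)"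
    unfolding c_def using EF prim primitiveD(1) by (intro mult_sum_left dA) blast
  also have "\<dots> = 0"
  proof (rule sum.neutral, rule ballI)
    fix e assume e: "e \<in> E"
    hence "e \<in> P" "e \<notin> F" using EF by auto
    thus "e \<cdot> d = 0" unfolding d_def using orthogonal_primitives_mult_sum(1)[OF P(1) EF(2)] by simp
  qed
  finally have cd: "c \<cdot> d = 0" .
  have d_eq: "d = \<one> - c" using cd1 by (simp add: eq_diff_eq add.commute)
  have cc: "c \<cdot> c = c" using cd cA unfolding d_eq by (simp add: mult_diff_right)
  have dd: "d \<cdot> d = d" unfolding d_eq using cA cc by (simp add: mult_diff_right mult_diff_left)
  have "c \<cdot> x \<cdot> d = 0" if "x \<in> carr A" for x
    by (rule complementary_corner_eq_0[OF finEF _ _ c_def d_def cd1 cc dd _ _ that])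
      (use EF prim non noarrow sq in auto)
  moreover have "d \<cdot> x \<cdot> c = 0" if "x \<in> carr A" for x
    by (rule complementary_corner_eq_0[OF finEF(2,1) _ _ d_def c_def _ dd cc _ _ that])
      (use EF prim non noarrow sq cd1 in \<open>auto simp: add.commute\<close>)
  ultimately have "c \<cdot> x = x \<cdot> c" if "x \<in> carr A" for x
    using that cA unfolding d_eq by (simp add: mult_diff_right mult_diff_left)
  hence "central_idempotent c" using cc cA unfolding central_idempotent_def idempotent_def by blast
  hence c01: "c = 0 \<or> c = \<one>" by (rule triv)
  have nonempty: "\<exists>p \<in> P. iso_rel `` {p} = V" if V: "V \<in> verts ?Q" for V
  proof -
    obtain e where e: "primitive_idempotent A e" "V = iso_rel `` {e}" using vertsE[OF V] by blast
    obtain p where p: "p \<in> P" "proj_iso A e p" using primitive_iso_to_summand[OF P e(1)] by blast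
    hence "iso_rel `` {e} = iso_rel `` {p}" using class_eq_iff[OF e(1) prim[OF p(1)]] by blast
    thus ?thesis using e(2) p(1) by blast
  qed
  obtain p where p: "p \<in> P" "iso_rel `` {p} = v" using nonempty vw by blast
  have pE: "p \<in> E" using p unfolding E_def S_def by simp
  obtain q where q: "q \<in> P" "iso_rel `` {q} = w" using nonempty vw by blast
  have qE: "q \<notin> E" using q vw unfolding E_def S_def by simp
  have "p \<cdot> c = p" "q \<cdot> c = 0"
    using orthogonal_primitives_mult_sum(1)[OF P(1) EF(1)] p q pE qE unfolding c_def by simp_all
  thus False using c01 primitiveD[OF prim[OF p(1)]] primitiveD[OF prim[OF q(1)]] by auto
qed

theorem connected_gabriel_quiver_iff:
  "connected_quiver (gabriel_quiver A) \<longleftrightarrow>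
     \<one> \<noteq> 0 \<and> (\<forall>c. central_idempotent c \<longrightarrow> c = 0 \<or> c = \<one>)"
proof
  assume conn: "connected_quiver (gabriel_quiver A)"
  have "\<one> \<noteq> 0"
  proof
    assume one: "\<one> = 0"
    have "\<not> primitive_idempotent A e" for e
      using primitiveD[of e] mult_one_left[of e] one by auto
    hence "verts (gabriel_quiver A) = {}" unfolding gabriel_quiver_def by simp
    thus False using conn unfolding connected_quiver_def by blast
  qed
  thus "\<one> \<noteq> 0 \<and> (\<forall>c. central_idempotent c \<longrightarrow> c = 0 \<or> c = \<one>)"
    using central_idempotent_disconnects conn by blast
qed (use connected_if_no_central_idempotent in blast)

end

section \<open>Linear and triangulated categories\<close>

context linear_category
begin

text \<open>In the ambient space a morphism does not determine its ends (zero lies in every Hom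
  space), so the ends are carried along.\<close>

definition arr :: "'m \<Rightarrow> 'o \<Rightarrow> 'o \<Rightarrow> bool" where
  "arr f X Y \<longleftrightarrow> X \<in> Obj C \<and> Y \<in> Obj C \<and> f \<in> Hom C X Y"

lemma arrD: "arr f X Y \<Longrightarrow> X \<in> Obj C" "arr f X Y \<Longrightarrow> Y \<in> Obj C" "arr f X Y \<Longrightarrow> f \<in> Hom C X Y"
  unfolding arr_def by auto

lemma arr_comp: "\<lbrakk>arr f X Y; arr g Y Z\<rbrakk> \<Longrightarrow> arr (g \<odot> f) X Z"
  unfolding arr_def using Comp_in by blast

lemma arr_Id: "X \<in> Obj C \<Longrightarrow> arr (Id C X) X X"
  unfolding arr_def using Id_in by blast

lemma arr_zero: "\<lbrakk>X \<in> Obj C; Y \<in> Obj C\<rbrakk> \<Longrightarrow> arr 0 X Y"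
  unfolding arr_def using Hom_subspace subspace_0 by blast

lemma arr_add: "\<lbrakk>arr f X Y; arr g X Y\<rbrakk> \<Longrightarrow> arr (f + g) X Y"
  unfolding arr_def using Hom_subspace subspace_add by blast

lemma arr_diff: "\<lbrakk>arr f X Y; arr g X Y\<rbrakk> \<Longrightarrow> arr (f - g) X Y"
  unfolding arr_def using Hom_subspace subspace_diff by blast

lemma arr_uminus: "arr f X Y \<Longrightarrow> arr (- f) X Y"
  unfolding arr_def using Hom_subspace subspace_neg by blast

lemma comp_assoc: "\<lbrakk>arr f W X; arr g X Y; arr h Y Z\<rbrakk> \<Longrightarrow> h \<odot> g \<odot> f = h \<odot> (g \<odot> f)"
  unfolding arr_def using Comp_assoc by blast

lemma comp_Id_left: "arr f X Y \<Longrightarrow> Id C Y \<odot> f = f"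
  unfolding arr_def using Id_left by blast

lemma comp_Id_right: "arr f X Y \<Longrightarrow> f \<odot> Id C X = f"
  unfolding arr_def using Id_right by blast

lemma comp_add_left: "\<lbrakk>arr f X Y; arr g Y Z; arr g' Y Z\<rbrakk> \<Longrightarrow> (g + g') \<odot> f = g \<odot> f + g' \<odot> f"
  unfolding arr_def using Comp_add_left by blast

lemma comp_add_right: "\<lbrakk>arr f X Y; arr f' X Y; arr g Y Z\<rbrakk> \<Longrightarrow> g \<odot> (f + f') = g \<odot> f + g \<odot> f'"
  unfolding arr_def using Comp_add_right by blast

lemma comp_diff_left:
  assumes "arr f X Y" "arr g Y Z" "arr g' Y Z"
  shows "(g - g') \<odot> f = g \<odot> f - g' \<odot> f"
  using comp_add_left[OF assms(1) arr_diff[OF assms(2,3)] assms(3)] by (simp add: eq_diff_eq)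

lemma comp_diff_right:
  assumes "arr f X Y" "arr f' X Y" "arr g Y Z"
  shows "g \<odot> (f - f') = g \<odot> f - g \<odot> f'"
  using comp_add_right[OF arr_diff[OF assms(1,2)] assms(2,3)] by (simp add: eq_diff_eq)

lemma comp_zero_left: "arr f X Y \<Longrightarrow> 0 \<odot> f = 0"
  using comp_diff_left[of f X Y "Id C Y" Y "Id C Y"] arr_Id arrD by simp

lemma comp_zero_right: "arr f X Y \<Longrightarrow> f \<odot> 0 = 0"
  using comp_diff_right[of "Id C X" X X "Id C X" f Y] arr_Id arrD by simp

text \<open>These are the morphisms that factor through a finite direct sum of copies of
  \<open>T\<close>; sums of composites avoid choosing such a direct sum.\<close>

definition thru :: "'o \<Rightarrow> 'o \<Rightarrow> 'o \<Rightarrow> 'm set" where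
  "thru T X Y = span {a \<odot> b | a b. arr b X T \<and> arr a T Y}"

lemma thru_subset:
  assumes "X \<in> Obj C" "Y \<in> Obj C"
    and "subspace S" "\<And>a b. \<lbrakk>arr b X T; arr a T Y\<rbrakk> \<Longrightarrow> a \<odot> b \<in> S"
  shows "thru T X Y \<subseteq> S"
  unfolding thru_def using assms by (intro span_minimal) auto

lemma subspace_post_comp:
  assumes "X \<in> Obj C" "arr d Y Z" "subspace S"
  shows "subspace {m \<in> Hom C X Y. d \<odot> m \<in> S}"
proof (rule subspaceI)
  have Y: "Y \<in> Obj C" "Z \<in> Obj C" using assms arrD by blast+
  have H: "subspace (Hom C X Y)" using Hom_subspace assms(1) Y by blast
  show "0 \<in> {m \<in> Hom C X Y. d \<odot> m \<in> S}"
    using subspace_0[OF H] comp_zero_right[OF assms(2)] subspace_0[OF assms(3)] by simp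
  show "x + y \<in> {m \<in> Hom C X Y. d \<odot> m \<in> S}"
    if "x \<in> {m \<in> Hom C X Y. d \<odot> m \<in> S}" "y \<in> {m \<in> Hom C X Y. d \<odot> m \<in> S}" for x y
    using that subspace_add[OF H] subspace_add[OF assms(3)] Comp_add_right[OF assms(1) Y] arrD[OF assms(2)]
    by simp
  show "Scal C k x \<in> {m \<in> Hom C X Y. d \<odot> m \<in> S}"
    if "x \<in> {m \<in> Hom C X Y. d \<odot> m \<in> S}" for k x
    using that subspace_scale[OF H] subspace_scale[OF assms(3)] Comp_scal_right[OF assms(1) Y] arrD[OF assms(2)]
    by simp
qed

lemma subspace_pre_comp:
  assumes "Z \<in> Obj C" "arr d X Y" "subspace S"
  shows "subspace {m \<in> Hom C Y Z. m \<odot> d \<in> S}"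
proof (rule subspaceI)
  have Y: "X \<in> Obj C" "Y \<in> Obj C" using assms arrD by blast+
  have H: "subspace (Hom C Y Z)" using Hom_subspace assms(1) Y by blast
  show "0 \<in> {m \<in> Hom C Y Z. m \<odot> d \<in> S}"
    using subspace_0[OF H] comp_zero_left[OF assms(2)] subspace_0[OF assms(3)] by simp
  show "x + y \<in> {m \<in> Hom C Y Z. m \<odot> d \<in> S}"
    if "x \<in> {m \<in> Hom C Y Z. m \<odot> d \<in> S}" "y \<in> {m \<in> Hom C Y Z. m \<odot> d \<in> S}" for x y
    using that subspace_add[OF H] subspace_add[OF assms(3)] Comp_add_left[OF Y assms(1)] arrD[OF assms(2)]
    by simp
  show "Scal C k x \<in> {m \<in> Hom C Y Z. m \<odot> d \<in> S}"
    if "x \<in> {m \<in> Hom C Y Z. m \<odot> d \<in> S}" for k x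
    using that subspace_scale[OF H] subspace_scale[OF assms(3)] Comp_scal_left[OF Y assms(1)] arrD[OF assms(2)]
    by simp
qed

lemma thru_post_comp:
  assumes "X \<in> Obj C" "m \<in> thru T X Y" "arr v Y Z"
  shows "v \<odot> m \<in> thru T X Z"
proof -
  have Y: "Y \<in> Obj C" using assms arrD by blast
  have "thru T X Y \<subseteq> {m \<in> Hom C X Y. v \<odot> m \<in> thru T X Z}"
  proof (rule thru_subset[OF assms(1) Y])
    show "subspace {m \<in> Hom C X Y. v \<odot> m \<in> thru T X Z}"
      using subspace_post_comp[OF assms(1,3)] unfolding thru_def by blast
    fix a b assume ab: "arr b X T" "arr a T Y"
    have "v \<odot> (a \<odot> b) = (v \<odot> a) \<odot> b" using comp_assoc[OF ab assms(3)] by simp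
    moreover have "(v \<odot> a) \<odot> b \<in> thru T X Z"
      unfolding thru_def using ab arr_comp[OF ab(2) assms(3)] by (intro span_base) blast
    ultimately show "a \<odot> b \<in> {m \<in> Hom C X Y. v \<odot> m \<in> thru T X Z}"
      using arrD(3)[OF arr_comp[OF ab]] by simp
  qed
  thus ?thesis using assms(2) by blast
qed

lemma thru_pre_comp:
  assumes "Y \<in> Obj C" "m \<in> thru T X Y" "arr u W X"
  shows "m \<odot> u \<in> thru T W Y"
proof -
  have X: "X \<in> Obj C" using assms arrD by blast
  have "thru T X Y \<subseteq> {m \<in> Hom C X Y. m \<odot> u \<in> thru T W Y}"
  proof (rule thru_subset[OF X assms(1)])
    show "subspace {m \<in> Hom C X Y. m \<odot> u \<in> thru T W Y}"
      using subspace_pre_comp[OF assms(1,3)] unfolding thru_def by blast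
    fix a b assume ab: "arr b X T" "arr a T Y"
    have "a \<odot> b \<odot> u = a \<odot> (b \<odot> u)" using comp_assoc[OF assms(3) ab] .
    moreover have "a \<odot> (b \<odot> u) \<in> thru T W Y"
      unfolding thru_def using ab arr_comp[OF assms(3) ab(1)] by (intro span_base) blast
    ultimately show "a \<odot> b \<in> {m \<in> Hom C X Y. m \<odot> u \<in> thru T W Y}"
      using arrD(3)[OF arr_comp[OF ab]] by simp
  qed
  thus ?thesis using assms(2) by blast
qed

text \<open>Morphisms through \<open>T\<close> form a two-sided ideal. The identity of a direct sum
  is a sum of terms \<open>\<iota> \<pi>\<close>, that of a summand is \<open>\<pi> \<iota>\<close>,
  so both closure rules preserve the property. It replaces membership in \<open>add T\<close> by a
  condition on one morphism.\<close>

lemma add_closure_thru: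
  assumes T: "T \<in> Obj C" and Y: "Y \<in> add_closure C T"
  shows "Y \<in> Obj C \<and> Id C Y \<in> thru T Y Y"
  using Y
proof induction
  case base
  have "Id C T \<odot> Id C T \<in> thru T T T"
    unfolding thru_def using arr_Id[OF T] by (intro span_base) blast
  thus ?case using T comp_Id_left[OF arr_Id[OF T]] by simp
next
  case (sum Xs Z)
  obtain \<iota> \<pi> where Z: "Z \<in> Obj C" "set Xs \<subseteq> Obj C"
    and maps: "\<And>i. i < length Xs \<Longrightarrow> \<iota> i \<in> Hom C (Xs ! i) Z \<and> \<pi> i \<in> Hom C Z (Xs ! i)"
    and Id: "(\<Sum>i < length Xs. \<iota> i \<odot> \<pi> i) = Id C Z"
    using sum.hyps unfolding direct_sum_def by blast
  have "\<iota> i \<odot> \<pi> i \<in> thru T Z Z" if i: "i < length Xs" for i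
  proof -
    have X: "Xs ! i \<in> Obj C" "Id C (Xs ! i) \<in> thru T (Xs ! i) (Xs ! i)"
      using sum.IH i by auto
    have arr: "arr (\<iota> i) (Xs ! i) Z" "arr (\<pi> i) Z (Xs ! i)"
      using maps[OF i] X Z unfolding arr_def by auto
    have "Id C (Xs ! i) \<odot> \<pi> i \<in> thru T Z (Xs ! i)" using thru_pre_comp[OF X arr(2)] .
    hence "\<pi> i \<in> thru T Z (Xs ! i)" using comp_Id_left[OF arr(2)] by simp
    thus ?thesis using thru_post_comp[OF Z(1) _ arr(1)] by blast
  qed
  hence "(\<Sum>i < length Xs. \<iota> i \<odot> \<pi> i) \<in> thru T Z Z"
    unfolding thru_def by (intro subspace_sum subspace_span) auto
  thus ?case using Id Z by simp
next
  case (summand Z Xs X)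
  obtain \<iota> \<pi> where Z: "Z \<in> Obj C" "set Xs \<subseteq> Obj C"
    and maps: "\<And>i. i < length Xs \<Longrightarrow> \<iota> i \<in> Hom C (Xs ! i) Z \<and> \<pi> i \<in> Hom C Z (Xs ! i)"
    and Id: "\<And>i. i < length Xs \<Longrightarrow> \<pi> i \<odot> \<iota> i = Id C (Xs ! i)"
    using summand.hyps(2) unfolding direct_sum_def by (metis (lifting))
  obtain i where i: "i < length Xs" "X = Xs ! i"
    using summand.hyps(3) by (metis in_set_conv_nth)
  have X: "X \<in> Obj C" using Z summand.hyps(3) by blast
  have arr: "arr (\<iota> i) X Z" "arr (\<pi> i) Z X"
    using maps[OF i(1)] X Z i(2) unfolding arr_def by auto
  have "Id C Z \<odot> \<iota> i \<in> thru T X Z" using thru_pre_comp[OF Z(1) _ arr(1)] summand.IH by blast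
  hence "\<iota> i \<in> thru T X Z" using comp_Id_left[OF arr(1)] by simp
  hence "\<pi> i \<odot> \<iota> i \<in> thru T X X" using thru_post_comp[OF X _ arr(2)] by blast
  thus ?case using Id[OF i(1)] i(2) X by simp
qed

text \<open>The endomorphisms of \<open>Y\<close> killed by \<open>d\<close> form a subspace that
  contains all composites through \<open>T\<close>, hence the identity. Maps out of
  \<open>add T\<close> are tested on \<open>T\<close> in this way.\<close>

lemma eq_0_if_thru_right:
  assumes Id: "Id C Y \<in> thru T Y Y" and d: "arr d Y W" and z: "\<And>y. arr y T Y \<Longrightarrow> d \<odot> y = 0"
  shows "d = 0"
proof -
  have Y: "Y \<in> Obj C" using d arrD by blast
  have "thru T Y Y \<subseteq> {m \<in> Hom C Y Y. d \<odot> m \<in> {0}}"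
  proof (rule thru_subset[OF Y Y subspace_post_comp[OF Y d]])
    show "subspace {0}" by (rule subspace_single_0)
    fix a b assume ab: "arr b Y T" "arr a T Y"
    have "d \<odot> (a \<odot> b) = d \<odot> a \<odot> b" using comp_assoc[OF ab d] by simp
    thus "a \<odot> b \<in> {m \<in> Hom C Y Y. d \<odot> m \<in> {0}}"
      using z[OF ab(2)] comp_zero_left[OF ab(1)] arrD(3)[OF arr_comp[OF ab]] by simp
  qed
  hence "d \<odot> Id C Y = 0" using Id by blast
  thus ?thesis using comp_Id_right[OF d] by simp
qed

lemma eq_0_if_thru_left:
  assumes Id: "Id C Y \<in> thru T Y Y" and d: "arr d W Y" and z: "\<And>y. arr y Y T \<Longrightarrow> y \<odot> d = 0"
  shows "d = 0"
proof -
  have Y: "Y \<in> Obj C" using d arrD by blast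
  have "thru T Y Y \<subseteq> {m \<in> Hom C Y Y. m \<odot> d \<in> {0}}"
  proof (rule thru_subset[OF Y Y subspace_pre_comp[OF Y d]])
    show "subspace {0}" by (rule subspace_single_0)
    fix a b assume ab: "arr b Y T" "arr a T Y"
    have "a \<odot> b \<odot> d = a \<odot> (b \<odot> d)" using comp_assoc[OF d ab] .
    thus "a \<odot> b \<in> {m \<in> Hom C Y Y. m \<odot> d \<in> {0}}"
      using z[OF ab(1)] comp_zero_right[OF ab(2)] arrD(3)[OF arr_comp[OF ab]] by simp
  qed
  hence "Id C Y \<odot> d = 0" using Id by blast
  thus ?thesis using comp_Id_left[OF d] by simp
qed

text \<open>An object together with an idempotent stands for the direct summand that the idempotent would
  split off, so that no idempotent ever has to be split.\<close>

definition idem :: "'o \<Rightarrow> 'm \<Rightarrow> bool" where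
  "idem X e \<longleftrightarrow> arr e X X \<and> e \<odot> e = e"

definition intertwines :: "'o \<Rightarrow> 'm \<Rightarrow> 'o \<Rightarrow> 'm \<Rightarrow> bool" where
  "intertwines X e Y e' \<longleftrightarrow> (\<forall>x. arr x X Y \<longrightarrow> e' \<odot> x = x \<odot> e)"

text \<open>The factorisation half of exactness of both Hom sequences at the middle of a triangle.
  Isolating it lets a triangle and its shift, whose maps differ by signs, be treated alike.\<close>

definition exact_at :: "'o \<Rightarrow> 'o \<Rightarrow> 'o \<Rightarrow> 'm \<Rightarrow> 'm \<Rightarrow> bool" where
  "exact_at A X B a b \<longleftrightarrow> arr a A X \<and> arr b X B \<and>
     (\<forall>W y. arr y X W \<longrightarrow> y \<odot> a = 0 \<longrightarrow> (\<exists>w. arr w B W \<and> y = w \<odot> b)) \<and>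
     (\<forall>W y. arr y W X \<longrightarrow> b \<odot> y = 0 \<longrightarrow> (\<exists>w. arr w W A \<and> y = a \<odot> w))"

text \<open>The commutator is \<open>e' x (1 - e) - (1 - e') x e\<close>. Multiplying by
  \<open>e'\<close> on the left keeps the first corner, by \<open>e\<close> on the right the second
  up to sign; if these agree they lie in complementary corners, so both vanish, in every
  characteristic.\<close>

lemma commutator_eq_0:
  assumes e: "idem X e" "idem Y e'" and x: "arr x X Y"
    and d: "e' \<odot> (e' \<odot> x - x \<odot> e) = (e' \<odot> x - x \<odot> e) \<odot> e"
  shows "e' \<odot> x = x \<odot> e"
proof -
  have eA: "arr e X X" "e \<odot> e = e" "arr e' Y Y" "e' \<odot> e' = e'" using e by (auto simp: idem_def)
  have 1: "arr (e' \<odot> x) X Y" "arr (x \<odot> e) X Y" using arr_comp x eA by blast+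
  have "e' \<odot> (e' \<odot> x) = e' \<odot> x" using comp_assoc[OF x eA(3,3)] eA by simp
  hence l: "e' \<odot> (e' \<odot> x - x \<odot> e) = e' \<odot> x - e' \<odot> (x \<odot> e)"
    using comp_diff_right[OF 1 eA(3)] by simp
  have "x \<odot> e \<odot> e = x \<odot> e" using comp_assoc[OF eA(1,1) x] eA by simp
  moreover have ex: "e' \<odot> x \<odot> e = e' \<odot> (x \<odot> e)" using comp_assoc[OF eA(1) x eA(3)] .
  ultimately have r: "(e' \<odot> x - x \<odot> e) \<odot> e = e' \<odot> (x \<odot> e) - x \<odot> e"
    using comp_diff_left[OF eA(1) 1] by simp
  have 2: "arr (e' \<odot> (x \<odot> e)) X Y" using arr_comp 1 eA by blast
  have "e' \<odot> (e' \<odot> (x \<odot> e)) = e' \<odot> (x \<odot> e)" using comp_assoc[OF 1(2) eA(3,3)] eA by simp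
  hence "e' \<odot> (e' \<odot> (x \<odot> e) - x \<odot> e) = 0" using comp_diff_right[OF 2 1(2) eA(3)] by simp
  moreover have "e' \<odot> (e' \<odot> (x \<odot> e) - x \<odot> e) = e' \<odot> x - e' \<odot> (x \<odot> e)"
    using d l r comp_diff_right[OF 1(1) 2 eA(3)] \<open>e' \<odot> (e' \<odot> x) = e' \<odot> x\<close>
      \<open>e' \<odot> (e' \<odot> (x \<odot> e)) = e' \<odot> (x \<odot> e)\<close> by metis
  ultimately have "e' \<odot> x = e' \<odot> (x \<odot> e)" by simp
  thus ?thesis using d l r by simp
qed

text \<open>The commutator kills \<open>a\<close> because of the end \<open>A\<close>, so it factors
  as \<open>w b\<close>. The end \<open>B\<close> makes \<open>w\<close>, and thereby the commutator
  itself, compatible with the idempotents.\<close>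

lemma intertwines_exact_source:
  assumes ex: "exact_at A X B a b"
    and e: "idem X e" "idem Y e'" "arr eA A A" "arr eB B B"
    and comm: "e \<odot> a = a \<odot> eA" "b \<odot> e = eB \<odot> b"
    and int: "intertwines A eA Y e'" "intertwines B eB Y e'"
  shows "intertwines X e Y e'"
  unfolding intertwines_def
proof (intro allI impI)
  fix x assume x: "arr x X Y"
  have a: "arr a A X" "arr b X B" using ex unfolding exact_at_def by auto
  have e0: "arr e X X" "arr e' Y Y" using e unfolding idem_def by auto
  have 1: "arr (e' \<odot> x) X Y" "arr (x \<odot> e) X Y" using arr_comp x e0 by blast+
  let ?d = "e' \<odot> x - x \<odot> e"
  have "e' \<odot> x \<odot> a = e' \<odot> (x \<odot> a)" using comp_assoc[OF a(1) x e0(2)] .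
  also have "\<dots> = x \<odot> a \<odot> eA" using int(1) arr_comp[OF a(1) x] unfolding intertwines_def by blast
  also have "\<dots> = x \<odot> e \<odot> a"
    using comp_assoc[OF e(3) a(1) x] comp_assoc[OF a(1) e0(1) x] comm(1) by simp
  finally have "?d \<odot> a = 0" using comp_diff_left[OF a(1) 1] by simp
  then obtain w where w: "arr w B Y" "?d = w \<odot> b"
    using ex arr_diff[OF 1] unfolding exact_at_def by blast
  have "e' \<odot> (w \<odot> b) = e' \<odot> w \<odot> b" using comp_assoc[OF a(2) w(1) e0(2)] by simp
  also have "\<dots> = w \<odot> eB \<odot> b" using int(2) w(1) unfolding intertwines_def by simp
  also have "\<dots> = w \<odot> b \<odot> e"
    using comp_assoc[OF a(2) e(4) w(1)] comp_assoc[OF e0(1) a(2) w(1)] comm(2) by simp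
  finally have "e' \<odot> ?d = ?d \<odot> e" unfolding w(2) .
  thus "e' \<odot> x = x \<odot> e" using commutator_eq_0[OF e(1,2) x] by blast
qed

lemma intertwines_exact_target:
  assumes ex: "exact_at A X B a b"
    and e: "idem X e" "idem Y e'" "arr eA A A" "arr eB B B"
    and comm: "e \<odot> a = a \<odot> eA" "b \<odot> e = eB \<odot> b"
    and int: "intertwines Y e' A eA" "intertwines Y e' B eB"
  shows "intertwines Y e' X e"
  unfolding intertwines_def
proof (intro allI impI)
  fix y assume y: "arr y Y X"
  have a: "arr a A X" "arr b X B" using ex unfolding exact_at_def by auto
  have e0: "arr e X X" "arr e' Y Y" using e unfolding idem_def by auto
  have 1: "arr (e \<odot> y) Y X" "arr (y \<odot> e') Y X" using arr_comp y e0 by blast+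
  let ?d = "e \<odot> y - y \<odot> e'"
  have "b \<odot> (e \<odot> y) = eB \<odot> (b \<odot> y)"
    using comp_assoc[OF y e0(1) a(2)] comp_assoc[OF y a(2) e(4)] comm(2) by simp
  also have "\<dots> = b \<odot> y \<odot> e'" using int(2) arr_comp[OF y a(2)] unfolding intertwines_def by blast
  also have "\<dots> = b \<odot> (y \<odot> e')" using comp_assoc[OF e0(2) y a(2)] .
  finally have "b \<odot> ?d = 0" using comp_diff_right[OF 1 a(2)] by simp
  then obtain w where w: "arr w Y A" "?d = a \<odot> w"
    using ex arr_diff[OF 1] unfolding exact_at_def by blast
  have "e \<odot> (a \<odot> w) = a \<odot> (eA \<odot> w)"
    using comp_assoc[OF w(1) a(1) e0(1)] comp_assoc[OF w(1) e(3) a(1)] comm(1) by simp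
  also have "\<dots> = a \<odot> (w \<odot> e')" using int(1) w(1) unfolding intertwines_def by simp
  also have "\<dots> = a \<odot> w \<odot> e'" using comp_assoc[OF e0(2) w(1) a(1)] by simp
  finally have "e \<odot> ?d = ?d \<odot> e'" unfolding w(2) .
  thus "e \<odot> y = y \<odot> e'" using commutator_eq_0[OF e(2,1) y] by blast
qed

text \<open>The defect \<open>p = c^2 - c\<close> satisfies \<open>p a = 0\<close> and
  \<open>b p = 0\<close>. Exactness gives \<open>p = v b\<close>, whence
  \<open>p^2 = v b p = 0\<close>. The correction terms \<open>p\<close> and \<open>w = c p\<close>
  vanish against \<open>a\<close> and \<open>b\<close>, so the compatibility with both ends
  survives.\<close>

lemma lift_idempotent:
  assumes ex: "exact_at A X B a b" and c: "arr c X X"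
    and e: "idem A eA" "idem B eB" and comm: "c \<odot> a = a \<odot> eA" "b \<odot> c = eB \<odot> b"
  shows "\<exists>e. idem X e \<and> e \<odot> a = a \<odot> eA \<and> b \<odot> e = eB \<odot> b"
proof -
  have a: "arr a A X" "arr b X B" using ex unfolding exact_at_def by auto
  have eA: "arr eA A A" "eA \<odot> eA = eA" and eB: "arr eB B B" "eB \<odot> eB = eB"
    using e unfolding idem_def by auto
  define p where "p = c \<odot> c - c"
  define w where "w = c \<odot> p"
  have p: "arr p X X" unfolding p_def using arr_diff arr_comp c by blast
  have w: "arr w X X" unfolding w_def using arr_comp c p by blast
  have cc: "arr (c \<odot> c) X X" using arr_comp c by blast
  have cca: "c \<odot> c \<odot> a = c \<odot> a"
  proof -
    have "c \<odot> c \<odot> a = c \<odot> (a \<odot> eA)" using comp_assoc[OF a(1) c c] comm by simp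
    also have "\<dots> = a \<odot> (eA \<odot> eA)"
      using comp_assoc[OF eA(1) a(1) c] comp_assoc[OF eA(1,1) a(1)] comm by simp
    finally show ?thesis using eA comm by simp
  qed
  have bcc: "b \<odot> (c \<odot> c) = b \<odot> c"
  proof -
    have "b \<odot> (c \<odot> c) = eB \<odot> b \<odot> c" using comp_assoc[OF c c a(2)] comm by simp
    also have "\<dots> = eB \<odot> eB \<odot> b"
      using comp_assoc[OF c a(2) eB(1)] comp_assoc[OF a(2) eB(1,1)] comm by simp
    finally show ?thesis using eB comm by simp
  qed
  have pa: "p \<odot> a = 0" unfolding p_def using comp_diff_left[OF a(1) cc c] cca by simp
  have bp: "b \<odot> p = 0" unfolding p_def using comp_diff_right[OF cc c a(2)] bcc by simp
  obtain v where v: "arr v B X" "p = v \<odot> b"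
    using ex p pa unfolding exact_at_def by blast
  have "p \<odot> p = v \<odot> (b \<odot> p)" using v(2) comp_assoc[OF p a(2) v(1)] by simp
  hence pp: "p \<odot> p = 0" using bp comp_zero_right[OF v(1)] by simp
  have wa: "w \<odot> a = 0"
    unfolding w_def using comp_assoc[OF a(1) p c] pa comp_zero_right[OF c] by simp
  have bw: "b \<odot> w = 0"
    unfolding w_def using comp_assoc[OF p c a(2)] comm comp_assoc[OF p a(2) eB(1)] bp
      comp_zero_right[OF eB(1)] by simp
  have pc: "p \<odot> c = w"
    unfolding w_def p_def
    using comp_diff_left[OF c cc c] comp_diff_right[OF cc c c] comp_assoc[OF c c c] by simp
  have ccp: "c \<odot> c = c + p" unfolding p_def by simp
  have cw: "c \<odot> w = w"
  proof -
    have "c \<odot> w = c \<odot> c \<odot> p" unfolding w_def using comp_assoc[OF p c c] by simp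
    also have "\<dots> = c \<odot> p + p \<odot> p" unfolding ccp using comp_add_left[OF p c p] .
    finally show ?thesis using pp by (simp add: w_def)
  qed
  have wp: "w \<odot> p = 0"
    unfolding w_def using comp_assoc[OF p p c] pp comp_zero_right[OF c] by simp
  have pw: "p \<odot> w = 0"
    unfolding w_def using comp_assoc[OF p c p] pc wp by simp
  have wc: "w \<odot> c = w"
    unfolding w_def using comp_assoc[OF c p c] pc cw by (simp add: w_def)
  have ww: "w \<odot> w = 0"
    using comp_assoc[OF w p c] pw comp_zero_right[OF c] by (simp add: w_def)
  \<comment> \<open>\<open>c + p - 2 c p = 3 c\<^sup>2 - 2 c\<^sup>3\<close>, the usual lifting of idempotents modulo square zero\<close>
  let ?e = "c + p - w - w"
  note s1 = arr_add[OF c p]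
  note s2 = arr_diff[OF s1 w]
  note s = s1 s2 arr_diff[OF s2 w]
  have right: "?e \<odot> x = c \<odot> x + p \<odot> x - w \<odot> x - w \<odot> x" if "arr x Z X" for x Z
    using comp_diff_left[OF that s(2) w] comp_diff_left[OF that s(1) w] comp_add_left[OF that c p] by simp
  have left: "x \<odot> ?e = x \<odot> c + x \<odot> p - x \<odot> w - x \<odot> w" if "arr x X Z" for x Z
    using comp_diff_right[OF s(2) w that] comp_diff_right[OF s(1) w that] comp_add_right[OF c p that] by simp
  have 1: "c \<odot> ?e = c + p - w" "p \<odot> ?e = w" "w \<odot> ?e = w"
    unfolding left[OF c] left[OF p] left[OF w] ccp cw pc pp pw wc wp ww w_def[symmetric]
    by simp_all
  have "?e \<odot> ?e = ?e" using right[OF s(3)] by (simp add: 1)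
  moreover have "?e \<odot> a = a \<odot> eA" using right[OF a(1)] comm pa wa by simp
  moreover have "b \<odot> ?e = eB \<odot> b" using left[OF a(2)] comm bp bw by simp
  ultimately show ?thesis using s(3) unfolding idem_def by blast
qed

lemma zero_object_exists: "\<exists>Z. zero_object C Z"
proof -
  obtain Z where Z: "direct_sum C [] Z" using direct_sum_exists[of "[]"] by auto
  hence ZO: "Z \<in> Obj C" and Id: "Id C Z = 0" unfolding direct_sum_def by auto
  have "Hom C X Z = {0} \<and> Hom C Z X = {0}" if X: "X \<in> Obj C" for X
  proof -
    have "f = 0" if "arr f X Z" for f
      using comp_Id_left[OF that] comp_zero_left[OF that] Id by simp
    moreover have "f = 0" if "arr f Z X" for f
      using comp_Id_right[OF that] comp_zero_right[OF that] Id by simp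
    ultimately show ?thesis
      using arr_zero[OF X ZO] arr_zero[OF ZO X] X ZO unfolding arr_def by blast
  qed
  thus ?thesis unfolding zero_object_def using ZO by blast
qed

lemma intertwines_zero:
  assumes "\<And>x. arr x X Y \<Longrightarrow> x = 0" "arr e X X" "arr e' Y Y"
  shows "intertwines X e Y e'"
  using assms(1) comp_zero_left[OF assms(2)] comp_zero_right[OF assms(3)]
  unfolding intertwines_def by metis

lemma arr_zero_object: "\<lbrakk>zero_object C Z; arr f X Z\<rbrakk> \<Longrightarrow> f = 0" "\<lbrakk>zero_object C Z; arr f Z X\<rbrakk> \<Longrightarrow> f = 0"
  unfolding zero_object_def arr_def by auto

end

section \<open>Shift and exactness of triangles\<close>

context triangulated_category
begin

lemma arr_Sh: "arr f X Y \<Longrightarrow> arr (ShM C f) (Sh C X) (Sh C Y)"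
  unfolding arr_def using ShM_bij Sh_in by (meson bij_betwE)

lemma ShM_surj:
  assumes "X \<in> Obj C" "Y \<in> Obj C" "arr g (Sh C X) (Sh C Y)"
  shows "\<exists>f. arr f X Y \<and> g = ShM C f"
  using ShM_bij[OF assms(1,2)] assms unfolding arr_def bij_betw_def by blast

lemma ShM_inj: "\<lbrakk>arr f X Y; arr g X Y; ShM C f = ShM C g\<rbrakk> \<Longrightarrow> f = g"
  using ShM_bij unfolding arr_def bij_betw_def by (meson inj_onD)

lemma ShM_comp: "\<lbrakk>arr f X Y; arr g Y Z\<rbrakk> \<Longrightarrow> ShM C (g \<odot> f) = ShM C g \<odot> ShM C f"
  unfolding arr_def using ShM_Comp by blast

lemma ShM_zero: "\<lbrakk>X \<in> Obj C; Y \<in> Obj C\<rbrakk> \<Longrightarrow> ShM C 0 = 0"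
  using ShM_add[of X Y 0 0] arr_zero[of X Y] unfolding arr_def by simp

lemma idem_Sh: "idem X e \<Longrightarrow> idem (Sh C X) (ShM C e)"
  unfolding idem_def using arr_Sh ShM_comp by metis

lemma zero_Sh:
  assumes "X \<in> Obj C" "Y \<in> Obj C" "\<And>x. arr x X Y \<Longrightarrow> x = 0" "arr x (Sh C X) (Sh C Y)"
  shows "x = 0"
  using ShM_surj[OF assms(1,2,4)] assms(3) ShM_zero[OF assms(1,2)] by blast

lemma intertwines_Sh:
  assumes "arr e X X" "arr e' Y Y" "intertwines X e Y e'"
  shows "intertwines (Sh C X) (ShM C e) (Sh C Y) (ShM C e')"
  unfolding intertwines_def
proof (intro allI impI)
  fix x assume "arr x (Sh C X) (Sh C Y)"
  then obtain y where y: "arr y X Y" "x = ShM C y"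
    using ShM_surj arrD(1)[OF assms(1)] arrD(1)[OF assms(2)] by blast
  have "ShM C e' \<odot> x = ShM C (e' \<odot> y)" using ShM_comp[OF y(1) assms(2)] y(2) by simp
  also have "\<dots> = ShM C (y \<odot> e)" using assms(3) y(1) unfolding intertwines_def by simp
  also have "\<dots> = x \<odot> ShM C e" using ShM_comp[OF assms(1) y(1)] y(2) by simp
  finally show "ShM C e' \<odot> x = x \<odot> ShM C e" .
qed

lemma Tri_arr:
  assumes "Tri C X Y Z f g h"
  shows "arr f X Y" "arr g Y Z" "arr h Z (Sh C X)"
  using Tri_in[OF assms] Sh_in unfolding arr_def by auto

lemma Tri_rotate: "Tri C X Y Z f g h \<Longrightarrow> Tri C Y Z (Sh C X) g h (- ShM C f)"
  using TR2 Tri_in by blast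

text \<open>A vanishing composite is a commuting square into
  \<open>0 \<rightarrow> W \<rightarrow> W\<close> or out of
  \<open>W \<rightarrow> 0 \<rightarrow> W[1]\<close>; the third map supplied by TR3 is the
  factorisation, in the second case after undoing the shift.\<close>

lemma Tri_exact:
  assumes T: "Tri C X Y Z f g h"
  shows "exact_at X Y Z f g"
  unfolding exact_at_def
proof (intro conjI allI impI)
  note arr = Tri_arr[OF T]
  show "arr f X Y" "arr g Y Z" using arr by blast+
  have XO: "X \<in> Obj C" and ZO: "Z \<in> Obj C" using arr arrD by blast+
  obtain N where N: "zero_object C N" using zero_object_exists by blast
  hence OO: "N \<in> Obj C" unfolding zero_object_def by blast
  show "\<exists>w. arr w Z W \<and> y = w \<odot> g" if y: "arr y Y W" and yf: "y \<odot> f = 0" for W y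
  proof -
    have W: "W \<in> Obj C" using y arrD by blast
    \<comment> \<open>TR2 rotates backwards only from a triangle whose third object is literally a
      shift, so \<open>Sh C N\<close> has to serve as the zero object.\<close>
    have SO: "zero_object C (Sh C N)"
      unfolding zero_object_def
    proof (intro conjI ballI)
      show SO: "Sh C N \<in> Obj C" using Sh_in OO .
      have "ShM C (Id C N) = ShM C 0"
        using arr_zero_object(1)[OF N arr_Id[OF OO]] by simp
      hence Id0: "Id C (Sh C N) = 0" using ShM_Id[OF OO] ShM_zero[OF OO OO] by simp
      fix V assume V: "V \<in> Obj C"
      have "x = 0" if "arr x V (Sh C N)" for x
        using comp_Id_left[OF that] comp_zero_left[OF that] Id0 by simp
      thus "Hom C V (Sh C N) = {0}" using arr_zero[OF V SO] V SO unfolding arr_def by blast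
      have "x = 0" if "arr x (Sh C N) V" for x
        using comp_Id_right[OF that] comp_zero_right[OF that] Id0 by simp
      thus "Hom C (Sh C N) V = {0}" using arr_zero[OF SO V] V SO unfolding arr_def by blast
    qed
    have "Tri C W W (Sh C N) (Id C W) 0 (- ShM C 0)"
      using TR1_Id[OF W SO] ShM_zero[OF OO W] by simp
    hence t: "Tri C N W W 0 (Id C W) 0"
      using TR2[of N W W 0 "Id C W" 0] arr_zero[OF OO W] arr_zero[OF W Sh_in[OF OO]] arr_Id[OF W]
      unfolding arr_def by blast
    have "y \<odot> f = 0 \<odot> 0"
      using yf comp_zero_left[OF arr_zero[OF XO OO]] by simp
    then obtain c where c: "c \<in> Hom C Z W" "c \<odot> g = Id C W \<odot> y"
      using TR3[OF T t arrD(3)[OF arr_zero[OF XO OO]] arrD(3)[OF y]] by blast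
    thus ?thesis using comp_Id_left[OF y] W ZO unfolding arr_def by metis
  qed
  show "\<exists>w. arr w W X \<and> y = f \<odot> w" if y: "arr y W Y" and gy: "g \<odot> y = 0" for W y
  proof -
    have W: "W \<in> Obj C" using y arrD by blast
    \<comment> \<open>After forward rotation TR3 yields a map
      \<open>W[1] \<rightarrow> X[1]\<close>, which fullness of the shift brings back to
      \<open>W \<rightarrow> X\<close>. The two signs cancel.\<close>
    have t: "Tri C W N (Sh C W) 0 0 (- ShM C (Id C W))"
      using Tri_rotate[OF TR1_Id[OF W N]] .
    have "0 \<odot> 0 = g \<odot> y"
      using gy comp_zero_left[OF arr_zero[OF W OO]] by simp
    then obtain c where c: "c \<in> Hom C (Sh C W) (Sh C X)"
        "ShM C y \<odot> (- ShM C (Id C W)) = (- ShM C f) \<odot> c"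
      using TR3[OF t Tri_rotate[OF T] arrD(3)[OF y] arrD(3)[OF arr_zero[OF OO ZO]]] by blast
    have "arr c (Sh C W) (Sh C X)" using c(1) Sh_in W XO unfolding arr_def by blast
    then obtain x where x: "arr x W X" "c = ShM C x" using ShM_surj[OF W XO] by blast
    note Sy = arr_Sh[OF y] and Sf = arr_Sh[OF arr(1)] and Sx = arr_Sh[OF x(1)]
    have "ShM C y \<odot> (0 - Id C (Sh C W)) = (0 - ShM C f) \<odot> ShM C x"
      using c(2) x(2) ShM_Id[OF W] by simp
    hence "ShM C y = ShM C f \<odot> ShM C x"
      using comp_diff_right[OF arr_zero[OF Sh_in[OF W] Sh_in[OF W]] arr_Id[OF Sh_in[OF W]] Sy]
        comp_diff_left[OF Sx arr_zero[OF arrD(1,2)[OF Sf]] Sf]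
        comp_zero_left[OF Sx] comp_zero_right[OF Sy] comp_Id_right[OF Sy] by simp
    hence "ShM C y = ShM C (f \<odot> x)" using ShM_comp[OF x(1) arr(1)] by simp
    hence "y = f \<odot> x" using ShM_inj[OF y arr_comp[OF x(1) arr(1)]] by blast
    thus ?thesis using x(1) by blast
  qed
qed

text \<open>Signs are absorbed by the factoring map \<open>w\<close>. This clears the signs that
  three rotations put on a shifted triangle.\<close>

lemma exact_at_uminus:
  assumes "exact_at X Y Z (- f) (- g)"
  shows "exact_at X Y Z f g"
proof -
  have arr: "arr f X Y" "arr g Y Z"
    using assms arr_uminus[of "- f"] arr_uminus[of "- g"] unfolding exact_at_def by auto
  have neg_left: "(- v) \<odot> u = - (v \<odot> u)" if "arr u P Q" "arr v Q R" for u v P Q R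
    using comp_diff_left[OF that(1) arr_zero[OF arrD(1,2)[OF that(2)]] that(2)] comp_zero_left[OF that(1)] by simp
  have neg_right: "v \<odot> (- u) = - (v \<odot> u)" if "arr u P Q" "arr v Q R" for u v P Q R
    using comp_diff_right[OF arr_zero[OF arrD(1,2)[OF that(1)]] that] comp_zero_right[OF that(2)] by simp
  show ?thesis
    unfolding exact_at_def
  proof (intro conjI allI impI arr)
    fix W y assume y: "arr y Y W" "y \<odot> f = 0"
    hence "y \<odot> (- f) = 0" using neg_right[OF arr(1) y(1)] by simp
    then obtain w where w: "arr w Z W" "y = w \<odot> (- g)" using assms y unfolding exact_at_def by blast
    hence "arr (- w) Z W \<and> y = (- w) \<odot> g"
      using arr_uminus neg_left[OF arr(2) w(1)] neg_right[OF arr(2) w(1)] by simp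
    thus "\<exists>w. arr w Z W \<and> y = w \<odot> g" by blast
  next
    fix W y assume y: "arr y W Y" "g \<odot> y = 0"
    hence "(- g) \<odot> y = 0" using neg_left[OF y(1) arr(2)] by simp
    then obtain w where w: "arr w W X" "y = (- f) \<odot> w" using assms y unfolding exact_at_def by blast
    hence "arr (- w) W X \<and> y = f \<odot> (- w)"
      using arr_uminus neg_left[OF w(1) arr(1)] neg_right[OF w(1) arr(1)] by simp
    thus "\<exists>w. arr w W X \<and> y = f \<odot> w" by blast
  qed
qed

lemma Tri_exact_Sh:
  assumes T: "Tri C X Y Z f g h"
  shows "exact_at (Sh C X) (Sh C Y) (Sh C Z) (ShM C f) (ShM C g)"
  using Tri_exact[OF Tri_rotate[OF Tri_rotate[OF Tri_rotate[OF T]]]]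
  by (rule exact_at_uminus)

text \<open>With this, maps into \<open>Y[1]\<close> can be tested on \<open>T[1]\<close>, as the
  rigidity of all of \<open>add T\<close> requires.\<close>

lemma Id_thru_Sh:
  assumes Y: "T \<in> Obj C" "Y \<in> Obj C" and Id: "Id C Y \<in> thru T Y Y"
  shows "Id C (Sh C Y) \<in> thru (Sh C T) (Sh C Y) (Sh C Y)"
proof -
  let ?S = "thru (Sh C T) (Sh C Y) (Sh C Y)"
  have S: "subspace ?S" unfolding thru_def by (rule subspace_span)
  have H: "subspace (Hom C Y Y)" using Hom_subspace Y by blast
  have "thru T Y Y \<subseteq> {m \<in> Hom C Y Y. ShM C m \<in> ?S}"
  proof (rule thru_subset[OF Y(2,2)])
    show "subspace {m \<in> Hom C Y Y. ShM C m \<in> ?S}"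
      using subspace_0[OF H] subspace_0[OF S] ShM_zero[OF Y(2,2)] subspace_add[OF H] subspace_add[OF S]
        subspace_scale[OF H] subspace_scale[OF S] ShM_add[OF Y(2,2)] ShM_scal[OF Y(2,2)]
      by (intro subspaceI) auto
    fix a b assume ab: "arr b Y T" "arr a T Y"
    have "ShM C (a \<odot> b) = ShM C a \<odot> ShM C b" using ShM_comp[OF ab] .
    moreover have "ShM C a \<odot> ShM C b \<in> ?S"
      unfolding thru_def using arr_Sh[OF ab(1)] arr_Sh[OF ab(2)] by (intro span_base) blast
    ultimately show "a \<odot> b \<in> {m \<in> Hom C Y Y. ShM C m \<in> ?S}"
      using arrD(3)[OF arr_comp[OF ab]] by simp
  qed
  hence "ShM C (Id C Y) \<in> ?S" using Id by blast
  thus ?thesis using ShM_Id[OF Y(2)] by simp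
qed

end

section \<open>Calabi-Yau duality for intertwining idempotents\<close>

context two_calabi_yau_category
begin

text \<open>Under the pairing, \<open>x \<mapsto> e' x - x e\<close> is adjoint to
  \<open>h \<mapsto> h e' - e[2] h\<close>, so one vanishes identically iff the other does. One
  direction needs a functional that detects a nonzero commutator and comes from some morphism by
  surjectivity of \<open>\<phi> X Y\<close>; the other uses its injectivity.\<close>

lemma calabi_yau_intertwines:
  assumes e: "arr e X X" and e': "arr e' Y Y"
  shows "intertwines X e Y e' \<longleftrightarrow> intertwines Y e' (Sh C (Sh C X)) (ShM C (ShM C e))"
proof -
  obtain \<phi> where \<phi>: "serre_duality_2 C \<phi>" using two_calabi_yau by blast
  have XO: "X \<in> Obj C" and YO: "Y \<in> Obj C" using e e' arrD by blast+
  let ?S = "Sh C (Sh C X)"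
  let ?e = "ShM C (ShM C e)"
  have SO: "?S \<in> Obj C" using Sh_in XO by blast
  have SId: "ShM C (ShM C (Id C X)) = Id C ?S" using ShM_Id XO Sh_in by simp
  have Se: "arr ?e ?S ?S" using arr_Sh e by blast
  have bij: "bij_betw (\<phi> X Y) (Hom C X Y) (dual_Hom C Y ?S)"
    using \<phi> XO YO unfolding serre_duality_2_def by blast
  have nat: "\<phi> X Y (b \<odot> f \<odot> a) h = \<phi> X Y f (ShM C (ShM C a) \<odot> h \<odot> b)"
    if "arr a X X" "arr f X Y" "arr b Y Y" "arr h Y ?S" for a f b h
    using \<phi> XO YO arrD(3)[OF that(1)] arrD(3)[OF that(2)] arrD(3)[OF that(3)] arrD(3)[OF that(4)]
    unfolding serre_duality_2_def by blast
  have left: "\<phi> X Y (e' \<odot> f) h = \<phi> X Y f (h \<odot> e')" if f: "arr f X Y" and h: "arr h Y ?S" for f h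
    using nat[OF arr_Id[OF XO] f e' h] comp_Id_right[OF arr_comp[OF f e']] SId
      comp_Id_left[OF h] by simp
  have right: "\<phi> X Y (f \<odot> e) h = \<phi> X Y f (?e \<odot> h)" if f: "arr f X Y" and h: "arr h Y ?S" for f h
    using nat[OF e f arr_Id[OF YO] h] comp_Id_left[OF f]
      comp_Id_right[OF arr_comp[OF h Se]] by simp
  show ?thesis
  proof
    assume int: "intertwines X e Y e'"
    show "intertwines Y e' ?S ?e"
      unfolding intertwines_def
    proof (intro allI impI)
      fix h assume h: "arr h Y ?S"
      note ar = arr_comp[OF h Se] arr_comp[OF e' h]
      show "?e \<odot> h = h \<odot> e'"
      proof (rule ccontr)
        assume "?e \<odot> h \<noteq> h \<odot> e'"
        hence "?e \<odot> h - h \<odot> e' \<noteq> 0" by simp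
        then obtain l where l: "\<forall>x y. l (x + y) = l x + l y" "\<forall>\<mu> x. l (Scal C \<mu> x) = \<mu> * l x"
            "l (?e \<odot> h - h \<odot> e') \<noteq> 0" using separating_functional by blast
        have H: "subspace (Hom C Y ?S)" using Hom_subspace YO SO by blast
        have "restrict l (Hom C Y ?S) \<in> dual_Hom C Y ?S"
          unfolding dual_Hom_def using l(1,2) subspace_add[OF H] subspace_scale[OF H] by simp
        then obtain f where f: "f \<in> Hom C X Y" "\<phi> X Y f = restrict l (Hom C Y ?S)"
          using bij unfolding bij_betw_def by (metis imageE)
        have fa: "arr f X Y" using f(1) XO YO unfolding arr_def by blast
        have "\<phi> X Y f (?e \<odot> h) = \<phi> X Y f (h \<odot> e')"
          using left[OF fa h] right[OF fa h] int fa unfolding intertwines_def by simp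
        hence eq: "l (?e \<odot> h) = l (h \<odot> e')" using f(2) arrD(3)[OF ar(1)] arrD(3)[OF ar(2)] by simp
        have "l (?e \<odot> h) = l ((?e \<odot> h - h \<odot> e') + h \<odot> e')" by simp
        also have "\<dots> = l (?e \<odot> h - h \<odot> e') + l (h \<odot> e')" using l(1) by blast
        finally show False using eq l(3) by simp
      qed
    qed
  next
    assume int: "intertwines Y e' ?S ?e"
    show "intertwines X e Y e'"
      unfolding intertwines_def
    proof (intro allI impI)
      fix f assume f: "arr f X Y"
      note ar = arr_comp[OF f e'] arr_comp[OF e f]
      have ext: "\<phi> X Y g \<in> extensional (Hom C Y ?S)" if "arr g X Y" for g
        using bij_betwE[OF bij] arrD(3)[OF that] unfolding dual_Hom_def by blast
      have "\<phi> X Y (e' \<odot> f) = \<phi> X Y (f \<odot> e)"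
      proof (rule extensionalityI[OF ext[OF ar(1)] ext[OF ar(2)]])
        fix h assume "h \<in> Hom C Y ?S"
        hence h: "arr h Y ?S" using YO SO unfolding arr_def by blast
        show "\<phi> X Y (e' \<odot> f) h = \<phi> X Y (f \<odot> e) h"
          using left[OF f h] right[OF f h] int h unfolding intertwines_def by simp
      qed
      thus "e' \<odot> f = f \<odot> e"
        using bij arrD(3)[OF ar(1)] arrD(3)[OF ar(2)] unfolding bij_betw_def by (meson inj_onD)
    qed
  qed
qed

end

section \<open>Extension of a central idempotent from a cluster tilting object\<close>

locale cluster_tilting_idempotent = two_calabi_yau_category C
  for C :: "('o, 'm::ab_group_add, 'k::field, 'z) tri_cat_scheme" (structure) +
  fixes T :: 'o and f :: 'm
  assumes ct: "cluster_tilting C T"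
    and f_idem: "idem T f"
    and f_central: "intertwines T f T f"
begin

lemma T_in: "T \<in> Obj C"
  using ct unfolding cluster_tilting_def by blast

lemma f_arr: "arr f T T"
  using f_idem unfolding idem_def by blast

abbreviation addT :: "'o set" where
  "addT \<equiv> add_closure C T"

lemma addT_in: "Y \<in> addT \<Longrightarrow> Y \<in> Obj C"
  and addT_Id: "Y \<in> addT \<Longrightarrow> Id C Y \<in> thru T Y Y"
  using add_closure_thru[OF T_in] by blast+

text \<open>If the identity of \<open>Y\<close> is a sum of composites \<open>a b\<close> through
  \<open>T\<close>, then \<open>u\<close> is the sum of the \<open>a f b\<close>, since centrality
  of \<open>f\<close> gives \<open>a f b y = a b y f\<close>. To argue on a span, the claim is made
  for every \<open>m\<close> through \<open>T\<close>, not only for the identity.\<close>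

lemma extension_exists:
  assumes Y: "Y \<in> addT"
  shows "\<exists>u. arr u Y Y \<and> (\<forall>y. arr y T Y \<longrightarrow> u \<odot> y = y \<odot> f)"
proof -
  note YO = addT_in[OF Y]
  let ?P = "\<lambda>m u. arr u Y Y \<and> (\<forall>y. arr y T Y \<longrightarrow> u \<odot> y = m \<odot> (y \<odot> f))"
  have H: "subspace (Hom C Y Y)" using Hom_subspace YO by blast
  have yf: "arr (y \<odot> f) T Y" if "arr y T Y" for y using arr_comp[OF f_arr that] .
  have "thru T Y Y \<subseteq> {m \<in> Hom C Y Y. \<exists>u. ?P m u}"
  proof (rule thru_subset[OF YO YO])
    show "subspace {m \<in> Hom C Y Y. \<exists>u. ?P m u}"
    proof (rule subspaceI)
      have "?P 0 0" using arr_zero[OF YO YO] by (simp add: comp_zero_left yf comp_zero_left[OF yf])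
      thus "0 \<in> {m \<in> Hom C Y Y. \<exists>u. ?P m u}" using subspace_0[OF H] by blast
    next
      fix m m' assume "m \<in> {m \<in> Hom C Y Y. \<exists>u. ?P m u}" "m' \<in> {m \<in> Hom C Y Y. \<exists>u. ?P m u}"
      then obtain u u' where u: "m \<in> Hom C Y Y" "?P m u" "m' \<in> Hom C Y Y" "?P m' u'" by blast
      hence ma: "arr m Y Y" "arr m' Y Y" using YO unfolding arr_def by auto
      have "?P (m + m') (u + u')"
      proof (intro conjI allI impI)
        show "arr (u + u') Y Y" using arr_add u by blast
        fix y assume y: "arr y T Y"
        have "(u + u') \<odot> y = u \<odot> y + u' \<odot> y" using comp_add_left[OF y] u by blast
        also have "\<dots> = (m + m') \<odot> (y \<odot> f)" using u y comp_add_left[OF yf[OF y] ma] by simp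
        finally show "(u + u') \<odot> y = (m + m') \<odot> (y \<odot> f)" .
      qed
      thus "m + m' \<in> {m \<in> Hom C Y Y. \<exists>u. ?P m u}" using subspace_add[OF H u(1,3)] by blast
    next
      fix k m assume "m \<in> {m \<in> Hom C Y Y. \<exists>u. ?P m u}"
      then obtain u where u: "m \<in> Hom C Y Y" "?P m u" by blast
      have uH: "u \<in> Hom C Y Y" using u(2) arrD by blast
      have "?P (Scal C k m) (Scal C k u)"
      proof (intro conjI allI impI)
        show "arr (Scal C k u) Y Y" using subspace_scale[OF H uH] YO unfolding arr_def by blast
        fix y assume y: "arr y T Y"
        show "Scal C k u \<odot> y = Scal C k m \<odot> (y \<odot> f)"
          using Comp_scal_left[OF T_in YO YO arrD(3)[OF y] uH]
            Comp_scal_left[OF T_in YO YO arrD(3)[OF yf[OF y]] u(1)] u(2) y by simp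
      qed
      thus "Scal C k m \<in> {m \<in> Hom C Y Y. \<exists>u. ?P m u}" using subspace_scale[OF H u(1)] by blast
    qed
    fix a b assume ab: "arr b Y T" "arr a T Y"
    have "a \<odot> f \<odot> b \<odot> y = a \<odot> b \<odot> (y \<odot> f)" if y: "arr y T Y" for y
    proof -
      have bya: "arr (b \<odot> y) T T" using arr_comp[OF y ab(1)] .
      have "a \<odot> f \<odot> b \<odot> y = a \<odot> (f \<odot> (b \<odot> y))"
        using comp_assoc[OF y ab(1) arr_comp[OF f_arr ab(2)]] comp_assoc[OF bya f_arr ab(2)] by simp
      also have "f \<odot> (b \<odot> y) = b \<odot> y \<odot> f" using f_central bya unfolding intertwines_def by simp
      also have "a \<odot> (b \<odot> y \<odot> f) = a \<odot> b \<odot> (y \<odot> f)"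
        using comp_assoc[OF f_arr y ab(1)] comp_assoc[OF yf[OF y] ab] by simp
      finally show ?thesis .
    qed
    hence "?P (a \<odot> b) (a \<odot> f \<odot> b)"
      using arr_comp[OF ab(1) arr_comp[OF f_arr ab(2)]] by blast
    thus "a \<odot> b \<in> {m \<in> Hom C Y Y. \<exists>u. ?P m u}" using arrD(3)[OF arr_comp[OF ab]] by blast
  qed
  then obtain u where u: "?P (Id C Y) u" using addT_Id[OF Y] by blast
  hence "u \<odot> y = y \<odot> f" if "arr y T Y" for y using that comp_Id_left[OF yf[OF that]] by simp
  thus ?thesis using u by blast
qed

definition ext :: "'o \<Rightarrow> 'm" where
  "ext Y = (SOME u. arr u Y Y \<and> (\<forall>y. arr y T Y \<longrightarrow> u \<odot> y = y \<odot> f))"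

lemma ext_arr: "Y \<in> addT \<Longrightarrow> arr (ext Y) Y Y"
  and ext_comp: "\<lbrakk>Y \<in> addT; arr y T Y\<rbrakk> \<Longrightarrow> ext Y \<odot> y = y \<odot> f"
  using someI_ex[OF extension_exists[of Y]] unfolding ext_def by blast+

lemma ext_unique:
  assumes Y: "Y \<in> addT" and u: "arr u Y Y" "\<And>y. arr y T Y \<Longrightarrow> u \<odot> y = y \<odot> f"
  shows "u = ext Y"
proof -
  have "(u - ext Y) \<odot> y = 0" if y: "arr y T Y" for y
    using comp_diff_left[OF y u(1) ext_arr[OF Y]] u(2)[OF y] ext_comp[OF Y y] by simp
  hence "u - ext Y = 0"
    by (rule eq_0_if_thru_right[OF addT_Id[OF Y] arr_diff[OF u(1) ext_arr[OF Y]]])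
  thus ?thesis by simp
qed

lemma ext_idem:
  assumes Y: "Y \<in> addT"
  shows "idem Y (ext Y)"
proof -
  note a = ext_arr[OF Y]
  have "ext Y \<odot> ext Y \<odot> y = y \<odot> f" if y: "arr y T Y" for y
  proof -
    have "ext Y \<odot> ext Y \<odot> y = ext Y \<odot> (y \<odot> f)"
      using comp_assoc[OF y a a] ext_comp[OF Y y] by simp
    also have "\<dots> = y \<odot> (f \<odot> f)"
      using ext_comp[OF Y arr_comp[OF f_arr y]] comp_assoc[OF f_arr f_arr y] by simp
    finally show ?thesis using f_idem unfolding idem_def by simp
  qed
  hence "ext Y \<odot> ext Y = ext Y" using ext_unique[OF Y arr_comp[OF a a]] by blast
  thus ?thesis using a unfolding idem_def by blast
qed

lemma ext_T: "ext T = f"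
  using ext_unique[OF add_closure.base f_arr] f_central unfolding intertwines_def by simp

lemma ext_intertwines:
  assumes Y: "Y \<in> addT" and Z: "Z \<in> addT"
  shows "intertwines Y (ext Y) Z (ext Z)"
  unfolding intertwines_def
proof (intro allI impI)
  fix x assume x: "arr x Y Z"
  note a = ext_arr[OF Y] ext_arr[OF Z]
  note ar = arr_comp[OF x a(2)] arr_comp[OF a(1) x]
  have "(ext Z \<odot> x - x \<odot> ext Y) \<odot> y = 0" if y: "arr y T Y" for y
  proof -
    have "ext Z \<odot> x \<odot> y = x \<odot> y \<odot> f"
      using comp_assoc[OF y x a(2)] ext_comp[OF Z arr_comp[OF y x]] by simp
    moreover have "x \<odot> ext Y \<odot> y = x \<odot> y \<odot> f"
      using comp_assoc[OF y a(1) x] ext_comp[OF Y y] comp_assoc[OF f_arr y x] by simp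
    ultimately show ?thesis using comp_diff_left[OF y ar] by simp
  qed
  hence "ext Z \<odot> x - x \<odot> ext Y = 0"
    by (rule eq_0_if_thru_right[OF addT_Id[OF Y] arr_diff[OF ar]])
  thus "ext Z \<odot> x = x \<odot> ext Y" by simp
qed

text \<open>Testing the source on \<open>T\<close> and the target on \<open>T[1]\<close> reduces the
  claim to \<open>Hom(T, T[1]) = 0\<close>.\<close>

lemma rigid:
  assumes Y: "Y \<in> addT" and Z: "Z \<in> addT" and x: "arr x Y (Sh C Z)"
  shows "x = 0"
proof (rule eq_0_if_thru_right[OF addT_Id[OF Y] x])
  fix y assume y: "arr y T Y"
  have xy: "arr (x \<odot> y) T (Sh C Z)" using arr_comp[OF y x] .
  show "x \<odot> y = 0"
  proof (rule eq_0_if_thru_left[OF Id_thru_Sh[OF T_in addT_in[OF Z] addT_Id[OF Z]] xy])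
    fix z assume "arr z (Sh C Z) (Sh C T)"
    from arrD(3)[OF arr_comp[OF xy this]] ct show "z \<odot> (x \<odot> y) = 0"
      unfolding cluster_tilting_def by simp
  qed
qed

text \<open>The triangle is left open. That \<open>e\<close> depends on \<open>X\<close> alone comes
  out of naturality, applied to the identity of \<open>X\<close>.\<close>

definition extends :: "'o \<Rightarrow> 'm \<Rightarrow> bool" where
  "extends X e \<longleftrightarrow> idem X e \<and> (\<exists>P \<in> addT. \<exists>Q \<in> addT. \<exists>a b t. Tri C P X (Sh C Q) a b t \<and>
     e \<odot> a = a \<odot> ext P \<and> b \<odot> e = ShM C (ext Q) \<odot> b)"

lemma extendsE:
  assumes "extends X e"
  obtains P Q a b t where "idem X e" "P \<in> addT" "Q \<in> addT" "Tri C P X (Sh C Q) a b t"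
    "e \<odot> a = a \<odot> ext P" "b \<odot> e = ShM C (ext Q) \<odot> b"
  using assms unfolding extends_def by blast

text \<open>By fullness of the shift the connecting map is \<open>- d[1]\<close> for a map
  \<open>d\<close> from \<open>Q\<close> to \<open>P\<close>. So \<open>X\<close> is a cone of a map
  in \<open>add T\<close>, on which \<open>ext\<close> is natural, and TR3 applies.\<close>

lemma triangle_endomorphism:
  assumes P: "P \<in> addT" and Q: "Q \<in> addT" and tri: "Tri C P X (Sh C Q) a b t"
  shows "\<exists>c. arr c X X \<and> c \<odot> a = a \<odot> ext P \<and> b \<odot> c = ShM C (ext Q) \<odot> b"
proof -
  note arr = Tri_arr[OF tri]
  note PO = addT_in[OF P] and QO = addT_in[OF Q]
  have X: "X \<in> Obj C" using arr arrD by blast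
  obtain d where d: "arr d Q P" "- t = ShM C d"
    using ShM_surj[OF QO PO arr_uminus[OF arr(3)]] by blast
  hence "Tri C P X (Sh C Q) a b (- ShM C d)" using tri by (metis minus_minus)
  hence tri': "Tri C Q P X d a b"
    using TR2[OF QO PO X arrD(3)[OF d(1)] arrD(3)[OF arr(1)] arrD(3)[OF arr(2)]] by blast
  have "ext P \<odot> d = d \<odot> ext Q" using ext_intertwines[OF Q P] d unfolding intertwines_def by blast
  then obtain c where "c \<in> Hom C X X" "c \<odot> a = a \<odot> ext P" "ShM C (ext Q) \<odot> b = b \<odot> c"
    using TR3[OF tri' tri' arrD(3)[OF ext_arr[OF Q]] arrD(3)[OF ext_arr[OF P]]] by blast
  thus ?thesis using X unfolding arr_def by metis
qed

lemma tilting_triangle: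
  assumes "X \<in> Obj C"
  obtains P Q a b t where "P \<in> addT" "Q \<in> addT" "Tri C P X (Sh C Q) a b t"
  using ct assms unfolding cluster_tilting_def by blast

lemma extends_exists:
  assumes X: "X \<in> Obj C"
  shows "\<exists>e. extends X e"
proof -
  obtain P Q a b t where t: "P \<in> addT" "Q \<in> addT" "Tri C P X (Sh C Q) a b t"
    using tilting_triangle[OF X] .
  obtain c where "arr c X X" "c \<odot> a = a \<odot> ext P" "b \<odot> c = ShM C (ext Q) \<odot> b"
    using triangle_endomorphism[OF t] by blast
  then obtain e where "idem X e" "e \<odot> a = a \<odot> ext P" "b \<odot> e = ShM C (ext Q) \<odot> b"
    using lift_idempotent[OF Tri_exact[OF t(3)] _ ext_idem[OF t(1)] idem_Sh[OF ext_idem[OF t(2)]]]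
    by blast
  thus ?thesis unfolding extends_def using t by blast
qed

lemma ext_intertwines_Sh2:
  assumes Y: "Y \<in> addT" and Z: "Z \<in> addT"
  shows "intertwines Y (ext Y) (Sh C (Sh C Z)) (ShM C (ShM C (ext Z)))"
  using calabi_yau_intertwines[OF ext_arr[OF Z] ext_arr[OF Y]] ext_intertwines[OF Z Y] by blast

text \<open>By duality \<open>?e\<close> agrees with the completion \<open>c\<close> on maps from
  \<open>P\<close>. Their difference therefore factors through a map
  \<open>Q[1] \<rightarrow> Z[2]\<close>, which is zero because it is the shift of a map
  \<open>Q \<rightarrow> Z[1]\<close>.\<close>

lemma extends_Sh2:
  assumes Z: "Z \<in> addT"
  shows "extends (Sh C (Sh C Z)) (ShM C (ShM C (ext Z)))" (is "extends ?X ?e")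
proof -
  have ZO: "Z \<in> Obj C" "Sh C Z \<in> Obj C" "?X \<in> Obj C" using addT_in[OF Z] Sh_in by blast+
  have e: "idem ?X ?e" using idem_Sh ext_idem[OF Z] by blast
  hence ea: "arr ?e ?X ?X" unfolding idem_def by blast
  obtain P Q a b t where t: "P \<in> addT" "Q \<in> addT" "Tri C P ?X (Sh C Q) a b t"
    using tilting_triangle[OF ZO(3)] .
  note arr = Tri_arr[OF t(3)]
  obtain c where c: "arr c ?X ?X" "c \<odot> a = a \<odot> ext P" "b \<odot> c = ShM C (ext Q) \<odot> b"
    using triangle_endomorphism[OF t] by blast
  have ea': "?e \<odot> a = a \<odot> ext P"
    using ext_intertwines_Sh2[OF t(1) Z] arr(1) unfolding intertwines_def by blast
  have "(c - ?e) \<odot> a = 0" using comp_diff_left[OF arr(1) c(1) ea] ea' c(2) by simp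
  then obtain w where w: "arr w (Sh C Q) ?X" "c - ?e = w \<odot> b"
    using Tri_exact[OF t(3)] arr_diff[OF c(1) ea] unfolding exact_at_def by blast
  have "w = 0" using zero_Sh[OF addT_in[OF t(2)] ZO(2) _ w(1)] rigid[OF t(2) Z] by blast
  hence "c = ?e" using w(2) comp_zero_left[OF arr(2)] by simp
  thus ?thesis unfolding extends_def using e t c by blast
qed

text \<open>Of the two ends of the triangle of \<open>X\<close>, \<open>P\<close> lies in
  \<open>add T\<close> and \<open>Q[1]\<close> receives only the zero map from
  \<open>Y\<close>.\<close>

lemma intertwines_into_extends:
  assumes Y: "Y \<in> addT" and X: "extends X e"
  shows "intertwines Y (ext Y) X e"
proof -
  obtain P Q a b t where t: "idem X e" "P \<in> addT" "Q \<in> addT" "Tri C P X (Sh C Q) a b t"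
    "e \<odot> a = a \<odot> ext P" "b \<odot> e = ShM C (ext Q) \<odot> b" using extendsE[OF X] .
  show ?thesis
    using intertwines_exact_target[OF Tri_exact[OF t(4)] t(1) ext_idem[OF Y] ext_arr[OF t(2)]
        arr_Sh[OF ext_arr[OF t(3)]] t(5,6) ext_intertwines[OF Y t(2)]]
      intertwines_zero[OF rigid[OF Y t(3)] ext_arr[OF Y] arr_Sh[OF ext_arr[OF t(3)]]] by blast
qed

text \<open>The shifted triangle has ends \<open>P[1]\<close>, which receives only zero from
  \<open>Y\<close>, and \<open>Q[2]\<close>, where maps from \<open>Y\<close> are dual to maps
  \<open>Q \<rightarrow> Y\<close>.\<close>

lemma intertwines_into_extends_Sh:
  assumes Y: "Y \<in> addT" and X: "extends X e"
  shows "intertwines Y (ext Y) (Sh C X) (ShM C e)"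
proof -
  obtain P Q a b t where t: "idem X e" "P \<in> addT" "Q \<in> addT" "Tri C P X (Sh C Q) a b t"
    "e \<odot> a = a \<odot> ext P" "b \<odot> e = ShM C (ext Q) \<odot> b" using extendsE[OF X] .
  note arr = Tri_arr[OF t(4)]
  have e: "arr e X X" using t(1) unfolding idem_def by blast
  have 1: "ShM C e \<odot> ShM C a = ShM C a \<odot> ShM C (ext P)"
    using ShM_comp[OF arr(1) e] ShM_comp[OF ext_arr[OF t(2)] arr(1)] t(5) by simp
  have 2: "ShM C b \<odot> ShM C e = ShM C (ShM C (ext Q)) \<odot> ShM C b"
    using ShM_comp[OF e arr(2)] ShM_comp[OF arr(2) arr_Sh[OF ext_arr[OF t(3)]]] t(6) by simp
  show ?thesis
    using intertwines_exact_target[OF Tri_exact_Sh[OF t(4)] idem_Sh[OF t(1)] ext_idem[OF Y]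
        arr_Sh[OF ext_arr[OF t(2)]] arr_Sh[OF arr_Sh[OF ext_arr[OF t(3)]]] 1 2
        intertwines_zero[OF rigid[OF Y t(2)] ext_arr[OF Y] arr_Sh[OF ext_arr[OF t(2)]]]
        ext_intertwines_Sh2[OF Y t(3)]] .
qed

text \<open>Duality at \<open>Z[1]\<close> leads to maps \<open>Y \<rightarrow> Z[3]\<close>, and
  \<open>Z[3]\<close> is the shift of an object whose extension is known.\<close>

lemma intertwines_Sh_add:
  assumes Y: "Y \<in> addT" and Z: "Z \<in> addT"
  shows "intertwines (Sh C Z) (ShM C (ext Z)) Y (ext Y)"
  using calabi_yau_intertwines[OF arr_Sh[OF ext_arr[OF Z]] ext_arr[OF Y]]
    intertwines_into_extends_Sh[OF Y extends_Sh2[OF Z]] by blast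

lemma intertwines_Sh_into_extends:
  assumes Y: "Y \<in> addT" and X: "extends X e"
  shows "intertwines (Sh C Y) (ShM C (ext Y)) X e"
proof -
  obtain P Q a b t where t: "idem X e" "P \<in> addT" "Q \<in> addT" "Tri C P X (Sh C Q) a b t"
    "e \<odot> a = a \<odot> ext P" "b \<odot> e = ShM C (ext Q) \<odot> b" using extendsE[OF X] .
  show ?thesis
    using intertwines_exact_target[OF Tri_exact[OF t(4)] t(1) idem_Sh[OF ext_idem[OF Y]] ext_arr[OF t(2)]
        arr_Sh[OF ext_arr[OF t(3)]] t(5,6) intertwines_Sh_add[OF t(2) Y]
        intertwines_Sh[OF ext_arr[OF Y] ext_arr[OF t(3)] ext_intertwines[OF Y t(3)]]] .
qed

lemma extends_intertwines:
  assumes X: "extends X e" and Y: "extends Y e'"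
  shows "intertwines X e Y e'"
proof -
  obtain P Q a b t where t: "idem X e" "P \<in> addT" "Q \<in> addT" "Tri C P X (Sh C Q) a b t"
    "e \<odot> a = a \<odot> ext P" "b \<odot> e = ShM C (ext Q) \<odot> b" using extendsE[OF X] .
  have e': "idem Y e'" using Y unfolding extends_def by blast
  show ?thesis
    using intertwines_exact_source[OF Tri_exact[OF t(4)] t(1) e' ext_arr[OF t(2)]
        arr_Sh[OF ext_arr[OF t(3)]] t(5,6) intertwines_into_extends[OF t(2) Y]
        intertwines_Sh_into_extends[OF t(3) Y]] .
qed

text \<open>The shifted triangle of \<open>X\<close> has ends \<open>P[1]\<close> and
  \<open>Q[2]\<close>. On \<open>Q[2]\<close> the twice shifted \<open>ext Q\<close> is again an
  extension, so naturality between extensions covers that end.\<close>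

lemma extends_Sh_intertwines:
  assumes X: "extends X e" and Y: "extends Y e'"
  shows "intertwines (Sh C X) (ShM C e) Y e'"
proof -
  obtain P Q a b t where t: "idem X e" "P \<in> addT" "Q \<in> addT" "Tri C P X (Sh C Q) a b t"
    "e \<odot> a = a \<odot> ext P" "b \<odot> e = ShM C (ext Q) \<odot> b" using extendsE[OF X] .
  note arr = Tri_arr[OF t(4)]
  have e: "arr e X X" using t(1) unfolding idem_def by blast
  have e': "idem Y e'" using Y unfolding extends_def by blast
  have 1: "ShM C e \<odot> ShM C a = ShM C a \<odot> ShM C (ext P)"
    using ShM_comp[OF arr(1) e] ShM_comp[OF ext_arr[OF t(2)] arr(1)] t(5) by simp
  have 2: "ShM C b \<odot> ShM C e = ShM C (ShM C (ext Q)) \<odot> ShM C b"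
    using ShM_comp[OF e arr(2)] ShM_comp[OF arr(2) arr_Sh[OF ext_arr[OF t(3)]]] t(6) by simp
  show ?thesis
    using intertwines_exact_source[OF Tri_exact_Sh[OF t(4)] idem_Sh[OF t(1)] e'
        arr_Sh[OF ext_arr[OF t(2)]] arr_Sh[OF arr_Sh[OF ext_arr[OF t(3)]]] 1 2
        intertwines_Sh_into_extends[OF t(2) Y] extends_intertwines[OF extends_Sh2[OF t(3)] Y]] .
qed

lemma extends_Sh_eq:
  assumes X: "extends X e" and Y: "extends (Sh C X) e'"
  shows "e' = ShM C e"
proof -
  have e: "arr e X X" "arr e' (Sh C X) (Sh C X)" using X Y unfolding extends_def idem_def by blast+
  have "e' \<odot> Id C (Sh C X) = Id C (Sh C X) \<odot> ShM C e"
    using extends_Sh_intertwines[OF X Y] arr_Id[OF arrD(1)[OF e(2)]] unfolding intertwines_def by blast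
  thus ?thesis using comp_Id_left[OF arr_Sh[OF e(1)]] comp_Id_right[OF e(2)] by simp
qed

lemma extends_T_eq:
  assumes "extends T e"
  shows "e = f"
proof -
  have e: "arr e T T" using assms unfolding extends_def idem_def by blast
  have "e \<odot> Id C T = Id C T \<odot> f"
    using intertwines_into_extends[OF add_closure.base assms] arr_Id[OF T_in]
    unfolding ext_T intertwines_def by blast
  thus ?thesis using comp_Id_left[OF f_arr] comp_Id_right[OF e] by simp
qed

text \<open>Vanishing at both ends gives \<open>d = w b\<close> and so
  \<open>d d = w (b d) = 0\<close>; only idempotency turns this into \<open>d = 0\<close>.\<close>

lemma idem_eq_0_if_exact:
  assumes ex: "exact_at A X B a b" and d: "idem X d" and z: "d \<odot> a = 0" "b \<odot> d = 0"
  shows "d = 0"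
proof -
  have da: "arr d X X" "d \<odot> d = d" using d unfolding idem_def by auto
  obtain w where w: "arr w B X" "d = w \<odot> b" using ex z(1) da(1) unfolding exact_at_def by blast
  have b: "arr b X B" using ex unfolding exact_at_def by blast
  have "d = w \<odot> b \<odot> d" using w(2) da(2) by simp
  also have "\<dots> = 0" using comp_assoc[OF da(1) b w(1)] z(2) comp_zero_right[OF w(1)] by simp
  finally show ?thesis .
qed

text \<open>A value \<open>0\<close> or identity at \<open>T'\<close> spreads to
  \<open>add T'\<close>, and from \<open>Q\<close> to \<open>Q[1]\<close> because extensions commute
  with the shift. Then \<open>f\<close>, respectively \<open>Id C T - f\<close>, is an idempotent
  that vanishes at both ends of a triangle around \<open>T\<close>.\<close>

lemma extends_other_tilting:
  assumes ct': "cluster_tilting C T'" and e: "extends T' e"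
  shows "e = 0 \<Longrightarrow> f = 0" "e = Id C T' \<Longrightarrow> f = Id C T"
proof -
  have T': "T' \<in> Obj C" using ct' unfolding cluster_tilting_def by blast
  obtain P Q a b t where t: "P \<in> add_closure C T'" "Q \<in> add_closure C T'" "Tri C P T (Sh C Q) a b t"
    using ct' T_in unfolding cluster_tilting_def by blast
  note arr = Tri_arr[OF t(3)]
  have PQ: "P \<in> Obj C" "Id C P \<in> thru T' P P" "Q \<in> Obj C" "Id C Q \<in> thru T' Q Q"
    using add_closure_thru[OF T'] t by blast+
  obtain u v v' h where u: "extends P u" and v: "extends Q v" and v': "extends (Sh C Q) v'"
    and h: "extends T h" using extends_exists PQ Sh_in T_in by metis
  have ua: "arr u P P" "arr v Q Q" "arr v' (Sh C Q) (Sh C Q)"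
    using u v v' unfolding extends_def idem_def by blast+
  have ea: "arr e T' T'" using e unfolding extends_def idem_def by blast
  have fa: "f \<odot> a = a \<odot> u" "b \<odot> f = ShM C v \<odot> b"
    using extends_intertwines[OF u h] extends_intertwines[OF h v'] arr extends_T_eq[OF h] extends_Sh_eq[OF v v']
    unfolding intertwines_def by metis+
  have nat: "u \<odot> y = y \<odot> e" if "arr y T' Y" "extends Y u" for y Y u
    using extends_intertwines[OF e that(2)] that(1) unfolding intertwines_def by blast
  have f: "arr f T T" "f \<odot> f = f" using f_idem unfolding idem_def by auto
  show "f = 0" if "e = 0"
  proof -
    have "u = 0" using eq_0_if_thru_right[OF PQ(2) ua(1)] nat[OF _ u] comp_zero_right that by metis
    moreover have "v = 0" using eq_0_if_thru_right[OF PQ(4) ua(2)] nat[OF _ v] comp_zero_right that by metis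
    ultimately have "f \<odot> a = 0" "b \<odot> f = 0"
      using fa comp_zero_right[OF arr(1)] comp_zero_left[OF arr(2)] ShM_zero[OF PQ(3,3)] by simp_all
    thus ?thesis using idem_eq_0_if_exact[OF Tri_exact[OF t(3)] f_idem] by blast
  qed
  show "f = Id C T" if eI: "e = Id C T'"
  proof -
    have one: "u = Id C Y" if "arr u Y Y" "extends Y u" "Id C Y \<in> thru T' Y Y" for u Y
    proof -
      have Y: "Y \<in> Obj C" using that(1) arrD by blast
      have "(u - Id C Y) \<odot> y = 0" if y: "arr y T' Y" for y
        using comp_diff_left[OF y \<open>arr u Y Y\<close> arr_Id[OF Y]] nat[OF y \<open>extends Y u\<close>]
          comp_Id_left[OF y] comp_Id_right[OF y] eI by simp
      hence "u - Id C Y = 0"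
        by (rule eq_0_if_thru_right[OF that(3) arr_diff[OF that(1) arr_Id[OF Y]]])
      thus ?thesis by simp
    qed
    have uv: "u = Id C P" "v = Id C Q" using one ua u v PQ by blast+
    hence f1: "f \<odot> a = a" "b \<odot> f = b"
      using fa comp_Id_right[OF arr(1)] comp_Id_left[OF arr(2)] ShM_Id[OF PQ(3)] by simp_all
    let ?g = "Id C T - f"
    note I = arr_Id[OF T_in]
    note g = arr_diff[OF I f(1)]
    have "?g \<odot> a = 0" "b \<odot> ?g = 0"
      using comp_diff_left[OF arr(1) I f(1)] comp_diff_right[OF I f(1) arr(2)] f1
        comp_Id_left[OF arr(1)] comp_Id_right[OF arr(2)] by simp_all
    moreover have "?g \<odot> ?g = ?g"
      using comp_diff_left[OF g I f(1)] comp_diff_right[OF I f(1) f(1)] comp_Id_left[OF g]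
        comp_Id_right[OF f(1)] f(2) by simp
    hence "idem T ?g" using g unfolding idem_def by blast
    ultimately have "?g = 0" using idem_eq_0_if_exact[OF Tri_exact[OF t(3)]] by blast
    thus ?thesis by simp
  qed
qed

end

section \<open>Connectedness does not depend on the cluster tilting object\<close>

lemma (in hom_finite_category) End_alg_fd_algebra:
  assumes X: "X \<in> Obj C"
  shows "fd_algebra (End_alg C X)"
proof -
  have arr: "x \<in> carr (End_alg C X) \<longleftrightarrow> arr x X X" for x
    using X by (simp add: End_alg_def arr_def)
  show ?thesis
  proof (intro fd_algebra.intro fd_algebra_axioms.intro)
    show "vector_space (scal (End_alg C X))"
      using vector_space_axioms by (simp add: End_alg_def)
  next
    show "module.subspace (scal (End_alg C X)) (carr (End_alg C X))"
      using Hom_subspace[OF X X] by (simp add: End_alg_def)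
  next
    show "\<exists>B. finite B \<and> module.span (scal (End_alg C X)) B = carr (End_alg C X)"
      using hom_finite[OF X X] by (simp add: End_alg_def)
  qed (use X in \<open>auto simp: End_alg_def Id_in Comp_in Comp_assoc Id_left Id_right
    Comp_add_left Comp_add_right Comp_scal_left Comp_scal_right\<close>)
qed

lemma (in hom_finite_category) connected_End_alg_iff:
  assumes X: "X \<in> Obj C"
  shows "connected_quiver (gabriel_quiver (End_alg C X)) \<longleftrightarrow>
    Id C X \<noteq> 0 \<and> (\<forall>e. idem X e \<and> intertwines X e X e \<longrightarrow> e = 0 \<or> e = Id C X)"
proof -
  interpret E: fd_algebra "End_alg C X" using End_alg_fd_algebra[OF X] .
  have "E.central_idempotent e \<longleftrightarrow> idem X e \<and> intertwines X e X e" for e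
    unfolding E.central_idempotent_def idempotent_def idem_def intertwines_def arr_def
    using X by (auto simp: End_alg_def)
  thus ?thesis
    using E.connected_gabriel_quiver_iff by (simp add: End_alg_def)
qed

lemma (in two_calabi_yau_category) connected_transfer:
  assumes T: "cluster_tilting C T" and T': "cluster_tilting C T'"
    and conn: "connected_quiver (gabriel_quiver (End_alg C T'))"
  shows "connected_quiver (gabriel_quiver (End_alg C T))"
proof -
  have TO: "T \<in> Obj C" "T' \<in> Obj C" using T T' unfolding cluster_tilting_def by auto
  \<comment> \<open>The pair \<open>U\<close>, \<open>V\<close> is kept general because transfer is
    needed both ways: from \<open>T\<close> to \<open>T'\<close> for the central idempotents, and
    back to exclude a zero \<open>T\<close>.\<close>
  have transfer: "\<exists>e. idem V e \<and> intertwines V e V e \<and> (e = 0 \<longrightarrow> f = 0) \<and> (e = Id C V \<longrightarrow> f = Id C U)"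
    if f: "idem U f" "intertwines U f U f" and UV: "cluster_tilting C U" "cluster_tilting C V" for U V f
  proof -
    interpret cluster_tilting_idempotent C U f by unfold_locales (use f UV in auto)
    have "V \<in> Obj C" using UV(2) unfolding cluster_tilting_def by blast
    then obtain e where e: "extends V e" using extends_exists by blast
    show ?thesis
      using extends_intertwines[OF e e] extends_other_tilting[OF UV(2) e] e unfolding extends_def by blast
  qed
  note conn' = conn[unfolded connected_End_alg_iff[OF TO(2)]]
  have "Id C T \<noteq> 0"
  proof
    \<comment> \<open>The identity of \<open>T'\<close> extends to a zero morphism on a zero object
      \<open>T\<close>, which would force \<open>T'\<close> to be zero as well.\<close>
    assume 0: "Id C T = 0"
    have I: "arr (Id C T') T' T'" using arr_Id TO by blast
    have "idem T' (Id C T')" "intertwines T' (Id C T') T' (Id C T')"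
      using I comp_Id_left comp_Id_right unfolding idem_def intertwines_def by auto
    then obtain e where e: "idem T e" "e = 0 \<longrightarrow> Id C T' = 0"
      using transfer[OF _ _ T' T] by blast
    hence "arr e T T" unfolding idem_def by blast
    hence "e = 0" using comp_Id_left[of e T T] comp_zero_left[of e T T] 0 by simp
    thus False using e(2) conn' by blast
  qed
  moreover have "f = 0 \<or> f = Id C T" if "idem T f" "intertwines T f T f" for f
    using transfer[OF that T T'] conn' by blast
  ultimately show ?thesis using connected_End_alg_iff[OF TO(1)] by blast
qed

theorem corollary3p16:
  fixes C :: "('o, 'm::ab_group_add, 'k::field) tri_cat" and T T' :: 'o
  assumes "two_calabi_yau_category C"
    and "cluster_tilting C T"
    and "cluster_tilting C T'"
  shows "connected_quiver (gabriel_quiver (End_alg C T)) \<longleftrightarrow>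
         connected_quiver (gabriel_quiver (End_alg C T'))"
proof -
  interpret two_calabi_yau_category C using assms(1) .
  show ?thesis using connected_transfer assms(2,3) by blast
qed

end
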